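(* Let $(\mathbb{X},\mathfrak{d})$ be a compact metric space, $d\in\mathbb{N}$, and $B=\mathcal{C}(\mathbb{X};\mathbb{R}^d)$ with the supremum norm. Then $\xi$ is a continuous $d$-variate Gaussian process on $\mathbb{X}$ with zero mean function and covariance function $k:\mathbb{X}\times\mathbb{X}\to\mathbb{R}^{d\times d}$ if and only if $\xi$ is a centered Gaussian random element in the separable Banach space $B$ with covariance operator $K_\xi:B^*\to B$, where $k$ and $K_\xi$ are related as follows. The covariance operator is obtained from the covariance function by \[ K_\xi L=\Bigl[y\in\mathbb{X}\mapsto\Bigl(\sum_{k'=1}^{d}\int_{\mathbb{X}}k(x,y)_{k'l}\,\mu_{k'}(dx)\Bigr)_{l=1,\dots,d}\Bigr],\qquad L\in B^*, \] where $\mu_1,\dots,\mu_d$ are the finite signed Borel measures on $\mathbb{X}$ representing $L$, i.e. $L(f)=\sum_{i=1}^d\int_{\mathbb{X}}f_i(x)\,\mu_i(dx)$ for all $f=(f_1,\dots,f_d)\in B$. Conversely, given the covariance operator $K_\xi$, the covariance function is \[ k(x,y)=\bigl(\langle K_\xi\delta_x^{k'},\delta_y^{l}\rangle\bigr)_{k',l=1}^{d},\qquad x,y\in\mathbb{X}, \] where $\delta_x^{k'}:=\pi_{k'}\circ\delta_x\in B^*$, i.e. $\delta_x^{k'}(f)=f_{k'}(x)$, for $x\in\mathbb{X}$ and $k'\in\{1,\dots,d\}$.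
   Context: A $d$-variate Gaussian process is an $\mathbb{R}^d$-valued process whose finite-dimensional distributions are (possibly degenerate) Gaussian; "continuous" means that it has continuous sample paths. Its mean function is $m(x)=\mathbb{E}[\xi(x)]$ and its matrix covariance function is $k(x,y)=\mathbb{E}[(\xi(x)-m(x))(\xi(y)-m(y))^\top]$. A random element $X$ of a separable Banach space $B$ is Gaussian if $\langle X,L\rangle$ is a (possibly degenerate) Gaussian variable for every $L\in B^*$, where $\langle\cdot,\cdot\rangle$ is the duality bracket; it is centered if its Bochner expectation $\mathbb{E}[X]$ is $0$. The covariance operator of a centered Gaussian random element $X$ is $K_X:B^*\to B$, $K_XL=\mathbb{E}[\langle X,L\rangle X]$ (Bochner integral). *)

theory Defs
  imports "HOL-Probability.Probability"
begin

section \<open>The separable Banach space of continuous functions on a compact metric space\<close>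

class compact_metric_space = metric_space +
  assumes compact_UNIV: "compact (UNIV :: 'a set)"

text \<open>
  Over a compact space every continuous function is bounded, so \<open>'x \<Rightarrow>\<^sub>C (real ^ 'd)\<close> is the full
  space of continuous functions with the supremum norm.
\<close>

lemma continuous_in_bcontfun:
  fixes f :: "'x::compact_metric_space \<Rightarrow> 'b::metric_space"
  assumes "continuous_on UNIV f"
  shows "f \<in> bcontfun"
  using assms compact_continuous_image[OF assms compact_UNIV]
  by (auto simp: bcontfun_def compact_imp_bounded)

instance bcontfun :: (metric_space, banach) banach ..

text \<open>
  Separability of the space, stated as second countability.  The library's Bochner integral is
  available for type class \<open>second_countable_topology\<close> only.
\<close>

lemma bcontfun_countable_dense:
  "\<exists>D :: ('x::compact_metric_space \<Rightarrow>\<^sub>C 'b::{metric_space,second_countable_topology}) set.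
     countable D \<and> (\<forall>f. \<forall>e>0. \<exists>g\<in>D. dist f g < e)"
proof -
  obtain Q :: "'b set" where Q: "countable Q" "\<And>X. open X \<Longrightarrow> X \<noteq> {} \<Longrightarrow> \<exists>d\<in>Q. d \<in> X"
    using countable_dense_setE by blast
  have "\<exists>F. finite F \<and> (UNIV::'x set) \<subseteq> (\<Union>p\<in>F. ball p (1 / Suc n))" for n
  proof -
    have "0 < 1 / real (Suc n)" by simp
    then show ?thesis
      using compact_UNIV[where 'a='x] unfolding compact_eq_totally_bounded by blast
  qed
  then obtain F :: "nat \<Rightarrow> 'x set" where F: "\<And>n. finite (F n)"
    "\<And>n. UNIV \<subseteq> (\<Union>p\<in>F n. ball p (1 / Suc n))" by metis
  define C :: "nat \<Rightarrow> nat \<Rightarrow> ('x \<Rightarrow> 'b) \<Rightarrow> ('x \<Rightarrow>\<^sub>C 'b) \<Rightarrow> bool"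
    where "C m n q f \<longleftrightarrow> (\<forall>x y. dist x y < 1 / Suc n \<longrightarrow> dist (apply_bcontfun f x) (apply_bcontfun f y) < 1 / Suc m)
       \<and> (\<forall>p\<in>F n. dist (apply_bcontfun f p) (q p) < 1 / Suc m)" for m n q f
  define I where "I = (SIGMA m:(UNIV :: nat set). SIGMA n:(UNIV :: nat set). PiE (F n) (\<lambda>_. Q))"
  have cI: "countable I"
    unfolding I_def using F(1) Q(1) by (intro countable_SIGMA countable_PiE) auto
  define D where "D = (\<lambda>(m,n,q). SOME f. C m n q f) ` I"
  have "\<exists>g\<in>D. dist f g < e" if "e > 0" for f :: "'x \<Rightarrow>\<^sub>C 'b" and e
  proof -
    obtain m where m: "4 / Suc m < e"
      using reals_Archimedean[of "e/4"] \<open>e > 0\<close> by (auto simp: field_simps)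
    have "uniformly_continuous_on UNIV (apply_bcontfun f)"
      by (rule compact_uniformly_continuous) (auto simp: compact_UNIV)
    then obtain d where d: "d > 0"
      "\<And>x y. dist x y < d \<Longrightarrow> dist (apply_bcontfun f x) (apply_bcontfun f y) < 1 / Suc m"
      unfolding uniformly_continuous_on_def
      by (metis UNIV_I dist_commute of_nat_0_less_iff zero_less_Suc zero_less_divide_1_iff)
    obtain n where n: "1 / Suc n < d"
      using reals_Archimedean[OF d(1)] by (auto simp: field_simps)
    have "\<exists>a\<in>Q. dist (apply_bcontfun f p) a < 1 / Suc m" for p
      using Q(2)[of "ball (apply_bcontfun f p) (1 / Suc m)"] by (auto simp: mem_ball)
    then obtain q0 where q0: "\<And>p. q0 p \<in> Q" "\<And>p. dist (apply_bcontfun f p) (q0 p) < 1 / Suc m"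
      by metis
    define q where "q = restrict q0 (F n)"
    have qI: "(m,n,q) \<in> I" using q0(1) by (auto simp: I_def q_def)
    have Cf: "C m n q f" using d(2) n q0(2) by (auto simp: C_def q_def)
    define g where "g = (SOME f. C m n q f)"
    have Cg: "C m n q g" unfolding g_def using Cf by (rule someI)
    have "dist (apply_bcontfun f x) (apply_bcontfun g x) \<le> 4 / Suc m" for x
    proof -
      obtain p where p: "p \<in> F n" "dist p x < 1 / Suc n"
        using subsetD[OF F(2)[of n] UNIV_I[of x]] by (auto simp: mem_ball)
      have "dist (apply_bcontfun f p) (apply_bcontfun f x) < 1 / Suc m"
        "dist (apply_bcontfun g p) (apply_bcontfun g x) < 1 / Suc m"
        "dist (apply_bcontfun f p) (q p) < 1 / Suc m"
        "dist (apply_bcontfun g p) (q p) < 1 / Suc m"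
        using Cf Cg p by (auto simp: C_def)
      moreover have "dist (apply_bcontfun f x) (apply_bcontfun g x) \<le>
         dist (apply_bcontfun f p) (apply_bcontfun f x) + dist (apply_bcontfun f p) (q p)
         + dist (apply_bcontfun g p) (q p) + dist (apply_bcontfun g p) (apply_bcontfun g x)"
        using dist_triangle[of "apply_bcontfun f x" "apply_bcontfun g x" "apply_bcontfun f p"]
          dist_triangle[of "apply_bcontfun f p" "apply_bcontfun g x" "q p"]
          dist_triangle[of "q p" "apply_bcontfun g x" "apply_bcontfun g p"]
        by (simp add: dist_commute)
      moreover have "4 / real (Suc m) = 1 / Suc m + 1 / Suc m + 1 / Suc m + 1 / Suc m" by simp
      ultimately show ?thesis by linarith
    qed
    then have "dist f g \<le> 4 / Suc m" by (rule dist_bound)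
    then show ?thesis using m qI unfolding D_def g_def by force
  qed
  moreover have "countable D" unfolding D_def using cI by simp
  ultimately show ?thesis by blast
qed

instance bcontfun :: (compact_metric_space, "{metric_space,second_countable_topology}")
  second_countable_topology
proof
  obtain D :: "('a \<Rightarrow>\<^sub>C 'b) set" where D: "countable D" "\<And>f e. e > 0 \<Longrightarrow> \<exists>g\<in>D. dist f g < e"
    using bcontfun_countable_dense by blast
  define B where "B = (\<lambda>(g,n::nat). ball g (1 / Suc n)) ` (D \<times> UNIV)"
  have "countable B" unfolding B_def using D(1) by auto
  moreover have "topological_basis B"
  proof (rule topological_basisI)
    show "open S" if "S \<in> B" for S using that by (auto simp: B_def)
    fix S :: "('a \<Rightarrow>\<^sub>C 'b) set" and f assume S: "open S" "f \<in> S"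
    then obtain e where e: "e > 0" "ball f e \<subseteq> S" using openE by blast
    obtain n where n: "2 / Suc n < e"
      using reals_Archimedean[of "e/2"] e(1) by (auto simp: field_simps)
    obtain g where g: "g \<in> D" "dist f g < 1 / Suc n" using D(2)[of "1 / Suc n" f] by auto
    have "ball g (1 / Suc n) \<subseteq> ball f e"
    proof
      fix h assume "h \<in> ball g (1 / Suc n)"
      then have "dist f h < 1 / Suc n + 1 / Suc n"
        using g dist_triangle[of f h g] by (simp add: mem_ball)
      then show "h \<in> ball f e" using n by (simp add: mem_ball)
    qed
    then show "\<exists>B'\<in>B. f \<in> B' \<and> B' \<subseteq> S"
      using g e(2) unfolding B_def by (intro bexI[of _ "ball g (1 / Suc n)"])
        (auto simp: mem_ball dist_commute)
  qed
  ultimately show "\<exists>B :: ('a \<Rightarrow>\<^sub>C 'b) set set. countable B \<and> open = generate_topology B"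
    using topological_basis_imp_subbasis by blast
qed

section \<open>Gaussian processes\<close>

text \<open>Univariate Gaussian laws, including the degenerate ones.\<close>

definition gaussian_law :: "real measure \<Rightarrow> bool" where
  "gaussian_law N \<longleftrightarrow>
     (\<exists>m. N = return borel m) \<or>
     (\<exists>m s. s > 0 \<and> N = density lborel (normal_density m s))"

definition fdd :: "'w measure \<Rightarrow> ('w \<Rightarrow> 'x \<Rightarrow> real ^ 'd) \<Rightarrow> 'x set \<Rightarrow> ('x \<Rightarrow> real ^ 'd) measure" where
  "fdd M \<xi> J = distr M (\<Pi>\<^sub>M x\<in>J. borel) (\<lambda>\<omega>. \<lambda>x\<in>J. \<xi> \<omega> x)"

text \<open>
  A possibly degenerate Gaussian law on the finite-dimensional space \<open>(\<real>\<^sup>d)\<^sup>J\<close>: all linear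
  functionals are Gaussian.
\<close>

definition gaussian_law_on :: "'x set \<Rightarrow> ('x \<Rightarrow> real ^ 'd) measure \<Rightarrow> bool" where
  "gaussian_law_on J N \<longleftrightarrow>
     (\<forall>a :: 'x \<Rightarrow> real ^ 'd. gaussian_law (distr N borel (\<lambda>v. \<Sum>x\<in>J. a x \<bullet> v x)))"

definition continuous_gaussian_process ::
    "'w measure \<Rightarrow> ('w \<Rightarrow> 'x::topological_space \<Rightarrow> real ^ 'd) \<Rightarrow> bool" where
  "continuous_gaussian_process M \<xi> \<longleftrightarrow>
     (\<forall>x. (\<lambda>\<omega>. \<xi> \<omega> x) \<in> borel_measurable M) \<and>
     (\<forall>J. finite J \<longrightarrow> gaussian_law_on J (fdd M \<xi> J)) \<and>
     (\<forall>\<omega>\<in>space M. continuous_on UNIV (\<xi> \<omega>))"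

definition mean_function :: "'w measure \<Rightarrow> ('w \<Rightarrow> 'x \<Rightarrow> real ^ 'd) \<Rightarrow> 'x \<Rightarrow> real ^ 'd" where
  "mean_function M \<xi> x = (\<integral>\<omega>. \<xi> \<omega> x \<partial>M)"

definition covariance_function ::
    "'w measure \<Rightarrow> ('w \<Rightarrow> 'x \<Rightarrow> real ^ 'd) \<Rightarrow> 'x \<Rightarrow> 'x \<Rightarrow> real ^ 'd ^ 'd" where
  "covariance_function M \<xi> x y =
     (\<chi> i j. \<integral>\<omega>. (\<xi> \<omega> x - mean_function M \<xi> x) $ i * (\<xi> \<omega> y - mean_function M \<xi> y) $ j \<partial>M)"

section \<open>Gaussian random elements of a separable Banach space\<close>

definition gaussian_element ::
    "'w measure \<Rightarrow> ('w \<Rightarrow> 'b::{banach,second_countable_topology}) \<Rightarrow> bool" where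
  "gaussian_element M X \<longleftrightarrow>
     X \<in> borel_measurable M \<and>
     (\<forall>L :: 'b \<Rightarrow>\<^sub>L real. gaussian_law (distr M borel (\<lambda>\<omega>. blinfun_apply L (X \<omega>))))"

definition centered :: "'w measure \<Rightarrow> ('w \<Rightarrow> 'b::{banach,second_countable_topology}) \<Rightarrow> bool" where
  "centered M X \<longleftrightarrow> has_bochner_integral M X 0"

definition has_covariance_operator ::
    "'w measure \<Rightarrow> ('w \<Rightarrow> 'b::{banach,second_countable_topology}) \<Rightarrow> (('b \<Rightarrow>\<^sub>L real) \<Rightarrow> 'b) \<Rightarrow> bool" where
  "has_covariance_operator M X K \<longleftrightarrow>
     (\<forall>L. has_bochner_integral M (\<lambda>\<omega>. blinfun_apply L (X \<omega>) *\<^sub>R X \<omega>) (K L))"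

section \<open>Finite signed Borel measures\<close>

text \<open>
  A finite signed measure is a countably additive real-valued function on the Borel sets; integrals
  are taken via the Jordan decomposition.
\<close>

definition finite_signed_measure :: "('x::topological_space set \<Rightarrow> real) \<Rightarrow> bool" where
  "finite_signed_measure \<nu> \<longleftrightarrow>
     \<nu> {} = 0 \<and>
     (\<forall>A :: nat \<Rightarrow> 'x set. range A \<subseteq> sets borel \<longrightarrow> disjoint_family A \<longrightarrow>
        (\<lambda>n. \<nu> (A n)) sums \<nu> (\<Union>n. A n))"

text \<open>
  Negative values are truncated to \<open>0\<close> by \<^const>\<open>ennreal\<close>; as \<open>\<nu> {} = 0\<close>, this does not affect
  the supremum.
\<close>

definition pos_variation :: "('x::topological_space set \<Rightarrow> real) \<Rightarrow> 'x measure" where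
  "pos_variation \<nu> =
     measure_of UNIV (sets borel) (\<lambda>A. SUP B\<in>{B \<in> sets borel. B \<subseteq> A}. ennreal (\<nu> B))"

definition neg_variation :: "('x::topological_space set \<Rightarrow> real) \<Rightarrow> 'x measure" where
  "neg_variation \<nu> = pos_variation (\<lambda>A. - \<nu> A)"

definition signed_integrable :: "('x::topological_space set \<Rightarrow> real) \<Rightarrow> ('x \<Rightarrow> real) \<Rightarrow> bool" where
  "signed_integrable \<nu> f \<longleftrightarrow> integrable (pos_variation \<nu>) f \<and> integrable (neg_variation \<nu>) f"

definition signed_integral :: "('x::topological_space set \<Rightarrow> real) \<Rightarrow> ('x \<Rightarrow> real) \<Rightarrow> real" where
  "signed_integral \<nu> f = (\<integral>x. f x \<partial>pos_variation \<nu>) - (\<integral>x. f x \<partial>neg_variation \<nu>)"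

definition represents ::
    "('d \<Rightarrow> 'x set \<Rightarrow> real) \<Rightarrow> (('x::topological_space \<Rightarrow>\<^sub>C (real ^ 'd)) \<Rightarrow>\<^sub>L real) \<Rightarrow> bool" where
  "represents \<mu> L \<longleftrightarrow>
     (\<forall>i. finite_signed_measure (\<mu> i)) \<and>
     (\<forall>f. blinfun_apply L f = (\<Sum>i\<in>UNIV. signed_integral (\<mu> i) (\<lambda>x. apply_bcontfun f x $ i)))"

section \<open>Covariance functions and covariance operators\<close>

lift_definition eval_functional ::
    "'x::topological_space \<Rightarrow> 'd \<Rightarrow> (('x \<Rightarrow>\<^sub>C (real ^ 'd)) \<Rightarrow>\<^sub>L real)" is
  "\<lambda>x i f. apply_bcontfun f x $ i"
proof (rule bounded_linear_intro[where K=1])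
  fix x :: 'x and i :: 'd and f :: "'x \<Rightarrow>\<^sub>C (real ^ 'd)"
  show "norm (apply_bcontfun f x $ i) \<le> norm f * 1"
    using component_le_norm_cart[of "apply_bcontfun f x" i] norm_bounded[of f x] by simp
qed (auto simp: plus_bcontfun.rep_eq scaleR_bcontfun.rep_eq)

definition operator_from_function ::
    "('x \<Rightarrow> 'x \<Rightarrow> real ^ 'd ^ 'd) \<Rightarrow>
     ((('x::topological_space \<Rightarrow>\<^sub>C (real ^ 'd)) \<Rightarrow>\<^sub>L real) \<Rightarrow> ('x \<Rightarrow>\<^sub>C (real ^ 'd))) \<Rightarrow> bool" where
  "operator_from_function k K \<longleftrightarrow>
     (\<forall>L \<mu>. represents \<mu> L \<longrightarrow>
        (\<forall>y l. (\<forall>i. signed_integrable (\<mu> i) (\<lambda>x. k x y $ i $ l)) \<and>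
               apply_bcontfun (K L) y $ l =
                 (\<Sum>i\<in>UNIV. signed_integral (\<mu> i) (\<lambda>x. k x y $ i $ l))))"

definition function_from_operator ::
    "('x \<Rightarrow> 'x \<Rightarrow> real ^ 'd ^ 'd) \<Rightarrow>
     ((('x::topological_space \<Rightarrow>\<^sub>C (real ^ 'd)) \<Rightarrow>\<^sub>L real) \<Rightarrow> ('x \<Rightarrow>\<^sub>C (real ^ 'd))) \<Rightarrow> bool" where
  "function_from_operator k K \<longleftrightarrow>
     (\<forall>x y. k x y =
        (\<chi> i l. blinfun_apply (eval_functional y l) (K (eval_functional x i))))"

definition centered_continuous_gp ::
    "'w measure \<Rightarrow> ('w \<Rightarrow> 'x::topological_space \<Rightarrow> real ^ 'd) \<Rightarrow>
     ('x \<Rightarrow> 'x \<Rightarrow> real ^ 'd ^ 'd) \<Rightarrow> bool" where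
  "centered_continuous_gp M \<xi> k \<longleftrightarrow>
     continuous_gaussian_process M \<xi> \<and>
     (\<forall>x. mean_function M \<xi> x = 0) \<and>
     (\<forall>x y. covariance_function M \<xi> x y = k x y)"

text \<open>The random function \<open>\<xi>\<close>, regarded as a map into the Banach space of continuous functions.\<close>

definition centered_gaussian_C_element ::
    "'w measure \<Rightarrow> ('w \<Rightarrow> 'x::compact_metric_space \<Rightarrow> real ^ 'd) \<Rightarrow>
     ((('x \<Rightarrow>\<^sub>C (real ^ 'd)) \<Rightarrow>\<^sub>L real) \<Rightarrow> ('x \<Rightarrow>\<^sub>C (real ^ 'd))) \<Rightarrow> bool" where
  "centered_gaussian_C_element M \<xi> K \<longleftrightarrow>
     (\<exists>X :: 'w \<Rightarrow> ('x \<Rightarrow>\<^sub>C (real ^ 'd)).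
        (\<forall>\<omega>\<in>space M. apply_bcontfun (X \<omega>) = \<xi> \<omega>) \<and>
        gaussian_element M X \<and> centered M X \<and> has_covariance_operator M X K)"

end

theory Submission
  imports Defs
begin

text \<open>
  From a Gaussian random element \<open>X\<close> of the space of continuous functions one passes to the process
  by applying point evaluations. Linear combinations of values are continuous linear functionals of
  \<open>X\<close>, hence Gaussian, and the covariance function consists of the numbers \<open>\<delta>' (K \<delta>)\<close> for two
  evaluations \<open>\<delta>\<close>, \<open>\<delta>'\<close>. The formula for \<open>K L\<close> follows from the symmetry
  \<open>L (K L') = E (L X * L' X) = L' (K L)\<close>: as a function of its first argument, the covariance
  function is a component of \<open>K \<delta>\<close>, and integrating it against the measures that represent \<open>L\<close> gives
  \<open>L (K \<delta>) = \<delta> (K L)\<close> (\<open>gaussian_element_is_process\<close>).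

  The converse needs more. A continuous process is a random function \<open>X\<close>, and a partition of unity
  approximates \<open>X\<close> uniformly by interpolations, which are finite sums of fixed functions with jointly
  Gaussian coefficients (\<open>finite_rank_approximation\<close>). This gives measurability. The Bochner integrals in the
  definitions of expectation and covariance operator exist because \<open>E (norm X)^2\<close> is finite, which is
  Fernique's theorem: two independent copies of a centered Gaussian vector have a rotation invariant
  joint law, and this forces the tails of the norm to decay fast once the norm is bounded with high
  probability (\<open>fernique_inequality\<close>, \<open>fernique_second_moment\<close>). The bound is uniform over
  the interpolations, hence passes to \<open>X\<close>. For a functional \<open>L\<close>, the variances of \<open>L\<close> at the
  interpolations then converge, so \<open>L X\<close> has the characteristic function of a Gaussian law
  (\<open>functional_gaussian\<close>). Rotation invariance rests on the fact that a finite-dimensional law is determined by its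
  characteristic function (\<open>char_vector_unique\<close>), obtained here from the one-dimensional uniqueness theorem
  one coordinate at a time.

  Finally, a covariance operator is recovered from the covariance function because every functional is
  represented by signed measures (\<open>riesz_representation\<close>). A functional is a difference of positive
  ones; a positive functional induces an outer measure, in which the cost of a set is the least
  total value of a series of nonnegative continuous functions that is at least \<open>1\<close> on the set, and
  Caratheodory's construction turns it into the representing Borel measure
  (\<open>integral_riesz_measure\<close>). The difference of the two measures is a signed measure whose Jordan
  decomposition yields the same integrals (\<open>signed_integral_diff\<close>).
\<close>

section \<open>Riesz representation of positive functionals on a compact metric space\<close>

definition nonneg_continuous :: "('x::topological_space \<Rightarrow> real) \<Rightarrow> bool" where
  "nonneg_continuous f \<longleftrightarrow> continuous_on UNIV f \<and> (\<forall>x. 0 \<le> f x)"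

lemma nonneg_continuous_const: "0 \<le> c \<Longrightarrow> nonneg_continuous (\<lambda>_. c)"
  by (simp add: nonneg_continuous_def)

lemma nonneg_continuous_add:
  "nonneg_continuous f \<Longrightarrow> nonneg_continuous g \<Longrightarrow> nonneg_continuous (\<lambda>x. f x + g x)"
  by (auto simp: nonneg_continuous_def intro!: continuous_intros)

lemma nonneg_continuous_mult:
  "nonneg_continuous f \<Longrightarrow> nonneg_continuous g \<Longrightarrow> nonneg_continuous (\<lambda>x. f x * g x)"
  by (auto simp: nonneg_continuous_def intro!: continuous_intros)

lemma nonneg_continuous_sum:
  "(\<And>i. i \<in> I \<Longrightarrow> nonneg_continuous (f i)) \<Longrightarrow> nonneg_continuous (\<lambda>x. \<Sum>i\<in>I. f i x)"
  by (auto simp: nonneg_continuous_def intro!: continuous_intros sum_nonneg)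

lemma nonneg_continuous_diff:
  "nonneg_continuous f \<Longrightarrow> nonneg_continuous g \<Longrightarrow> (\<And>x. g x \<le> f x) \<Longrightarrow>
     nonneg_continuous (\<lambda>x. f x - g x)"
  by (auto simp: nonneg_continuous_def intro!: continuous_intros)

lemma continuous_real_bounded:
  fixes f :: "'x::compact_metric_space \<Rightarrow> real"
  assumes "continuous_on UNIV f"
  obtains b where "\<And>x. \<bar>f x\<bar> \<le> b"
proof -
  have "bounded (range f)"
    using compact_continuous_image[OF assms compact_UNIV] by (rule compact_imp_bounded)
  then show thesis using that by (auto simp: bounded_iff)
qed

lemma nonneg_continuous_shift:
  fixes f :: "'x::compact_metric_space \<Rightarrow> real"
  assumes "continuous_on UNIV f"
  obtains b where "0 \<le> b" "nonneg_continuous (\<lambda>x. f x + b)"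
proof -
  obtain b where b: "\<And>x. \<bar>f x\<bar> \<le> b" using continuous_real_bounded[OF assms] by blast
  have "0 \<le> b" using order_trans[OF abs_ge_zero b[of undefined]] .
  moreover have "0 \<le> f x + b" for x using b[of x] by linarith
  then have "nonneg_continuous (\<lambda>x. f x + b)"
    using assms by (simp add: nonneg_continuous_def continuous_on_add)
  ultimately show thesis by (rule that)
qed

lemma integrable_continuous_bounded:
  fixes f :: "'x::compact_metric_space \<Rightarrow> real"
  assumes "finite_measure M" "sets M = sets borel" "continuous_on UNIV f"
  shows "integrable M f"
proof -
  interpret finite_measure M by fact
  obtain b where "\<And>x. \<bar>f x\<bar> \<le> b" using continuous_real_bounded[OF assms(3)] by blast
  moreover have "f \<in> borel_measurable M"
    using borel_measurable_continuous_onI[OF assms(3)] by (simp cong: measurable_cong_sets add: assms(2))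
  ultimately show ?thesis by (intro integrable_const_bound[of _ b]) auto
qed

lemma integral_shift_continuous:
  fixes f :: "'x::compact_metric_space \<Rightarrow> real"
  assumes "finite_measure M" "sets M = sets borel" "continuous_on UNIV f"
  shows "(\<integral>x. f x + b \<partial>M) = (\<integral>x. f x \<partial>M) + (\<integral>x. b \<partial>M)"
  using integrable_continuous_bounded[OF assms]
    integrable_continuous_bounded[OF assms(1,2) continuous_on_const, of b]
  by (rule Bochner_Integration.integral_add)

text \<open>
  The functional is only required on the cone of nonnegative continuous functions, because the
  positive part of a bounded functional is first obtained there, as a supremum.
\<close>

locale positive_cone_functional =
  fixes l :: "('x::compact_metric_space \<Rightarrow> real) \<Rightarrow> real"
  assumes l_add: "nonneg_continuous f \<Longrightarrow> nonneg_continuous g \<Longrightarrow> l (\<lambda>x. f x + g x) = l f + l g"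
    and l_scale: "nonneg_continuous f \<Longrightarrow> 0 \<le> c \<Longrightarrow> l (\<lambda>x. c * f x) = c * l f"
    and l_nonneg: "nonneg_continuous f \<Longrightarrow> 0 \<le> l f"
begin

lemma l_zero: "l (\<lambda>_. 0) = 0"
  using l_scale[OF nonneg_continuous_const[of 0], of 0] by simp

lemma l_const: "0 \<le> c \<Longrightarrow> l (\<lambda>_. c) = c * l (\<lambda>_. 1)"
  using l_scale[OF nonneg_continuous_const[of 1], of c] by simp

lemma l_diff:
  assumes "nonneg_continuous f" "nonneg_continuous g" "\<And>x. g x \<le> f x"
  shows "l (\<lambda>x. f x - g x) = l f - l g"
  using l_add[OF nonneg_continuous_diff[OF assms] assms(2)] by simp

lemma l_mono:
  assumes "nonneg_continuous f" "nonneg_continuous g" "\<And>x. f x \<le> g x"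
  shows "l f \<le> l g"
  using l_diff[OF assms(2,1,3)] l_nonneg[OF nonneg_continuous_diff[OF assms(2,1,3)]] by simp

lemma l_sum:
  assumes "finite I" "\<And>i. i \<in> I \<Longrightarrow> nonneg_continuous (f i)"
  shows "l (\<lambda>x. \<Sum>i\<in>I. f i x) = (\<Sum>i\<in>I. l (f i))"
  using assms
proof (induction I rule: finite_induct)
  case empty
  then show ?case by (simp add: l_zero)
next
  case (insert a I)
  then show ?case
    by (simp add: l_add nonneg_continuous_sum)
qed

text \<open>
  Covering a set by a series of continuous functions, rather than by open sets, makes countable
  subadditivity of the resulting outer measure immediate.
\<close>

definition covers :: "'x set \<Rightarrow> (nat \<Rightarrow> 'x \<Rightarrow> real) \<Rightarrow> bool" where
  "covers A f \<longleftrightarrow> (\<forall>n. nonneg_continuous (f n)) \<and> (\<forall>x\<in>A. 1 \<le> (\<Sum>n. ennreal (f n x)))"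

definition cost :: "(nat \<Rightarrow> 'x \<Rightarrow> real) \<Rightarrow> ennreal" where
  "cost f = (\<Sum>n. ennreal (l (f n)))"

definition outer :: "'x set \<Rightarrow> ennreal" where
  "outer A = (INF f\<in>{f. covers A f}. cost f)"

lemma outer_le: "covers A f \<Longrightarrow> outer A \<le> cost f"
  unfolding outer_def by (rule INF_lower) simp

lemma outer_mono: "A \<subseteq> B \<Longrightarrow> outer A \<le> outer B"
  unfolding outer_def by (rule INF_superset_mono) (auto simp: covers_def subset_iff)

lemma outer_near:
  assumes "outer A < c"
  obtains f where "covers A f" "cost f < c"
  using assms unfolding outer_def INF_less_iff by auto

lemma suminf_ennreal_eq_head:
  fixes h :: "nat \<Rightarrow> ennreal"
  assumes "\<And>n. n \<noteq> 0 \<Longrightarrow> h n = 0"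
  shows "(\<Sum>n. h n) = h 0"
  using suminf_finite[of "{0}" h] assms by auto

lemma outer_le_single:
  assumes "nonneg_continuous f" "\<And>x. x \<in> A \<Longrightarrow> 1 \<le> f x"
  shows "outer A \<le> ennreal (l f)"
proof -
  define h where "h n = (if n = 0 then f else (\<lambda>_. 0))" for n :: nat
  have "covers A h"
    using assms suminf_ennreal_eq_head[of "\<lambda>n. ennreal (h n x)" for x]
    by (auto simp: covers_def h_def nonneg_continuous_const)
  moreover have "cost h = ennreal (l f)"
    unfolding cost_def using suminf_ennreal_eq_head[of "\<lambda>n. ennreal (l (h n))"]
    by (simp add: h_def l_zero)
  ultimately show ?thesis using outer_le by metis
qed

lemma outer_empty: "outer {} = 0"
  using outer_le_single[of "\<lambda>_. 0" "{}"] by (simp add: nonneg_continuous_const l_zero)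

lemma cost_double:
  fixes F :: "nat \<Rightarrow> nat \<Rightarrow> 'x \<Rightarrow> real"
  shows "cost (\<lambda>i. case_prod F (prod_decode i)) = (\<Sum>n. cost (F n))"
  unfolding cost_def
  using suminf_ennreal_2dimen[of "\<lambda>n. \<Sum>k. ennreal (l (F n k))" "\<lambda>p. ennreal (l (case_prod F p))"]
  by simp

lemma suminf_double:
  fixes F :: "nat \<Rightarrow> nat \<Rightarrow> 'x \<Rightarrow> real"
  shows "(\<Sum>i. ennreal (case_prod F (prod_decode i) x)) = (\<Sum>n k. ennreal (F n k x))"
  using suminf_ennreal_2dimen[of "\<lambda>n. \<Sum>k. ennreal (F n k x)" "\<lambda>p. ennreal (case_prod F p x)"]
  by simp

lemma suminf_add_eps:
  fixes a :: "nat \<Rightarrow> ennreal"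
  assumes "0 \<le> e"
  shows "(\<Sum>n. a n + ennreal (e * (1/2) ^ Suc n)) = (\<Sum>n. a n) + ennreal e"
proof -
  have "(\<Sum>n. ennreal (e * (1/2) ^ Suc n)) = ennreal e"
    using assms sums_mult[OF power_half_series, of e]
    by (intro suminf_ennreal_eq) auto
  then show ?thesis by (subst suminf_add[symmetric]) auto
qed

lemma outer_UN: "outer (\<Union>i. A i) \<le> (\<Sum>i. outer (A i))" for A :: "nat \<Rightarrow> 'x set"
proof (rule ennreal_le_epsilon)
  fix e :: real assume e: "0 < e" and fin: "(\<Sum>i. outer (A i)) < top"
  have "outer (A n) < outer (A n) + ennreal (e * (1/2) ^ Suc n)" for n
    using e ennreal_suminf_lessD[OF fin, of n] by (auto simp: less_top)
  then have "\<exists>f. covers (A n) f \<and> cost f \<le> outer (A n) + ennreal (e * (1/2) ^ Suc n)" for n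
    by (metis outer_near less_imp_le)
  then obtain F where F: "\<And>n. covers (A n) (F n)"
      "\<And>n. cost (F n) \<le> outer (A n) + ennreal (e * (1/2) ^ Suc n)" by metis
  have "covers (\<Union>i. A i) (\<lambda>i. case_prod F (prod_decode i))"
    unfolding covers_def suminf_double
  proof (intro conjI allI ballI)
    show "nonneg_continuous (case_prod F (prod_decode i))" for i
      using F(1) by (auto simp: covers_def split: prod.split)
    fix x assume "x \<in> (\<Union>i. A i)"
    then obtain n where "x \<in> A n" by auto
    then have "1 \<le> (\<Sum>k. ennreal (F n k x))" using F(1) by (auto simp: covers_def)
    also have "\<dots> \<le> (\<Sum>n k. ennreal (F n k x))"
      using sum_le_suminf[of "\<lambda>n. \<Sum>k. ennreal (F n k x)" "{n}"] by simp
    finally show "1 \<le> (\<Sum>n k. ennreal (F n k x))" .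
  qed
  then have "outer (\<Union>i. A i) \<le> (\<Sum>n. cost (F n))"
    using outer_le cost_double by metis
  also have "\<dots> \<le> (\<Sum>n. outer (A n) + ennreal (e * (1/2) ^ Suc n))"
    by (intro suminf_le F) auto
  also have "\<dots> = (\<Sum>n. outer (A n)) + ennreal e"
    using e by (intro suminf_add_eps) simp
  finally show "outer (\<Union>i. A i) \<le> (\<Sum>i. outer (A i)) + ennreal e" .
qed

lemma outer_measure_space_outer: "outer_measure_space (Pow UNIV) outer"
  unfolding outer_measure_space_def positive_def increasing_def countably_subadditive_def
  using outer_empty outer_mono outer_UN by auto

lemma outer_Un: "outer (A \<union> B) \<le> outer A + outer B"
proof -
  have "countably_subadditive (Pow UNIV) outer" "positive (Pow UNIV) outer"
    using outer_measure_space_outer by (auto simp: outer_measure_space_def)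
  from ring_of_sets.countably_subadditive_subadditive[OF _ this(2,1)]
  have sub: "subadditive (Pow UNIV) outer"
    using sigma_algebra_Pow sigma_algebra_def algebra_def by blast
  have "outer (A \<union> (B - A)) \<le> outer A + outer (B - A)"
    using sub by (intro subadditiveD) auto
  also have "\<dots> \<le> outer A + outer B" by (intro add_left_mono outer_mono) auto
  finally show ?thesis by simp
qed

text \<open>Dini's argument: by compactness, finitely many functions of a cover of the whole space sum
  to more than \<open>1 - d\<close> everywhere, for any \<open>d > 0\<close>.\<close>

lemma cost_cover_UNIV_ge:
  assumes "covers UNIV f"
  shows "ennreal (l (\<lambda>_. 1)) \<le> cost f"
proof (rule ennreal_le_epsilon)
  fix e :: real assume "0 < e" and fin: "cost f < top"
  define c where "c = l (\<lambda>_. 1)"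
  have c0: "0 \<le> c" unfolding c_def by (intro l_nonneg nonneg_continuous_const) simp
  \<comment> \<open>The error \<open>d\<close> in the covering costs \<open>d * c\<close>; the summand \<open>1\<close> allows for \<open>c = 0\<close>.\<close>
  define d where "d = e / (c + 1)"
  have d: "0 < d" "d * c \<le> e" using \<open>0 < e\<close> c0 by (auto simp: d_def field_simps)
  have nc: "nonneg_continuous (f n)" for n using assms by (auto simp: covers_def)
  define U where "U N = {x. 1 < d + (\<Sum>n<N. f n x)}" for N :: nat
  have open_U: "open (U N)" for N
    unfolding U_def using nc
    by (intro open_Collect_less continuous_intros) (auto simp: nonneg_continuous_def)
  have "\<exists>N. x \<in> U N" for x
  proof (rule ccontr)
    assume "\<not> ?thesis"
    then have *: "(\<Sum>n<N. f n x) \<le> 1 - d" for N by (simp add: U_def not_less) (metis add.commute le_diff_eq)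
    then have "0 \<le> 1 - d" by (metis lessThan_0 sum.empty)
    have "(\<Sum>n<N. ennreal (f n x)) \<le> ennreal (1 - d)" for N
      using * nc by (subst sum_ennreal) (auto simp: nonneg_continuous_def intro!: ennreal_leI)
    then have "(\<Sum>n. ennreal (f n x)) \<le> ennreal (1 - d)"
      by (intro suminf_le_const) auto
    moreover have "1 \<le> (\<Sum>n. ennreal (f n x))" using assms by (auto simp: covers_def)
    ultimately have "1 \<le> ennreal (1 - d)" by order
    then show False using d \<open>0 \<le> 1 - d\<close> by simp
  qed
  then have UN_U: "UNIV \<subseteq> (\<Union>N\<in>UNIV. U N)" by auto
  obtain T where T: "finite T" "UNIV \<subseteq> (\<Union>N\<in>T. U N)"
    by (rule compactE_image[OF compact_UNIV open_U UN_U])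
  have U_mono: "U N \<subseteq> U N'" if "N \<le> N'" for N N'
  proof -
    have "(\<Sum>n<N. f n x) \<le> (\<Sum>n<N'. f n x)" for x
      using that nc by (intro sum_mono2) (auto simp: nonneg_continuous_def)
    then show ?thesis unfolding U_def by (auto intro: less_le_trans)
  qed
  define N where "N = Max (insert 0 T)"
  have UN: "x \<in> U N" for x
  proof -
    obtain N' where "N' \<in> T" "x \<in> U N'" using T by blast
    then show ?thesis using U_mono[of N' N] T(1) by (auto simp: N_def)
  qed
  have "l (\<lambda>_. 1) \<le> l (\<lambda>x. d + (\<Sum>n<N. f n x))"
    using nc d UN by (intro l_mono nonneg_continuous_add nonneg_continuous_sum nonneg_continuous_const)
      (auto simp: U_def less_imp_le)
  also have "\<dots> = d * c + (\<Sum>n<N. l (f n))"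
    using nc d l_add[of "\<lambda>_. d" "\<lambda>x. \<Sum>n<N. f n x"] l_sum[of "{..<N}" f] l_const[of d]
    by (simp add: nonneg_continuous_sum nonneg_continuous_const c_def)
  also have "\<dots> \<le> e + (\<Sum>n<N. l (f n))" using d by simp
  finally have "ennreal (l (\<lambda>_. 1)) \<le> ennreal e + (\<Sum>n<N. ennreal (l (f n)))"
    using \<open>0 < e\<close> nc
    by (simp add: l_nonneg sum_nonneg sum_ennreal ennreal_leI del: ennreal_plus flip: ennreal_plus)
  also have "\<dots> \<le> ennreal e + cost f"
    unfolding cost_def by (intro add_left_mono sum_le_suminf) auto
  finally show "ennreal (l (\<lambda>_. 1)) \<le> cost f + ennreal e" by (simp add: add.commute)
qed

lemma outer_UNIV: "outer UNIV = ennreal (l (\<lambda>_. 1))"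
proof (rule antisym)
  show "outer UNIV \<le> ennreal (l (\<lambda>_. 1))"
    by (rule outer_le_single) (simp_all add: nonneg_continuous_const)
  show "ennreal (l (\<lambda>_. 1)) \<le> outer UNIV"
    unfolding outer_def by (rule INF_greatest) (simp add: cost_cover_UNIV_ge)
qed

text \<open>
  A cover \<open>f\<close> of \<open>A\<close> is split by continuous functions \<open>u k\<close> that vanish on \<open>C\<close> and increase to
  the indicator of its complement: the increments \<open>f n * (u (Suc k) - u k)\<close> cover \<open>A - C\<close>, while
  \<open>f n * (1 - u k)\<close> agrees with \<open>f n\<close> on \<open>C\<close> for every \<open>k\<close>. With \<open>k\<close> chosen large, depending
  on \<open>n\<close>, the two covers together cost hardly more than \<open>f\<close>.
\<close>

lemma outer_split_closed:
  assumes "closed C"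
  shows "outer (A - C) + outer (A \<inter> C) \<le> outer A"
proof (cases "C = {}")
  case True
  then show ?thesis by (simp add: outer_empty)
next
  case False
  define u where "u k x = min 1 (real k * infdist x C)" for k x
  have u_cont: "continuous_on UNIV (u k)" for k
    unfolding u_def by (intro continuous_intros)
  have u01: "0 \<le> u k x" "u k x \<le> 1" for k x by (auto simp: u_def infdist_nonneg)
  have u_mono: "u k x \<le> u (Suc k) x" for k x
    unfolding u_def by (intro min.mono mult_right_mono) (auto simp: infdist_nonneg)
  have u0: "u 0 x = 0" for x by (simp add: u_def)
  have uC: "u k x = 0" if "x \<in> C" for k x using that by (simp add: u_def)
  have u_lim: "(\<lambda>k. u k x) \<longlonglongrightarrow> 1" if "x \<notin> C" for x
  proof -
    have "0 < infdist x C" using infdist_pos_not_in_closed[OF assms False that] .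
    then obtain K where "1 < real K * infdist x C" using reals_Archimedean3 by blast
    then have "u k x = 1" if "K \<le> k" for k
      using that mult_right_mono[of "real K" "real k" "infdist x C"] infdist_nonneg[of x C]
      by (auto simp: u_def)
    then show ?thesis by (intro tendsto_eventually) (auto simp: eventually_at_top_linorder)
  qed
  have u_nc: "nonneg_continuous (u k)" for k using u_cont u01 by (simp add: nonneg_continuous_def)
  define v where "v k x = u (Suc k) x - u k x" for k x
  have v_nc: "nonneg_continuous (v k)" for k
    unfolding v_def by (intro nonneg_continuous_diff u_nc u_mono)
  show ?thesis
    unfolding outer_def[of A]
  proof (rule INF_greatest)
    fix f assume "f \<in> {f. covers A f}"
    then have f: "covers A f" by simp
    then have f_nc: "nonneg_continuous (f n)" for n by (simp add: covers_def)
    then have f_nn: "0 \<le> f n x" for n x by (simp add: nonneg_continuous_def)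
    show "outer (A - C) + outer (A \<inter> C) \<le> cost f"
    proof (rule ennreal_le_epsilon)
      fix e :: real assume "0 < e"
      have fu_le: "l (\<lambda>x. f n x * u k x) \<le> l (f n)" for n k
        using f_nc[of n] u01 by (intro l_mono nonneg_continuous_mult u_nc f_nc)
          (auto simp: nonneg_continuous_def intro: mult_left_le)
      have fv: "l (\<lambda>x. f n x * v k x) = l (\<lambda>x. f n x * u (Suc k) x) - l (\<lambda>x. f n x * u k x)" for n k
        using u_mono f_nn unfolding v_def right_diff_distrib
        by (intro l_diff nonneg_continuous_mult u_nc f_nc mult_left_mono)
      have partial: "(\<Sum>k<m. l (\<lambda>x. f n x * v k x)) = l (\<lambda>x. f n x * u m x)" for n m
        unfolding fv by (subst sum_lessThan_telescope) (simp add: u0 l_zero)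
      define a where "a n = (\<Sum>k. l (\<lambda>x. f n x * v k x))" for n
      have summ: "summable (\<lambda>k. l (\<lambda>x. f n x * v k x))" for n
      proof (rule bounded_imp_summable)
        show "0 \<le> l (\<lambda>x. f n x * v k x)" for k
          by (intro l_nonneg nonneg_continuous_mult f_nc v_nc)
        show "(\<Sum>k\<le>m. l (\<lambda>x. f n x * v k x)) \<le> l (f n)" for m
          unfolding lessThan_Suc_atMost[symmetric] partial by (rule fu_le)
      qed
      have a_lim: "(\<lambda>m. l (\<lambda>x. f n x * u m x)) \<longlonglongrightarrow> a n" for n
        using summable_LIMSEQ[OF summ[of n]] unfolding partial a_def .
      have a_nonneg: "0 \<le> a n" for n
        unfolding a_def by (intro suminf_nonneg summ l_nonneg nonneg_continuous_mult f_nc v_nc)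
      have "\<exists>m. a n - e * (1/2) ^ Suc n < l (\<lambda>x. f n x * u m x)" for n
      proof -
        have "a n - e * (1/2) ^ Suc n < a n" using \<open>0 < e\<close> by simp
        then have "eventually (\<lambda>m. a n - e * (1/2) ^ Suc n < l (\<lambda>x. f n x * u m x)) sequentially"
          by (rule order_tendstoD(1)[OF a_lim])
        then show ?thesis by (intro eventually_happens'[OF sequentially_bot])
      qed
      then obtain m where m: "\<And>n. a n - e * (1/2) ^ Suc n < l (\<lambda>x. f n x * u (m n) x)" by metis
      have inside: "outer (A - C) \<le> (\<Sum>n. ennreal (a n))"
      proof -
        define F where "F n k x = f n x * v k x" for n k x
        have "covers (A - C) (\<lambda>i. case_prod F (prod_decode i))"
          unfolding covers_def suminf_double
        proof (intro conjI allI ballI)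
          show "nonneg_continuous (case_prod F (prod_decode i))" for i
            unfolding F_def by (auto split: prod.split intro!: nonneg_continuous_mult f_nc v_nc)
          fix x assume x: "x \<in> A - C"
          have "(\<Sum>k. ennreal (F n k x)) = ennreal (f n x)" for n
          proof (rule suminf_ennreal_eq)
            show "0 \<le> F n k x" for k
              using f_nc v_nc by (simp add: F_def nonneg_continuous_def)
            have "(\<lambda>k. v k x) sums 1"
              using u_lim[of x] x unfolding sums_def v_def
              by (subst sum_lessThan_telescope) (simp add: u0)
            then show "(\<lambda>k. F n k x) sums f n x"
              unfolding F_def using sums_mult[of "\<lambda>k. v k x" 1 "f n x"] by simp
          qed
          then show "1 \<le> (\<Sum>n k. ennreal (F n k x))"
            using f x by (simp add: covers_def)
        qed
        then have "outer (A - C) \<le> (\<Sum>n. cost (F n))"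
          using outer_le cost_double by metis
        moreover have "cost (F n) = ennreal (a n)" for n
          unfolding cost_def a_def F_def
          by (rule suminf_ennreal2) (auto intro!: summ l_nonneg nonneg_continuous_mult f_nc v_nc)
        ultimately show ?thesis by simp
      qed
      have rest_nc: "nonneg_continuous (\<lambda>x. f n x - f n x * u (m n) x)" for n
        using f_nc[of n] u01 by (intro nonneg_continuous_diff nonneg_continuous_mult u_nc f_nc)
          (auto simp: nonneg_continuous_def intro: mult_left_le)
      have outside: "outer (A \<inter> C) \<le> (\<Sum>n. ennreal (l (\<lambda>x. f n x - f n x * u (m n) x)))"
      proof -
        have "covers (A \<inter> C) (\<lambda>n x. f n x - f n x * u (m n) x)"
          using f rest_nc by (auto simp: covers_def uC)
        from outer_le[OF this] show ?thesis by (simp add: cost_def)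
      qed
      have le: "a n + l (\<lambda>x. f n x - f n x * u (m n) x) \<le> l (f n) + e * (1/2) ^ Suc n" for n
        using m[of n] u01 f_nn
        by (subst l_diff) (auto intro!: nonneg_continuous_mult f_nc u_nc mult_left_le)
      have "outer (A - C) + outer (A \<inter> C)
          \<le> (\<Sum>n. ennreal (a n)) + (\<Sum>n. ennreal (l (\<lambda>x. f n x - f n x * u (m n) x)))"
        by (intro add_mono inside outside)
      also have "\<dots> = (\<Sum>n. ennreal (a n + l (\<lambda>x. f n x - f n x * u (m n) x)))"
        using a_nonneg l_nonneg[OF rest_nc] by (subst suminf_add) auto
      also have "\<dots> \<le> (\<Sum>n. ennreal (l (f n)) + ennreal (e * (1/2) ^ Suc n))"
        using \<open>0 < e\<close> by (intro suminf_le)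
          (auto simp del: power_Suc simp: l_nonneg f_nc le simp flip: ennreal_plus intro!: ennreal_leI)
      also have "\<dots> = cost f + ennreal e"
        using \<open>0 < e\<close> unfolding cost_def by (intro suminf_add_eps) simp
      finally show "outer (A - C) + outer (A \<inter> C) \<le> cost f + ennreal e" .
    qed
  qed
qed

definition riesz_measure :: "'x measure" where
  "riesz_measure = measure_of UNIV (sets borel) outer"

lemma sets_riesz_measure [simp, measurable_cong]: "sets riesz_measure = sets borel"
  unfolding riesz_measure_def by simp (metis sets.sigma_sets_eq space_borel)

lemma space_riesz_measure [simp]: "space riesz_measure = UNIV"
  by (simp add: riesz_measure_def)

lemma emeasure_riesz_measure:
  assumes "A \<in> sets borel"
  shows "emeasure riesz_measure A = outer A"
proof -
  let ?L = "lambda_system UNIV (Pow UNIV) outer"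
  interpret P: sigma_algebra UNIV "Pow (UNIV :: 'x set)" by (rule sigma_algebra_Pow)
  have ms: "measure_space UNIV ?L outer"
    by (rule P.caratheodory_lemma) (rule outer_measure_space_outer)
  then interpret L: sigma_algebra UNIV ?L by (simp add: measure_space_def)
  have closed_L: "C \<in> ?L" if "closed C" for C
    unfolding lambda_system_def
  proof (safe intro!: antisym)
    fix A
    show "outer (C \<inter> A) + outer ((UNIV - C) \<inter> A) \<le> outer A"
      using outer_split_closed[OF that, of A]
      by (simp add: Int_commute Diff_eq add.commute)
    show "outer A \<le> outer (C \<inter> A) + outer ((UNIV - C) \<inter> A)"
      using outer_Un[of "C \<inter> A" "(UNIV - C) \<inter> A"]
      by (simp add: Int_Un_distrib2[symmetric] Un_Diff_cancel)
  qed auto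
  have sub: "sets borel \<subseteq> ?L"
    unfolding borel_eq_closed using L.sigma_sets_subset[of "Collect closed"] closed_L
    by (simp add: subset_iff)
  have "measure_space UNIV (sets borel) outer"
    using ms sub sets.sigma_algebra_axioms[of borel]
    unfolding measure_space_def positive_def countably_additive_def by auto
  then show ?thesis
    using assms unfolding riesz_measure_def measure_space_def
    by (intro emeasure_measure_of_sigma) auto
qed

lemma finite_riesz_measure: "finite_measure riesz_measure"
  by (rule finite_measureI) (simp add: emeasure_riesz_measure outer_UNIV)

lemma measure_riesz_UNIV: "measure riesz_measure UNIV = l (\<lambda>_. 1)"
  by (simp add: measure_def emeasure_riesz_measure outer_UNIV l_nonneg nonneg_continuous_const)

lemma integrable_riesz_measure:
  assumes "continuous_on UNIV f"
  shows "integrable riesz_measure (f :: _ \<Rightarrow> real)"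
  using assms by (intro integrable_continuous_bounded finite_riesz_measure) simp_all

text \<open>
  Layer cake: \<open>f\<close> is the sum of its slices \<open>s j = min (max (f - j/n) 0) (1/n)\<close>. As
  \<open>n * s j \<ge> 1\<close> on \<open>{f \<ge> (j + 1)/n}\<close>, the definition of the outer measure bounds the measure of
  that set by \<open>n * l (s j)\<close>, and these sets, weighted by \<open>1/n\<close>, account for \<open>f\<close> up to \<open>1/n\<close>.
\<close>

lemma integral_riesz_le:
  assumes f: "nonneg_continuous f"
  shows "(\<integral>x. f x \<partial>riesz_measure) \<le> l f"
proof -
  interpret finite_measure riesz_measure by (rule finite_riesz_measure)
  define c where "c = l (\<lambda>_. 1)"
  have fc: "continuous_on UNIV f" and f0: "\<And>x. 0 \<le> f x"
    using f by (auto simp: nonneg_continuous_def)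
  have "(\<integral>x. f x \<partial>riesz_measure) \<le> l f + inverse (real (Suc p)) * c" for p
  proof -
    define n where "n = real (Suc p)"
    have n: "0 < n" by (simp add: n_def)
    obtain B where B: "\<And>x. f x \<le> B" using continuous_real_bounded[OF fc] abs_le_D1 by metis
    obtain N :: nat where N: "B * n \<le> real N" using real_arch_simple by blast
    define s where "s j x = min (max (f x - real j / n) 0) (1 / n)" for j x
    have s_nc: "nonneg_continuous (s j)" for j
      using n fc by (auto simp: s_def nonneg_continuous_def intro!: continuous_intros)
    have s_part: "(\<Sum>j<k. s j x) = min (f x) (real k / n)" for k x
    proof (induction k)
      case 0
      then show ?case using f0[of x] by simp
    next
      case (Suc k)
      have step: "min a q + min (max (a - q) 0) r = min a (q + r)" if "0 \<le> r" for a q r :: real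
        using that by linarith
      show ?case
        using Suc n step[of "1 / n" "f x" "real k / n"] by (simp add: s_def add_divide_distrib add.commute)
    qed
    have s_sum: "(\<Sum>j<N. s j x) = f x" for x
    proof -
      have "f x * n \<le> real N" using mult_right_mono[OF B[of x] less_imp_le[OF n]] N by linarith
      then have "f x \<le> real N / n" using n by (simp add: pos_le_divide_eq)
      then show ?thesis unfolding s_part by simp
    qed
    define T where "T j = {x. real (Suc j) / n \<le> f x}" for j
    have T_closed: "closed (T j)" for j
      unfolding T_def using fc by (intro closed_Collect_le continuous_intros)
    have T_sets [measurable]: "T j \<in> sets borel" for j using T_closed by (rule borel_closed)
    have s_T: "1 / n \<le> s j x" if "x \<in> T j" for j x
      using that n by (simp add: T_def s_def add_divide_distrib)
    have T_le: "measure riesz_measure (T j) \<le> n * l (s j)" for j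
    proof -
      have "outer (T j) \<le> ennreal (l (\<lambda>x. n * s j x))"
        using n s_T[of _ j] s_nc nonneg_continuous_mult[OF nonneg_continuous_const[of n] s_nc[of j]]
        by (intro outer_le_single) (auto simp: field_simps)
      also have "l (\<lambda>x. n * s j x) = n * l (s j)" using n s_nc by (intro l_scale) auto
      finally show ?thesis
        using n l_nonneg[OF s_nc[of j]]
        by (simp add: measure_def emeasure_riesz_measure enn2real_leI)
    qed
    have s_le: "s (Suc j) x \<le> 1 / n * indicator (T j) x" for j x
      using n by (auto simp: s_def T_def indicator_def)
    have f_le: "f x \<le> 1 / n + (\<Sum>j<N. 1 / n * indicator (T j) x)" for x
    proof -
      have "f x = (\<Sum>j<Suc N. s j x)"
        using s_sum[of x] s_part[where k=N and x=x] s_part[where k="Suc N" and x=x] n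
          divide_right_mono[of "real N" "real (Suc N)" n]
        by linarith
      also have "\<dots> = s 0 x + (\<Sum>j<N. s (Suc j) x)" by (rule sum.lessThan_Suc_shift)
      also have "\<dots> \<le> 1 / n + (\<Sum>j<N. 1 / n * indicator (T j) x)"
        by (intro add_mono sum_mono s_le) (simp add: s_def)
      finally show ?thesis .
    qed
    have "(\<integral>x. f x \<partial>riesz_measure) \<le> (\<integral>x. 1 / n + (\<Sum>j<N. 1 / n * indicator (T j) x) \<partial>riesz_measure)"
      by (rule integral_mono[OF integrable_riesz_measure[OF fc] _ f_le]) (auto simp: less_top[symmetric])
    also have "\<dots> = 1 / n * c + (\<Sum>j<N. 1 / n * measure riesz_measure (T j))"
      by (subst Bochner_Integration.integral_add) (auto simp: measure_riesz_UNIV c_def less_top[symmetric])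
    also have "\<dots> \<le> 1 / n * c + (\<Sum>j<N. l (s j))"
      using n T_le by (intro add_left_mono sum_mono) (simp add: field_simps)
    also have "(\<Sum>j<N. l (s j)) = l f"
      using l_sum[of "{..<N}" s] s_nc s_sum by simp
    finally show ?thesis by (simp add: n_def inverse_eq_divide)
  qed
  moreover have "(\<lambda>p. l f + inverse (real (Suc p)) * c) \<longlonglongrightarrow> l f + 0 * c"
    by (intro tendsto_intros LIMSEQ_inverse_real_of_nat)
  ultimately show ?thesis by (intro LIMSEQ_le_const[where X="\<lambda>p. l f + inverse (real (Suc p)) * c"]) auto
qed

text \<open>The reverse inequality follows by applying \<open>integral_riesz_le\<close> to \<open>b - f\<close>, since the total
  mass is exactly \<open>l 1\<close>.\<close>

theorem integral_riesz_measure: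
  assumes f: "nonneg_continuous f"
  shows "(\<integral>x. f x \<partial>riesz_measure) = l f"
proof (rule antisym)
  show "(\<integral>x. f x \<partial>riesz_measure) \<le> l f" using f by (rule integral_riesz_le)
  interpret finite_measure riesz_measure by (rule finite_riesz_measure)
  have fc: "continuous_on UNIV f" and f0: "\<And>x. 0 \<le> f x"
    using f by (auto simp: nonneg_continuous_def)
  obtain b where b: "\<And>x. f x \<le> b" using continuous_real_bounded[OF fc] abs_le_D1 by metis
  have b0: "0 \<le> b" using b f0 order_trans by blast
  have "(\<integral>x. b - f x \<partial>riesz_measure) \<le> l (\<lambda>x. b - f x)"
    using b b0 f by (intro integral_riesz_le nonneg_continuous_diff nonneg_continuous_const)
  also have "\<dots> = b * l (\<lambda>_. 1) - l f"
    using b b0 f l_diff[of "\<lambda>_. b" f] l_const[of b] by (simp add: nonneg_continuous_const)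
  also have "(\<integral>x. b - f x \<partial>riesz_measure) = b * l (\<lambda>_. 1) - (\<integral>x. f x \<partial>riesz_measure)"
    using integrable_riesz_measure[OF fc] by (simp add: measure_riesz_UNIV)
  finally show "l f \<le> (\<integral>x. f x \<partial>riesz_measure)" by simp
qed

end

section \<open>Decomposition of bounded functionals and signed measures\<close>

text \<open>A bound from above, by a multiple of the supremum of the argument, keeps the suprema that define the
  positive part finite.\<close>

locale bounded_cone_functional =
  fixes l :: "('x::compact_metric_space \<Rightarrow> real) \<Rightarrow> real" and C :: real
  assumes l_add: "nonneg_continuous f \<Longrightarrow> nonneg_continuous g \<Longrightarrow> l (\<lambda>x. f x + g x) = l f + l g"
    and l_scale: "nonneg_continuous f \<Longrightarrow> 0 \<le> c \<Longrightarrow> l (\<lambda>x. c * f x) = c * l f"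
    and l_bound: "nonneg_continuous f \<Longrightarrow> (\<And>x. f x \<le> b) \<Longrightarrow> l f \<le> C * b"
begin

definition minorants :: "('x \<Rightarrow> real) \<Rightarrow> ('x \<Rightarrow> real) set" where
  "minorants f = {g. nonneg_continuous g \<and> (\<forall>x. g x \<le> f x)}"

definition pos_part :: "('x \<Rightarrow> real) \<Rightarrow> real" where
  "pos_part f = (SUP g\<in>minorants f. l g)"

lemma l_zero: "l (\<lambda>_. 0) = 0"
  using l_scale[OF nonneg_continuous_const[of 0], of 0] by simp

lemma zero_minorant: "nonneg_continuous f \<Longrightarrow> (\<lambda>_. 0) \<in> minorants f"
  by (simp add: minorants_def nonneg_continuous_def)

lemma self_minorant: "nonneg_continuous f \<Longrightarrow> f \<in> minorants f"
  by (simp add: minorants_def)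

lemma bdd_above_minorants:
  assumes "nonneg_continuous f"
  shows "bdd_above (l ` minorants f)"
proof -
  have "continuous_on UNIV f" using assms by (simp add: nonneg_continuous_def)
  then obtain b where b: "\<And>x. f x \<le> b" using continuous_real_bounded abs_le_D1 by metis
  have "l g \<le> C * b" if "g \<in> minorants f" for g
    using that order_trans[OF _ b] by (intro l_bound) (auto simp: minorants_def)
  then show ?thesis by (intro bdd_aboveI2)
qed

lemma pos_part_upper: "nonneg_continuous f \<Longrightarrow> g \<in> minorants f \<Longrightarrow> l g \<le> pos_part f"
  unfolding pos_part_def by (intro cSUP_upper bdd_above_minorants)

lemma pos_part_least:
  "nonneg_continuous f \<Longrightarrow> (\<And>g. g \<in> minorants f \<Longrightarrow> l g \<le> z) \<Longrightarrow> pos_part f \<le> z"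
  unfolding pos_part_def using zero_minorant by (intro cSUP_least) auto

text \<open>Riesz decomposition: a minorant \<open>h\<close> of \<open>f + g\<close> is the sum of the minorant \<open>min h f\<close> of
  \<open>f\<close> and the minorant \<open>h - min h f\<close> of \<open>g\<close>.\<close>

lemma pos_part_add:
  assumes f: "nonneg_continuous f" and g: "nonneg_continuous g"
  shows "pos_part (\<lambda>x. f x + g x) = pos_part f + pos_part g"
proof (rule antisym)
  have fg: "nonneg_continuous (\<lambda>x. f x + g x)" using f g by (rule nonneg_continuous_add)
  show "pos_part (\<lambda>x. f x + g x) \<le> pos_part f + pos_part g"
  proof (rule pos_part_least[OF fg])
    fix h assume h: "h \<in> minorants (\<lambda>x. f x + g x)"
    define h1 where "h1 x = min (h x) (f x)" for x
    define h2 where "h2 x = h x - h1 x" for x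
    have h1: "nonneg_continuous h1" "h1 \<in> minorants f"
      using h f by (auto simp: h1_def minorants_def nonneg_continuous_def intro!: continuous_intros)
    have "h2 x \<le> g x" for x
      using h g by (auto simp: h2_def h1_def minorants_def nonneg_continuous_def min_def algebra_simps)
    then have h2: "nonneg_continuous h2" "h2 \<in> minorants g"
      using h h1 by (auto simp: h2_def h1_def minorants_def nonneg_continuous_def intro!: continuous_intros)
    have "l h = l h1 + l h2" using l_add[OF h1(1) h2(1)] by (simp add: h2_def)
    also have "\<dots> \<le> pos_part f + pos_part g"
      by (intro add_mono pos_part_upper f g h1 h2)
    finally show "l h \<le> pos_part f + pos_part g" .
  qed
  have "pos_part f \<le> pos_part (\<lambda>x. f x + g x) - pos_part g"
  proof (rule pos_part_least[OF f])
    fix h1 assume h1: "h1 \<in> minorants f"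
    have "pos_part g \<le> pos_part (\<lambda>x. f x + g x) - l h1"
    proof (rule pos_part_least[OF g])
      fix h2 assume h2: "h2 \<in> minorants g"
      have "l h1 + l h2 = l (\<lambda>x. h1 x + h2 x)"
        using h1 h2 by (intro l_add[symmetric]) (auto simp: minorants_def)
      also have "\<dots> \<le> pos_part (\<lambda>x. f x + g x)"
        using h1 h2 by (intro pos_part_upper fg)
          (auto simp: minorants_def intro: nonneg_continuous_add add_mono)
      finally show "l h2 \<le> pos_part (\<lambda>x. f x + g x) - l h1" by simp
    qed
    then show "l h1 \<le> pos_part (\<lambda>x. f x + g x) - pos_part g" by simp
  qed
  then show "pos_part f + pos_part g \<le> pos_part (\<lambda>x. f x + g x)" by simp
qed

lemma pos_part_nonneg: "nonneg_continuous f \<Longrightarrow> 0 \<le> pos_part f"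
  using pos_part_upper[OF _ zero_minorant] l_zero by fastforce

lemma pos_part_scale_le:
  assumes f: "nonneg_continuous f" and "0 < c"
  shows "pos_part (\<lambda>x. c * f x) \<le> c * pos_part f"
proof (rule pos_part_least)
  show "nonneg_continuous (\<lambda>x. c * f x)"
    using f \<open>0 < c\<close> by (intro nonneg_continuous_mult nonneg_continuous_const) auto
  fix g assume g: "g \<in> minorants (\<lambda>x. c * f x)"
  have "(\<lambda>x. 1 / c * g x) \<in> minorants f"
    using g \<open>0 < c\<close>
    by (auto simp: minorants_def nonneg_continuous_def field_simps intro!: continuous_intros)
  then have "l (\<lambda>x. 1 / c * g x) \<le> pos_part f" by (rule pos_part_upper[OF f])
  moreover have "l (\<lambda>x. 1 / c * g x) = 1 / c * l g"
    using g \<open>0 < c\<close> by (intro l_scale) (auto simp: minorants_def)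
  ultimately have "c * (1 / c * l g) \<le> c * pos_part f"
    using \<open>0 < c\<close> by (intro mult_left_mono) auto
  then show "l g \<le> c * pos_part f" using \<open>0 < c\<close> by simp
qed

lemma pos_part_scale:
  assumes f: "nonneg_continuous f" and "0 \<le> c"
  shows "pos_part (\<lambda>x. c * f x) = c * pos_part f"
proof (cases "c = 0")
  case True
  have z: "nonneg_continuous (\<lambda>_::'x. 0)" by (rule nonneg_continuous_const) simp
  have "pos_part (\<lambda>_. 0) = 0" using pos_part_add[OF z z] by simp
  with True show ?thesis by simp
next
  case False
  then have c: "0 < c" using assms by simp
  have cf: "nonneg_continuous (\<lambda>x. c * f x)"
    using f c by (intro nonneg_continuous_mult nonneg_continuous_const) auto
  have "pos_part (\<lambda>x. 1 / c * (c * f x)) \<le> 1 / c * pos_part (\<lambda>x. c * f x)"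
    using c by (intro pos_part_scale_le cf) simp
  then have "c * pos_part f \<le> pos_part (\<lambda>x. c * f x)" using c by (simp add: field_simps)
  with pos_part_scale_le[OF f c] show ?thesis by simp
qed

text \<open>Both \<open>pos_part\<close> and \<open>pos_part - l\<close> are positive on the cone, so each has a Riesz measure.\<close>

theorem difference_of_measures:
  obtains \<mu> \<nu> :: "'x measure"
  where "finite_measure \<mu>" "finite_measure \<nu>" "sets \<mu> = sets borel" "sets \<nu> = sets borel"
    "\<And>f. nonneg_continuous f \<Longrightarrow> l f = (\<integral>x. f x \<partial>\<mu>) - (\<integral>x. f x \<partial>\<nu>)"
proof -
  interpret P: positive_cone_functional pos_part
    by unfold_locales (auto simp: pos_part_add pos_part_scale pos_part_nonneg)
  interpret N: positive_cone_functional "\<lambda>f. pos_part f - l f"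
    by unfold_locales
      (auto simp: pos_part_add pos_part_scale l_add l_scale right_diff_distrib
            intro: pos_part_upper self_minorant)
  show thesis
    by (rule that[of P.riesz_measure N.riesz_measure])
      (auto simp: P.finite_riesz_measure N.finite_riesz_measure
        P.integral_riesz_measure N.integral_riesz_measure)
qed

end

lemma measure_diff_sums:
  assumes "finite_measure \<mu>" "finite_measure \<nu>"
    and "range A \<subseteq> sets \<mu>" "range A \<subseteq> sets \<nu>" "disjoint_family A"
  shows "(\<lambda>n. measure \<mu> (A n) - measure \<nu> (A n)) sums (measure \<mu> (\<Union>n. A n) - measure \<nu> (\<Union>n. A n))"
  using assms by (intro sums_diff finite_measure.finite_measure_UNION)

lemma finite_signed_measure_diff:
  assumes "finite_measure \<mu>" "finite_measure \<nu>" "sets \<mu> = sets borel" "sets \<nu> = sets borel"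
  shows "finite_signed_measure (\<lambda>A. measure \<mu> A - measure \<nu> A)"
  unfolding finite_signed_measure_def using measure_diff_sums[OF assms(1,2)] assms(3,4) by auto

lemma sets_pos_variation [simp, measurable_cong]: "sets (pos_variation \<nu>) = sets borel"
  unfolding pos_variation_def by simp (metis sets.sigma_sets_eq space_borel)

lemma space_pos_variation [simp]: "space (pos_variation \<nu>) = UNIV"
  by (simp add: pos_variation_def)

text \<open>On a Hahn set \<open>Y\<close>, where \<open>\<mu>\<close> dominates \<open>\<nu>\<close>, the supremum in the definition of the positive
  variation is attained at \<open>A \<inter> Y\<close>.\<close>

lemma emeasure_pos_variation_Hahn:
  assumes fin: "finite_measure \<mu>" "finite_measure \<nu>"
    and sets: "sets \<mu> = sets borel" "sets \<nu> = sets borel"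
    and Y: "Y \<in> sets borel"
      "\<And>X. X \<in> sets borel \<Longrightarrow> X \<subseteq> Y \<Longrightarrow> measure \<nu> X \<le> measure \<mu> X"
      "\<And>X. X \<in> sets borel \<Longrightarrow> X \<inter> Y = {} \<Longrightarrow> measure \<mu> X \<le> measure \<nu> X"
    and A: "A \<in> sets borel"
  shows "emeasure (pos_variation (\<lambda>A. measure \<mu> A - measure \<nu> A)) A
    = ennreal (measure \<mu> (A \<inter> Y) - measure \<nu> (A \<inter> Y))"
proof -
  interpret mu: finite_measure \<mu> by fact
  interpret nu: finite_measure \<nu> by fact
  define d where "d = (\<lambda>A. measure \<mu> A - measure \<nu> A)"
  have d_Un: "d (A \<union> B) = d A + d B" if "A \<in> sets borel" "B \<in> sets borel" "A \<inter> B = {}" for A B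
    unfolding d_def using that sets by (simp add: mu.finite_measure_Union nu.finite_measure_Union)
  have d_pos: "0 \<le> d X" if "X \<in> sets borel" "X \<subseteq> Y" for X
    using Y(2)[OF that] by (simp add: d_def)
  have sup: "(SUP B\<in>{B \<in> sets borel. B \<subseteq> A}. ennreal (d B)) = ennreal (d (A \<inter> Y))"
    if A: "A \<in> sets borel" for A
  proof (rule antisym)
    show "(SUP B\<in>{B \<in> sets borel. B \<subseteq> A}. ennreal (d B)) \<le> ennreal (d (A \<inter> Y))"
    proof (safe intro!: SUP_least ennreal_leI)
      fix B assume B: "B \<in> sets borel" "B \<subseteq> A"
      have "d B = d (B \<inter> Y) + d (B - Y)"
        using d_Un[of "B \<inter> Y" "B - Y"] B Y(1) by (simp add: Int_Diff_Un) (metis Int_Diff_disjoint)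
      also have "d (B - Y) \<le> 0"
        using Y(3)[of "B - Y"] B Y(1) by (auto simp: d_def)
      also have "d (B \<inter> Y) + 0 \<le> d (B \<inter> Y) + d (A \<inter> Y - B \<inter> Y)"
        using d_pos[of "A \<inter> Y - B \<inter> Y"] A B Y(1) by auto
      also have "\<dots> = d (A \<inter> Y)"
        using d_Un[of "B \<inter> Y" "A \<inter> Y - B \<inter> Y"] A B Y(1)
        by (metis Diff_disjoint Diff_partition Int_mono order_refl sets.Diff sets.Int)
      finally show "d B \<le> d (A \<inter> Y)" by simp
    qed
    show "ennreal (d (A \<inter> Y)) \<le> (SUP B\<in>{B \<in> sets borel. B \<subseteq> A}. ennreal (d B))"
      using A Y(1) by (intro SUP_upper) auto
  qed
  let ?g = "\<lambda>A. SUP B\<in>{B \<in> sets borel. B \<subseteq> A}. ennreal (d B)"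
  have "emeasure (pos_variation d) A = ?g A"
    unfolding pos_variation_def
  proof (rule emeasure_measure_of_sigma)
    show "sigma_algebra UNIV (sets (borel :: 'a measure))"
      using sets.sigma_algebra_axioms[of "borel :: 'a measure"] by simp
    show "positive (sets borel) ?g"
      using sup[of "{}"] by (simp add: positive_def d_def)
    show "countably_additive (sets borel) ?g"
      unfolding countably_additive_def
    proof safe
      fix F :: "nat \<Rightarrow> 'a set"
      assume F: "range F \<subseteq> sets borel" "disjoint_family F" "(\<Union>i. F i) \<in> sets borel"
      have "(\<lambda>n. d (F n \<inter> Y)) sums d (\<Union>n. F n \<inter> Y)"
        unfolding d_def using F Y(1) sets
        by (intro measure_diff_sums fin) (auto simp: disjoint_family_on_def)
      then have "(\<Sum>n. ennreal (d (F n \<inter> Y))) = ennreal (d ((\<Union>n. F n) \<inter> Y))"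
        using F(1) Y(1) by (intro suminf_ennreal_eq d_pos) auto
      then show "(\<Sum>i. ?g (F i)) = ?g (\<Union> (range F))"
        using sup F by (simp add: range_subsetD[OF F(1)])
    qed
    show "A \<in> sets borel" by (rule A)
  qed
  then show ?thesis using sup[OF A] by (simp add: d_def)
qed

lemma nn_integral_eq_of_emeasure_add_eq:
  assumes sets: "sets P = sets borel" "sets N = sets borel" "sets Q = sets borel" "sets R = sets borel"
    and eq: "\<And>A. A \<in> sets borel \<Longrightarrow> emeasure P A + emeasure N A = emeasure Q A + emeasure R A"
    and f: "f \<in> borel_measurable borel"
  shows "(\<integral>\<^sup>+x. f x \<partial>P) + (\<integral>\<^sup>+x. f x \<partial>N) = (\<integral>\<^sup>+x. f x \<partial>Q) + (\<integral>\<^sup>+x. f x \<partial>R)"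
  using f
proof (induction rule: borel_measurable_induct)
  case (cong f g)
  then have "f = g" by auto
  with cong show ?case by simp
next
  case (set A)
  then show ?case using eq sets by simp
next
  case (mult u c)
  then have "(\<integral>\<^sup>+x. c * u x \<partial>M) = c * (\<integral>\<^sup>+x. u x \<partial>M)" if "sets M = sets borel" for M
    using that by (intro nn_integral_cmult) (simp cong: measurable_cong_sets)
  with mult sets show ?case by (simp flip: distrib_left)
next
  case (add u v)
  then have "(\<integral>\<^sup>+x. v x + u x \<partial>M) = (\<integral>\<^sup>+x. v x \<partial>M) + (\<integral>\<^sup>+x. u x \<partial>M)" if "sets M = sets borel" for M
    using that by (intro nn_integral_add) (simp_all cong: measurable_cong_sets)
  with add sets show ?case by (simp add: ac_simps)
next
  case (seq U)
  have *: "(\<integral>\<^sup>+x. (SUP i. U i) x \<partial>M) = (SUP i. \<integral>\<^sup>+x. U i x \<partial>M)" if "sets M = sets borel" for M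
    unfolding SUP_apply using that seq
    by (intro nn_integral_monotone_convergence_SUP) (simp_all cong: measurable_cong_sets)
  have inc: "incseq (\<lambda>i. \<integral>\<^sup>+x. U i x \<partial>M)" for M
    using seq by (auto simp: incseq_def le_fun_def intro!: nn_integral_mono)
  show ?case
    using seq unfolding *[OF sets(1)] *[OF sets(2)] *[OF sets(3)] *[OF sets(4)]
    by (simp add: ennreal_SUP_add[symmetric] inc)
qed

text \<open>The variations of \<open>\<mu> - \<nu>\<close> satisfy \<open>pos + \<nu> = neg + \<mu>\<close> as set functions, and this equation
  passes to integrals.\<close>

lemma signed_integral_diff:
  fixes f :: "'x::compact_metric_space \<Rightarrow> real"
  assumes fin: "finite_measure \<mu>" "finite_measure \<nu>"
    and sets: "sets \<mu> = sets borel" "sets \<nu> = sets borel"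
    and f: "continuous_on UNIV f"
  shows "signed_integral (\<lambda>A. measure \<mu> A - measure \<nu> A) f = (\<integral>x. f x \<partial>\<mu>) - (\<integral>x. f x \<partial>\<nu>)"
proof -
  interpret mu: finite_measure \<mu> by fact
  interpret nu: finite_measure \<nu> by fact
  define d where "d = (\<lambda>A. measure \<mu> A - measure \<nu> A)"
  obtain Y where Y: "Y \<in> sets borel"
    "\<And>X. X \<in> sets borel \<Longrightarrow> X \<subseteq> Y \<Longrightarrow> measure \<nu> X \<le> measure \<mu> X"
    "\<And>X. X \<in> sets borel \<Longrightarrow> X \<inter> Y = {} \<Longrightarrow> measure \<mu> X \<le> measure \<nu> X"
    using finite_unsigned_Hahn_decomposition[OF fin] sets
    by (auto simp: mu.emeasure_eq_measure nu.emeasure_eq_measure)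
  have pos: "emeasure (pos_variation d) A = ennreal (d (A \<inter> Y))" if "A \<in> sets borel" for A
    unfolding d_def using emeasure_pos_variation_Hahn[OF fin sets Y that] .
  have Y': "- Y \<in> sets borel" using Y(1) by auto
  have neg: "emeasure (neg_variation d) A = ennreal (- d (A - Y))" if "A \<in> sets borel" for A
    using emeasure_pos_variation_Hahn[OF fin(2,1) sets(2,1) Y' _ _ that] Y(2,3)
    by (simp add: neg_variation_def d_def Diff_eq) (metis disjoint_eq_subset_Compl double_complement)
  \<comment> \<open>The two decompositions of \<open>d\<close>, written without subtraction.\<close>
  have add: "emeasure (pos_variation d) A + emeasure \<nu> A = emeasure (neg_variation d) A + emeasure \<mu> A"
    if A: "A \<in> sets borel" for A
  proof -
    have m: "measure M A = measure M (A \<inter> Y) + measure M (A - Y)"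
      if "finite_measure M" "sets M = sets borel" for M
      using finite_measure.finite_measure_Union[OF that(1), of "A \<inter> Y" "A - Y"] A Y(1) that(2)
      by (simp add: Int_Diff_Un Int_Diff_disjoint)
    have "0 \<le> d (A \<inter> Y)" using Y(1) Y(2)[of "A \<inter> Y"] A by (simp add: d_def)
    moreover have "0 \<le> - d (A - Y)" using Y(1) Y(3)[of "A - Y"] A by (auto simp: d_def)
    moreover have "d (A \<inter> Y) + measure \<nu> A = - d (A - Y) + measure \<mu> A"
      using m[OF fin(1) sets(1)] m[OF fin(2) sets(2)] by (simp add: d_def)
    ultimately show ?thesis
      using pos[OF A] neg[OF A] by (simp add: mu.emeasure_eq_measure nu.emeasure_eq_measure flip: ennreal_plus)
  qed
  have sets': "sets (neg_variation d) = sets borel" by (simp add: neg_variation_def)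
  have fin': "finite_measure (pos_variation d)" "finite_measure (neg_variation d)"
    using pos[of UNIV] neg[of UNIV] by (auto intro!: finite_measureI simp: neg_variation_def)
  have eq: "(\<integral>x. g x \<partial>pos_variation d) + (\<integral>x. g x \<partial>\<nu>) = (\<integral>x. g x \<partial>neg_variation d) + (\<integral>x. g x \<partial>\<mu>)"
    if g: "nonneg_continuous g" for g
  proof -
    have gc: "continuous_on UNIV g" and g0: "\<And>x. 0 \<le> g x"
      using g by (auto simp: nonneg_continuous_def)
    have nn: "(\<integral>\<^sup>+x. ennreal (g x) \<partial>M) = ennreal (\<integral>x. g x \<partial>M)"
      if "finite_measure M" "sets M = sets borel" for M
      using integrable_continuous_bounded[OF that gc] g0 by (intro nn_integral_eq_integral) auto
    have "(\<integral>\<^sup>+x. ennreal (g x) \<partial>pos_variation d) + (\<integral>\<^sup>+x. ennreal (g x) \<partial>\<nu>)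
       = (\<integral>\<^sup>+x. ennreal (g x) \<partial>neg_variation d) + (\<integral>\<^sup>+x. ennreal (g x) \<partial>\<mu>)"
      using borel_measurable_continuous_onI[OF gc] sets sets' add
      by (intro nn_integral_eq_of_emeasure_add_eq) auto
    then show ?thesis
      using g0 by (simp add: nn fin fin' sets sets' flip: ennreal_plus)
  qed
  obtain B where B0: "0 \<le> B" and fB: "nonneg_continuous (\<lambda>x. f x + B)"
    using nonneg_continuous_shift[OF f] by blast
  note split = integral_shift_continuous[OF _ _ f, of _ B]
  have "signed_integral d f = (\<integral>x. f x \<partial>\<mu>) - (\<integral>x. f x \<partial>\<nu>)"
    unfolding signed_integral_def
    using eq[OF fB] eq[OF nonneg_continuous_const[OF B0]]
    unfolding split[OF fin(1) sets(1)] split[OF fin(2) sets(2)]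
      split[OF fin'(1) sets_pos_variation] split[OF fin'(2) sets'] by linarith
  then show ?thesis by (simp add: d_def)
qed

text \<open>
  By contradiction: a set whose measurable subsets have unbounded measure can be split repeatedly into
  another such set and a remainder of measure at least \<open>1\<close> in absolute value, and the disjoint
  remainders contradict summability.
\<close>

lemma finite_signed_measure_bounded:
  assumes "finite_signed_measure \<nu>"
  shows "\<exists>C. \<forall>B\<in>sets borel. \<bar>\<nu> B\<bar> \<le> C"
proof (rule ccontr)
  assume unb: "\<not> ?thesis"
  have n0: "\<nu> {} = 0" and
    sums: "\<And>A. range A \<subseteq> sets borel \<Longrightarrow> disjoint_family A \<Longrightarrow> (\<lambda>n::nat. \<nu> (A n)) sums \<nu> (\<Union>n. A n)"
    using assms by (auto simp: finite_signed_measure_def)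
  have add: "\<nu> (A \<union> B) = \<nu> A + \<nu> B" if "A \<in> sets borel" "B \<in> sets borel" "A \<inter> B = {}" for A B
  proof -
    have "(\<lambda>n. \<nu> (binaryset A B n)) sums \<nu> (\<Union>n. binaryset A B n)"
      using that by (intro sums) (auto simp: range_binaryset_eq disjoint_family_on_def binaryset_def)
    with binaryset_sums[of \<nu> A B, OF n0] show ?thesis
      by (simp add: UN_binaryset_eq sums_iff)
  qed
  define bad where "bad E \<longleftrightarrow> E \<in> sets borel \<and> (\<forall>C. \<exists>B\<in>sets borel. B \<subseteq> E \<and> C < \<bar>\<nu> B\<bar>)" for E
  have step: "\<exists>F. bad F \<and> F \<subseteq> E \<and> 1 \<le> \<bar>\<nu> (E - F)\<bar>" if E_bad: "bad E" for E
  proof -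
    obtain B where B: "B \<in> sets borel" "B \<subseteq> E" "\<bar>\<nu> E\<bar> + 1 < \<bar>\<nu> B\<bar>"
      using E_bad[unfolded bad_def, THEN conjunct2, THEN spec, of "\<bar>\<nu> E\<bar> + 1"] by auto
    have E: "E \<in> sets borel" using E_bad by (simp add: bad_def)
    have EB: "E - B \<in> sets borel" using E B by auto
    have "\<nu> E = \<nu> B + \<nu> (E - B)"
      using add[OF B(1) EB] B(2) by (simp add: Un_absorb1)
    then have ge: "1 \<le> \<bar>\<nu> (E - B)\<bar>" "1 \<le> \<bar>\<nu> B\<bar>" using B(3) by linarith+
    show ?thesis
    proof (cases "bad B")
      case True
      then show ?thesis using ge B by blast
    next
      case False
      then obtain C1 where C1: "\<And>X. X \<in> sets borel \<Longrightarrow> X \<subseteq> B \<Longrightarrow> \<bar>\<nu> X\<bar> \<le> C1"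
        using B(1) by (auto simp: bad_def not_less)
      have "bad (E - B)"
        unfolding bad_def
      proof (intro conjI allI EB)
        fix C
        obtain X where X: "X \<in> sets borel" "X \<subseteq> E" "C1 + C < \<bar>\<nu> X\<bar>"
          using E_bad[unfolded bad_def, THEN conjunct2, THEN spec, of "C1 + C"] by auto
        have "\<nu> X = \<nu> (X \<inter> B) + \<nu> (X - B)"
          using add[of "X \<inter> B" "X - B"] X(1) B(1) by (simp add: Int_Diff_Un Int_Diff_disjoint)
        moreover have "\<bar>\<nu> (X \<inter> B)\<bar> \<le> C1" using C1[of "X \<inter> B"] X(1) B(1) by auto
        ultimately have "C < \<bar>\<nu> (X - B)\<bar>" using X(3) by linarith
        then show "\<exists>B'\<in>sets borel. B' \<subseteq> E - B \<and> C < \<bar>\<nu> B'\<bar>"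
          using X B(1) by (intro bexI[of _ "X - B"]) auto
      qed
      moreover have "E - (E - B) = B" using B(2) by auto
      ultimately show ?thesis using ge by (intro exI[of _ "E - B"]) auto
    qed
  qed
  have "bad UNIV" using unb by (auto simp: bad_def not_le)
  then obtain E where E: "\<And>n::nat. bad (E n)" "\<And>n. E (Suc n) \<subseteq> E n \<and> 1 \<le> \<bar>\<nu> (E n - E (Suc n))\<bar>"
    using dependent_nat_choice[of "\<lambda>_. bad" "\<lambda>_ E F. F \<subseteq> E \<and> 1 \<le> \<bar>\<nu> (E - F)\<bar>"] step by metis
  define G where "G n = E n - E (Suc n)" for n
  have E_anti: "E m \<subseteq> E n" if "n \<le> m" for m n
    using lift_Suc_antimono_le[of E, OF _ that] E(2) by simp
  have "G m \<inter> G n = {}" if "m < n" for m n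
    using E_anti[of "Suc m" n] that by (auto simp: G_def)
  then have "disjoint_family G"
    unfolding disjoint_family_on_def by (metis Int_commute linorder_neqE_nat)
  moreover have "range G \<subseteq> sets borel" using E(1) by (auto simp: G_def bad_def)
  ultimately have "(\<lambda>n. \<nu> (G n)) \<longlonglongrightarrow> 0"
    using sums summable_LIMSEQ_zero sums_summable by blast
  then have "eventually (\<lambda>n. \<bar>\<nu> (G n)\<bar> < 1) sequentially"
    using tendstoD[of "\<lambda>n. \<nu> (G n)" 0 sequentially 1] by simp
  then obtain n where "\<bar>\<nu> (G n)\<bar> < 1"
    using eventually_happens'[OF sequentially_bot] by blast
  with E(2)[of n] show False by (simp add: G_def)
qed

lemma finite_pos_variation:
  assumes "\<forall>B\<in>sets borel. \<bar>\<nu> B\<bar> \<le> C"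
  shows "finite_measure (pos_variation \<nu>)"
proof (rule finite_measureI)
  have "(SUP B\<in>{B \<in> sets borel. B \<subseteq> UNIV}. ennreal (\<nu> B)) \<le> ennreal C"
    using assms by (auto intro!: SUP_least ennreal_leI dest: abs_le_D1)
  then have "emeasure (pos_variation \<nu>) UNIV \<le> ennreal C"
    unfolding pos_variation_def emeasure_measure_of_conv by simp
  then show "emeasure (pos_variation \<nu>) (space (pos_variation \<nu>)) \<noteq> \<infinity>"
    by (auto simp: top_unique)
qed

lemma signed_integrable_continuous:
  fixes f :: "'x::compact_metric_space \<Rightarrow> real"
  assumes "finite_signed_measure \<nu>" "continuous_on UNIV f"
  shows "signed_integrable \<nu> f"
proof -
  obtain C where "\<forall>B\<in>sets borel. \<bar>\<nu> B\<bar> \<le> C"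
    using finite_signed_measure_bounded[OF assms(1)] by blast
  then have "finite_measure (pos_variation \<nu>)" "finite_measure (neg_variation \<nu>)"
    unfolding neg_variation_def by (auto intro: finite_pos_variation[where C=C])
  then show ?thesis
    unfolding signed_integrable_def using assms(2)
    by (auto intro!: integrable_continuous_bounded simp: neg_variation_def)
qed

lemma apply_Bcontfun_continuous:
  fixes f :: "'x::compact_metric_space \<Rightarrow> 'b::metric_space"
  shows "continuous_on UNIV f \<Longrightarrow> apply_bcontfun (Bcontfun f) = f"
  by (intro Bcontfun_inverse continuous_in_bcontfun)

definition coordinate_function :: "'d \<Rightarrow> ('x::compact_metric_space \<Rightarrow> real) \<Rightarrow> ('x \<Rightarrow>\<^sub>C (real ^ 'd))" where
  "coordinate_function i g = Bcontfun (\<lambda>x. g x *\<^sub>R axis i 1)"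

lemma apply_coordinate_function:
  "continuous_on UNIV g \<Longrightarrow> apply_bcontfun (coordinate_function i g) x = g x *\<^sub>R axis i 1"
  unfolding coordinate_function_def
  by (subst apply_Bcontfun_continuous) (auto intro!: continuous_intros)

text \<open>A function is the sum of its coordinate functions, and each coordinate functional
  \<open>g \<mapsto> L (coordinate_function i g)\<close> is represented by a difference of two measures.\<close>

theorem riesz_representation:
  fixes L :: "('x::compact_metric_space \<Rightarrow>\<^sub>C (real ^ 'd)) \<Rightarrow>\<^sub>L real"
  shows "\<exists>\<mu>. represents \<mu> L"
proof -
  define l where "l i g = blinfun_apply L (coordinate_function i g)" for i g
  have l_add_cont: "l i (\<lambda>x. f x + g x) = l i f + l i g"
    if "continuous_on UNIV f" "continuous_on UNIV g" for i f g
  proof -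
    have "coordinate_function i (\<lambda>x. f x + g x) = coordinate_function i f + coordinate_function i g"
      using that by (intro bcontfun_eqI)
        (simp add: apply_coordinate_function continuous_on_add plus_bcontfun.rep_eq scaleR_add_left)
    then show ?thesis by (simp add: l_def blinfun.add_right)
  qed
  have l_scale: "l i (\<lambda>x. c * f x) = c * l i f" if "continuous_on UNIV f" for i f c
  proof -
    have "coordinate_function i (\<lambda>x. c * f x) = c *\<^sub>R coordinate_function i f"
      using that by (intro bcontfun_eqI)
        (simp add: apply_coordinate_function continuous_on_mult_left scaleR_bcontfun.rep_eq)
    then show ?thesis by (simp add: l_def blinfun.scaleR_right)
  qed
  have l_bound: "l i f \<le> norm L * b" if f: "nonneg_continuous f" "\<And>x. f x \<le> b" for i f b
  proof -
    have fc: "continuous_on UNIV f" using f by (simp add: nonneg_continuous_def)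
    have "norm (coordinate_function i f) \<le> b"
      using f fc by (intro norm_bound) (auto simp: apply_coordinate_function nonneg_continuous_def)
    then show ?thesis
      unfolding l_def using norm_blinfun[of L "coordinate_function i f"]
        mult_left_mono[of "norm (coordinate_function i f)" b "norm L"] by (auto dest: abs_le_D1)
  qed
  have "\<exists>m. finite_signed_measure m \<and> (\<forall>f. continuous_on UNIV f \<longrightarrow> l i f = signed_integral m f)" for i
  proof -
    interpret bounded_cone_functional "l i" "norm L"
      by unfold_locales (auto simp: l_add_cont l_scale l_bound nonneg_continuous_def)
    obtain \<mu> \<nu> :: "'x measure"
      where fin: "finite_measure \<mu>" "finite_measure \<nu>"
        and sets: "sets \<mu> = sets borel" "sets \<nu> = sets borel"
        and rep: "\<And>f. nonneg_continuous f \<Longrightarrow> l i f = (\<integral>x. f x \<partial>\<mu>) - (\<integral>x. f x \<partial>\<nu>)"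
      by (rule difference_of_measures) blast
    have "l i f = signed_integral (\<lambda>A. measure \<mu> A - measure \<nu> A) f" if f: "continuous_on UNIV f" for f
    proof -
      obtain B where B0: "0 \<le> B" and fB: "nonneg_continuous (\<lambda>x. f x + B)"
        using nonneg_continuous_shift[OF f] by blast
      note split = integral_shift_continuous[OF _ _ f, of _ B]
      show ?thesis
        using rep[OF fB] rep[OF nonneg_continuous_const[OF B0]] l_add_cont[OF f continuous_on_const[of _ B], of i]
        unfolding signed_integral_diff[OF fin sets f] split[OF fin(1) sets(1)] split[OF fin(2) sets(2)]
        by linarith
    qed
    then show ?thesis using finite_signed_measure_diff[OF fin sets] by blast
  qed
  then obtain m where m: "\<And>i. finite_signed_measure (m i)"
    "\<And>i f. continuous_on UNIV f \<Longrightarrow> l i f = signed_integral (m i) f" by metis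
  have "blinfun_apply L f = (\<Sum>i\<in>UNIV. signed_integral (m i) (\<lambda>x. apply_bcontfun f x $ i))" for f
  proof -
    have c: "continuous_on UNIV (\<lambda>x. apply_bcontfun f x $ i)" for i
      by (intro continuous_intros) simp
    have "f = (\<Sum>i\<in>UNIV. coordinate_function i (\<lambda>x. apply_bcontfun f x $ i))"
    proof (rule bcontfun_eqI)
      have ap: "apply_bcontfun (\<Sum>i\<in>I. g i) x = (\<Sum>i\<in>I. apply_bcontfun (g i) x)"
        for I and g :: "'d \<Rightarrow> ('x \<Rightarrow>\<^sub>C (real ^ 'd))" and x
        by (induction I rule: infinite_finite_induct) (auto simp: plus_bcontfun.rep_eq)
      show "apply_bcontfun f x
          = apply_bcontfun (\<Sum>i\<in>UNIV. coordinate_function i (\<lambda>x. apply_bcontfun f x $ i)) x" for x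
        using basis_expansion[of "apply_bcontfun f x"]
        by (simp add: ap apply_coordinate_function c scalar_mult_eq_scaleR)
    qed
    then have "blinfun_apply L f = (\<Sum>i\<in>UNIV. l i (\<lambda>x. apply_bcontfun f x $ i))"
      unfolding l_def by (metis blinfun.sum_right)
    then show ?thesis using m(2)[OF c] by simp
  qed
  then have "represents m L" using m(1) by (simp add: represents_def)
  then show ?thesis by blast
qed

section \<open>Uniqueness of multivariate laws from characteristic functions\<close>

lemma (in prob_space) integrable_weighted_iexp:
  assumes "w \<in> borel_measurable M" "Y \<in> borel_measurable M" "\<And>\<omega>. \<omega> \<in> space M \<Longrightarrow> \<bar>w \<omega>\<bar> \<le> C"
  shows "integrable M (\<lambda>\<omega>. complex_of_real (w \<omega>) * iexp (Y \<omega>))"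
  using assms by (intro integrable_const_bound[where B=C]) (auto simp: norm_mult)

lemma (in prob_space) integrable_bounded_real:
  assumes "w \<in> borel_measurable M" "\<And>\<omega>. \<omega> \<in> space M \<Longrightarrow> \<bar>w \<omega> :: real\<bar> \<le> C"
  shows "integrable M w"
  using assms by (intro integrable_const_bound[where B=C]) auto

text \<open>Normalised by its mean \<open>c\<close>, a bounded nonnegative weight \<open>u\<close> is a change of
  probability measure.\<close>

lemma (in prob_space) weighted_law:
  fixes u X :: "'a \<Rightarrow> real"
  assumes u [measurable]: "u \<in> borel_measurable M" and X [measurable]: "X \<in> borel_measurable M"
    and bound: "\<And>\<omega>. \<omega> \<in> space M \<Longrightarrow> 0 \<le> u \<omega> \<and> u \<omega> \<le> C"
    and c: "(\<integral>\<omega>. u \<omega> \<partial>M) = c" "0 < c"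
  obtains D where "real_distribution D"
    "\<And>t. char D t = (CLINT \<omega>|M. complex_of_real (u \<omega>) * iexp (t * X \<omega>)) / c"
    "\<And>A. A \<in> sets borel \<Longrightarrow> measure D A = (\<integral>\<omega>. u \<omega> * indicator A (X \<omega>) \<partial>M) / c"
proof -
  define D where "D = distr (density M (\<lambda>\<omega>. ennreal (u \<omega> / c))) borel X"
  have iu: "integrable M u" using bound by (intro integrable_bounded_real[where C=C]) auto
  have nn: "AE \<omega> in M. 0 \<le> u \<omega> / c" using bound c by auto
  have "emeasure (density M (\<lambda>\<omega>. ennreal (u \<omega> / c))) (space M) = (\<integral>\<^sup>+\<omega>. ennreal (u \<omega> / c) \<partial>M)"
    by (subst emeasure_density) (auto intro!: nn_integral_cong)
  also have "\<dots> = 1"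
    using iu nn c by (subst nn_integral_eq_integral) auto
  finally have pd: "prob_space (density M (\<lambda>\<omega>. ennreal (u \<omega> / c)))"
    by (intro prob_spaceI) simp
  have "real_distribution D"
    unfolding D_def by (rule prob_space.real_distribution_distr[OF pd]) simp
  moreover have "char D t = (CLINT \<omega>|M. complex_of_real (u \<omega>) * iexp (t * X \<omega>)) / c" for t
    unfolding char_def D_def using nn
    by (simp add: integral_distr integral_density scaleR_conv_of_real)
  moreover have "measure D A = (\<integral>\<omega>. u \<omega> * indicator A (X \<omega>) \<partial>M) / c" if [measurable]: "A \<in> sets borel" for A
  proof -
    have "measure D A = (\<integral>x. indicator A x \<partial>D)"
      unfolding D_def by simp
    also have "\<dots> = (\<integral>\<omega>. u \<omega> * indicator A (X \<omega>) \<partial>M) / c"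
      unfolding D_def using nn
      by (subst integral_distr, simp, simp, subst integral_density) simp_all
    finally show ?thesis .
  qed
  ultimately show thesis by (rule that)
qed

lemma integral_null_weight:
  fixes u :: "'a \<Rightarrow> real"
  assumes "integrable M u" "(\<integral>\<omega>. u \<omega> \<partial>M) = 0" "\<And>\<omega>. \<omega> \<in> space M \<Longrightarrow> 0 \<le> u \<omega>"
  shows "(\<integral>\<omega>. u \<omega> * g \<omega> \<partial>M) = 0"
proof -
  have "AE \<omega> in M. u \<omega> = 0" using assms by (subst (asm) integral_nonneg_eq_0_iff_AE) auto
  then show ?thesis by (intro integral_eq_zero_AE) auto
qed

lemma weighted_char_unique:
  fixes Y :: "'w \<Rightarrow> real" and Z :: "'v \<Rightarrow> real"
  assumes "prob_space M" "prob_space N"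
    and Y [measurable]: "Y \<in> borel_measurable M" and Z [measurable]: "Z \<in> borel_measurable N"
    and w [measurable]: "w \<in> borel_measurable M" and w': "\<And>\<omega>. \<omega> \<in> space M \<Longrightarrow> 0 \<le> w \<omega> \<and> w \<omega> \<le> C"
    and v [measurable]: "v \<in> borel_measurable N" and v': "\<And>\<omega>. \<omega> \<in> space N \<Longrightarrow> 0 \<le> v \<omega> \<and> v \<omega> \<le> C"
    and eq: "\<And>t. (CLINT \<omega>|M. complex_of_real (w \<omega>) * iexp (t * Y \<omega>))
               = (CLINT \<omega>|N. complex_of_real (v \<omega>) * iexp (t * Z \<omega>))"
    and A: "A \<in> sets borel"
  shows "(\<integral>\<omega>. w \<omega> * indicator A (Y \<omega>) \<partial>M) = (\<integral>\<omega>. v \<omega> * indicator A (Z \<omega>) \<partial>N)"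
proof -
  define c where "c = (\<integral>\<omega>. w \<omega> \<partial>M)"
  interpret M: prob_space M by fact
  interpret N: prob_space N by fact
  have iw: "integrable M w" using w' by (intro M.integrable_bounded_real[where C=C]) auto
  have iv: "integrable N v" using v' by (intro N.integrable_bounded_real[where C=C]) auto
  have c': "c = (\<integral>\<omega>. v \<omega> \<partial>N)" using eq[of 0] by (simp add: c_def)
  have c0: "0 \<le> c" unfolding c_def using w' by (intro Bochner_Integration.integral_nonneg) auto
  show ?thesis
  proof (cases "c = 0")
    case True
    then show ?thesis
      using integral_null_weight[OF iw] integral_null_weight[OF iv] c' c_def w' v' by simp
  next
    case False
    then have c: "0 < c" using c0 by simp
    obtain D where D: "real_distribution D"
      "\<And>t. char D t = (CLINT \<omega>|M. complex_of_real (w \<omega>) * iexp (t * Y \<omega>)) / c"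
      "\<And>A. A \<in> sets borel \<Longrightarrow> measure D A = (\<integral>\<omega>. w \<omega> * indicator A (Y \<omega>) \<partial>M) / c"
      using M.weighted_law[OF w Y w' c_def[symmetric] c] by blast
    obtain E where E: "real_distribution E"
      "\<And>t. char E t = (CLINT \<omega>|N. complex_of_real (v \<omega>) * iexp (t * Z \<omega>)) / c"
      "\<And>A. A \<in> sets borel \<Longrightarrow> measure E A = (\<integral>\<omega>. v \<omega> * indicator A (Z \<omega>) \<partial>N) / c"
      using N.weighted_law[OF v Z v' c'[symmetric] c] by blast
    have "char D = char E" using eq by (auto simp: D(2) E(2))
    then have "D = E" by (rule Levy_uniqueness[OF D(1) E(1)])
    then show ?thesis using D(3)[OF A] E(3)[OF A] c by simp
  qed
qed

text \<open>Euler's formula for the cosine reduces a cosine weight to three characteristic functions.\<close>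

lemma (in prob_space) char_cosine_weight:
  assumes [measurable]: "W \<in> borel_measurable M" "Y \<in> borel_measurable M" "\<theta> \<in> borel_measurable M"
    and W: "\<And>\<omega>. \<bar>W \<omega>\<bar> \<le> 1"
  shows "(CLINT \<omega>|M. complex_of_real (W \<omega> * (1 + cos (\<theta> \<omega> - \<alpha>))) * iexp (Y \<omega>))
    = (CLINT \<omega>|M. complex_of_real (W \<omega>) * iexp (Y \<omega>))
      + (iexp (- \<alpha>) / 2) * (CLINT \<omega>|M. complex_of_real (W \<omega>) * iexp (Y \<omega> + \<theta> \<omega>))
      + (iexp \<alpha> / 2) * (CLINT \<omega>|M. complex_of_real (W \<omega>) * iexp (Y \<omega> - \<theta> \<omega>))"
proof -
  have int: "integrable M (\<lambda>\<omega>. complex_of_real (W \<omega>) * iexp (g \<omega>))" if "g \<in> borel_measurable M" for g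
    using that W by (intro integrable_weighted_iexp[where C=1]) auto
  have pw: "complex_of_real (W \<omega> * (1 + cos (\<theta> \<omega> - \<alpha>))) * iexp (Y \<omega>)
      = complex_of_real (W \<omega>) * iexp (Y \<omega>)
      + (iexp (- \<alpha>) / 2) * (complex_of_real (W \<omega>) * iexp (Y \<omega> + \<theta> \<omega>))
      + (iexp \<alpha> / 2) * (complex_of_real (W \<omega>) * iexp (Y \<omega> - \<theta> \<omega>))" for \<omega>
  proof -
    have "complex_of_real (cos (\<theta> \<omega> - \<alpha>)) = (iexp (\<theta> \<omega>) * iexp (- \<alpha>) + iexp (- \<theta> \<omega>) * iexp \<alpha>) / 2"
      unfolding cos_of_real[symmetric] cos_exp_eq by (simp add: algebra_simps flip: exp_add)
    moreover have "iexp (Y \<omega> + \<theta> \<omega>) = iexp (Y \<omega>) * iexp (\<theta> \<omega>)" "iexp (Y \<omega> - \<theta> \<omega>) = iexp (Y \<omega>) * iexp (- \<theta> \<omega>)"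
      by (simp_all add: algebra_simps flip: exp_add)
    ultimately show ?thesis
      by (simp only: of_real_mult of_real_add of_real_1) (simp add: field_simps)
  qed
  show ?thesis
    unfolding pw by (simp add: int Bochner_Integration.integral_add del: of_real_add of_real_diff of_real_minus)
qed

lemma (in prob_space) integral_weighted_iexp:
  assumes [measurable]: "W \<in> borel_measurable M" "\<theta> \<in> borel_measurable M"
    and W: "\<And>\<omega>. \<bar>W \<omega>\<bar> \<le> 1"
  shows "(CLINT \<omega>|M. complex_of_real (W \<omega>) * iexp (\<theta> \<omega>))
    = Complex (\<integral>\<omega>. W \<omega> * cos (\<theta> \<omega>) \<partial>M) (\<integral>\<omega>. W \<omega> * sin (\<theta> \<omega>) \<partial>M)"
proof -
  have int: "integrable M (\<lambda>\<omega>. complex_of_real (W \<omega>) * iexp (\<theta> \<omega>))"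
    using W by (intro integrable_weighted_iexp[where C=1]) auto
  have ReIm: "Re (complex_of_real (W \<omega>) * iexp (\<theta> \<omega>)) = W \<omega> * cos (\<theta> \<omega>)"
    "Im (complex_of_real (W \<omega>) * iexp (\<theta> \<omega>)) = W \<omega> * sin (\<theta> \<omega>)" for \<omega>
    by (simp_all add: exp_Euler cos_of_real sin_of_real)
  show ?thesis
    unfolding complex_eq_iff complex.sel integral_Re[OF int, symmetric] integral_Im[OF int, symmetric] ReIm
    by simp
qed

text \<open>
  Coordinates are moved one at a time from the Fourier factor \<open>iexp \<theta>\<close> to the indicator factor.
  The one-dimensional uniqueness theorem needs a nonnegative weight, so \<open>iexp \<theta>\<close> is recovered from the
  weights \<open>1 + cos (\<theta> - \<alpha>)\<close> with \<open>\<alpha> = 0\<close> and \<open>\<alpha> = \<pi>/2\<close>.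
\<close>

lemma indicator_char_unique:
  fixes Y :: "'j \<Rightarrow> 'w \<Rightarrow> real" and Z :: "'j \<Rightarrow> 'v \<Rightarrow> real"
  assumes "prob_space M" "prob_space N"
    and Y: "\<And>j. Y j \<in> borel_measurable M" and Z: "\<And>j. Z j \<in> borel_measurable N"
    and A: "\<And>j. A j \<in> sets borel"
    and "finite I" "finite J" "I \<inter> J = {}"
    and eq: "\<And>t. (CLINT \<omega>|M. iexp (\<Sum>j\<in>I \<union> J. t j * Y j \<omega>)) = (CLINT \<omega>|N. iexp (\<Sum>j\<in>I \<union> J. t j * Z j \<omega>))"
  shows "(CLINT \<omega>|M. complex_of_real (\<Prod>j\<in>I. indicator (A j) (Y j \<omega>)) * iexp (\<Sum>j\<in>J. t j * Y j \<omega>))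
       = (CLINT \<omega>|N. complex_of_real (\<Prod>j\<in>I. indicator (A j) (Z j \<omega>)) * iexp (\<Sum>j\<in>J. t j * Z j \<omega>))"
  using assms(6-)
proof (induction I arbitrary: J t rule: finite_induct)
  case empty
  then show ?case by simp
next
  case (insert k I)
  note [measurable] = Y Z A
  interpret M: prob_space M by fact
  interpret N: prob_space N by fact
  define V where "V \<omega> = (\<Prod>j\<in>I. indicator (A j) (Y j \<omega>) :: real)" for \<omega>
  define W where "W \<omega> = (\<Prod>j\<in>I. indicator (A j) (Z j \<omega>) :: real)" for \<omega>
  define \<theta> where "\<theta> \<omega> = (\<Sum>j\<in>J. t j * Y j \<omega>)" for \<omega>
  define \<eta> where "\<eta> \<omega> = (\<Sum>j\<in>J. t j * Z j \<omega>)" for \<omega>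
  have V_borel [measurable]: "V \<in> borel_measurable M" and W_borel [measurable]: "W \<in> borel_measurable N"
    and \<theta>_borel [measurable]: "\<theta> \<in> borel_measurable M" and \<eta>_borel [measurable]: "\<eta> \<in> borel_measurable N"
    unfolding V_def W_def \<theta>_def \<eta>_def by measurable
  have V01: "0 \<le> V \<omega>" "V \<omega> \<le> 1" for \<omega>
    by (auto simp: V_def intro!: prod_nonneg prod_le_1)
  have W01: "0 \<le> W \<omega>" "W \<omega> \<le> 1" for \<omega>
    by (auto simp: W_def intro!: prod_nonneg prod_le_1)
  have kJ: "k \<notin> J" "k \<notin> I" using insert by auto
  have IH: "(CLINT \<omega>|M. complex_of_real (V \<omega>) * iexp (s * Y k \<omega> + r * \<theta> \<omega>))
     = (CLINT \<omega>|N. complex_of_real (W \<omega>) * iexp (s * Z k \<omega> + r * \<eta> \<omega>))" for s r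
  proof -
    have sum: "(\<Sum>j\<in>insert k J. (if j = k then s else r * t j) * X j) = s * X k + r * (\<Sum>j\<in>J. t j * X j)"
      for X :: "'j \<Rightarrow> real"
      using insert.prems(1) kJ
      by (simp add: sum_distrib_left mult.assoc) (rule sum.cong, auto)
    show ?thesis
      using insert.IH[of "insert k J" "\<lambda>j. if j = k then s else r * t j"] insert.prems kJ
      unfolding sum V_def W_def \<theta>_def \<eta>_def by (simp add: insert.hyps)
  qed
  have wt: "(\<integral>\<omega>. V \<omega> * indicator (A k) (Y k \<omega>) \<partial>M) = (\<integral>\<omega>. W \<omega> * indicator (A k) (Z k \<omega>) \<partial>N)"
    using V01 W01 IH[of _ 0] assms(1,2) by (intro weighted_char_unique[where C=1]) auto
  have cw: "(\<integral>\<omega>. V \<omega> * (1 + cos (\<theta> \<omega> - \<alpha>)) * indicator (A k) (Y k \<omega>) \<partial>M)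
      = (\<integral>\<omega>. W \<omega> * (1 + cos (\<eta> \<omega> - \<alpha>)) * indicator (A k) (Z k \<omega>) \<partial>N)" for \<alpha>
  proof (rule weighted_char_unique[where C=2])
    have b: "0 \<le> v * (1 + cos z) \<and> v * (1 + cos z) \<le> 2" if v: "0 \<le> v" "v \<le> 1" for v z :: real
    proof -
      have "0 \<le> 1 + cos z" "1 + cos z \<le> 2" using cos_ge_minus_one[of z] cos_le_one[of z] by linarith+
      then show ?thesis using v mult_mono[of v 1 "1 + cos z" 2] by simp
    qed
    show "0 \<le> V \<omega> * (1 + cos (\<theta> \<omega> - \<alpha>)) \<and> V \<omega> * (1 + cos (\<theta> \<omega> - \<alpha>)) \<le> 2" for \<omega>
      using V01 by (rule b)
    show "0 \<le> W \<omega> * (1 + cos (\<eta> \<omega> - \<alpha>)) \<and> W \<omega> * (1 + cos (\<eta> \<omega> - \<alpha>)) \<le> 2" for \<omega>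
      using W01 by (rule b)
    show "(CLINT \<omega>|M. complex_of_real (V \<omega> * (1 + cos (\<theta> \<omega> - \<alpha>))) * iexp (s * Y k \<omega>))
        = (CLINT \<omega>|N. complex_of_real (W \<omega> * (1 + cos (\<eta> \<omega> - \<alpha>))) * iexp (s * Z k \<omega>))" for s
    proof -
      have V1: "\<bar>V \<omega>\<bar> \<le> 1" for \<omega> using V01[of \<omega>] by simp
      have W1: "\<bar>W \<omega>\<bar> \<le> 1" for \<omega> using W01[of \<omega>] by simp
      have m: "(\<lambda>\<omega>. s * Y k \<omega>) \<in> borel_measurable M" "(\<lambda>\<omega>. s * Z k \<omega>) \<in> borel_measurable N"
        by measurable
      show ?thesis
        unfolding M.char_cosine_weight[OF V_borel m(1) \<theta>_borel V1]
          N.char_cosine_weight[OF W_borel m(2) \<eta>_borel W1]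
        using IH[of s 0] IH[of s 1] IH[of s "-1"] by simp
    qed
  qed (use assms(1,2) in \<open>simp_all\<close>)
  have cs: "(\<integral>\<omega>. V \<omega> * indicator (A k) (Y k \<omega>) * cos (\<theta> \<omega> - \<alpha>) \<partial>M)
      = (\<integral>\<omega>. W \<omega> * indicator (A k) (Z k \<omega>) * cos (\<eta> \<omega> - \<alpha>) \<partial>N)" for \<alpha>
  proof -
    have b: "\<bar>v * indicator B y * cos z\<bar> \<le> 1" "\<bar>v * indicator B y\<bar> \<le> 1"
      if "0 \<le> v" "v \<le> 1" for v z y :: real and B
      using that mult_mono[of v 1 "\<bar>cos z\<bar>" 1] by (auto simp: abs_mult indicator_def)
    have "integrable M (\<lambda>\<omega>. V \<omega> * indicator (A k) (Y k \<omega>) * cos (\<theta> \<omega> - \<alpha>))"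
      "integrable M (\<lambda>\<omega>. V \<omega> * indicator (A k) (Y k \<omega>))"
      using b V01 by (auto intro!: M.integrable_bounded_real[where C=1])
    moreover have "integrable N (\<lambda>\<omega>. W \<omega> * indicator (A k) (Z k \<omega>) * cos (\<eta> \<omega> - \<alpha>))"
      "integrable N (\<lambda>\<omega>. W \<omega> * indicator (A k) (Z k \<omega>))"
      using b W01 by (auto intro!: N.integrable_bounded_real[where C=1])
    ultimately show ?thesis
      using cw[of \<alpha>] wt by (simp add: algebra_simps)
  qed
  have sin: "(\<integral>\<omega>. V \<omega> * indicator (A k) (Y k \<omega>) * sin (\<theta> \<omega>) \<partial>M)
      = (\<integral>\<omega>. W \<omega> * indicator (A k) (Z k \<omega>) * sin (\<eta> \<omega>) \<partial>N)"
    using cs[of "pi / 2"] by (simp add: cos_diff)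
  have "(CLINT \<omega>|M. complex_of_real (V \<omega> * indicator (A k) (Y k \<omega>)) * iexp (\<theta> \<omega>))
      = (CLINT \<omega>|N. complex_of_real (W \<omega> * indicator (A k) (Z k \<omega>)) * iexp (\<eta> \<omega>))"
  proof -
    have b: "\<bar>v * indicator B y\<bar> \<le> 1" if "0 \<le> v" "v \<le> 1" for v y :: real and B
      using that by (auto simp: indicator_def)
    show ?thesis
      using cs[of 0] sin b[OF V01] b[OF W01]
      by (simp add: M.integral_weighted_iexp N.integral_weighted_iexp del: of_real_mult)
  qed
  then show ?case
    using insert.hyps by (simp add: V_def W_def \<theta>_def \<eta>_def mult.commute)
qed

lemma measure_distr_box:
  fixes X :: "'j \<Rightarrow> 'w \<Rightarrow> real"
  assumes "finite_measure P" "finite J" and X [measurable]: "\<And>j. X j \<in> borel_measurable P"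
    and B [measurable]: "\<And>j. B j \<in> sets borel"
  shows "complex_of_real (measure (distr P (\<Pi>\<^sub>M j\<in>J. borel) (\<lambda>\<omega>. \<lambda>j\<in>J. X j \<omega>)) (Pi\<^sub>E J B))
    = (CLINT \<omega>|P. complex_of_real (\<Prod>j\<in>J. indicator (B j) (X j \<omega>)))"
proof -
  interpret finite_measure P by fact
  define S where "S = {\<omega> \<in> space P. \<forall>j\<in>J. X j \<omega> \<in> B j}"
  have [measurable]: "S \<in> sets P" unfolding S_def using \<open>finite J\<close> by measurable
  have "(\<Prod>j\<in>J. indicator (B j) (X j \<omega>)) = (indicator S \<omega> :: real)" if \<omega>: "\<omega> \<in> space P" for \<omega>
  proof (cases "\<omega> \<in> S")
    case True
    then show ?thesis by (simp add: S_def)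
  next
    case False
    then obtain j where "j \<in> J" "X j \<omega> \<notin> B j" using \<omega> by (auto simp: S_def)
    then have "\<exists>j\<in>J. indicator (B j) (X j \<omega>) = (0 :: real)" by (intro bexI[of _ j]) auto
    then show ?thesis using False \<open>finite J\<close> by (simp add: prod_zero)
  qed
  then have "(CLINT \<omega>|P. complex_of_real (\<Prod>j\<in>J. indicator (B j) (X j \<omega>))) = complex_of_real (measure P S)"
    by (simp cong: Bochner_Integration.integral_cong del: of_real_prod)
  moreover have "(\<lambda>\<omega>. \<lambda>j\<in>J. X j \<omega>) -` Pi\<^sub>E J B \<inter> space P = S"
    by (auto simp: S_def PiE_iff)
  moreover have "Pi\<^sub>E J B \<in> sets (\<Pi>\<^sub>M j\<in>J. (borel :: real measure))"
    using \<open>finite J\<close> by (intro sets_PiM_I_finite) auto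
  ultimately show ?thesis by (simp add: measure_distr)
qed

text \<open>Once all coordinates carry indicators, the hypothesis on linear combinations gives equal measures of
  boxes, which determine a measure on a finite product.\<close>

theorem char_vector_unique:
  fixes Y :: "'j \<Rightarrow> 'w \<Rightarrow> real" and Z :: "'j \<Rightarrow> 'v \<Rightarrow> real"
  assumes M: "prob_space M" and N: "prob_space N"
    and Y: "\<And>j. Y j \<in> borel_measurable M" and Z: "\<And>j. Z j \<in> borel_measurable N"
    and J: "finite J"
    and eq: "\<And>t. (CLINT \<omega>|M. iexp (\<Sum>j\<in>J. t j * Y j \<omega>)) = (CLINT \<omega>|N. iexp (\<Sum>j\<in>J. t j * Z j \<omega>))"
  shows "distr M (\<Pi>\<^sub>M j\<in>J. borel) (\<lambda>\<omega>. \<lambda>j\<in>J. Y j \<omega>) = distr N (\<Pi>\<^sub>M j\<in>J. borel) (\<lambda>\<omega>. \<lambda>j\<in>J. Z j \<omega>)"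
    (is "?P = ?Q")
proof (rule measure_eqI_PiM_finite[where A = "\<lambda>_. Pi\<^sub>E J (\<lambda>_. UNIV)"])
  note [measurable] = Y Z
  interpret M: prob_space M by fact
  interpret N: prob_space N by fact
  interpret P: prob_space ?P by (intro M.prob_space_distr) measurable
  interpret Q: prob_space ?Q by (intro N.prob_space_distr) measurable
  show "finite J" by fact
  show "emeasure ?P (Pi\<^sub>E J A) = emeasure ?Q (Pi\<^sub>E J A)" if A: "\<And>j. j \<in> J \<Longrightarrow> A j \<in> sets borel" for A
  proof -
    define B where "B j = (if j \<in> J then A j else {})" for j
    have B: "B j \<in> sets borel" for j using A by (simp add: B_def)
    have PiE: "Pi\<^sub>E J A = Pi\<^sub>E J B" by (intro PiE_cong) (simp add: B_def)
    have "complex_of_real (measure ?P (Pi\<^sub>E J B)) = complex_of_real (measure ?Q (Pi\<^sub>E J B))"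
      using indicator_char_unique[OF M N Y Z B J, of "{}"] eq
      by (subst (1 2) measure_distr_box) (auto simp: J Y Z B M.finite_measure_axioms N.finite_measure_axioms)
    then show ?thesis unfolding PiE by (simp add: P.emeasure_eq_measure Q.emeasure_eq_measure)
  qed
  show "range (\<lambda>_::nat. Pi\<^sub>E J (\<lambda>_. UNIV)) \<subseteq> prod_algebra J (\<lambda>_. borel :: real measure)"
    using J by (auto intro!: prod_algebraI_finite)
  show "emeasure ?P (Pi\<^sub>E J (\<lambda>_. UNIV)) \<noteq> \<infinity>" by simp
qed (auto simp: space_PiM)

section \<open>Centered Gaussian laws and the rotation argument of Fernique\<close>

lemma char_normal:
  assumes s: "0 < s"
  shows "char (density lborel (normal_density 0 s)) t = complex_of_real (exp (- ((s * t)\<^sup>2 / 2)))"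
proof -
  let ?N = "density lborel (normal_density 0 s)"
  interpret N: prob_space ?N by (rule prob_space_normal_density[OF s])
  have "distributed ?N lborel (\<lambda>x. x) (normal_density 0 s)"
    by (auto simp: distributed_def intro!: distr_id2)
  then have "distributed ?N lborel (\<lambda>x. x / s) std_normal_density"
    using N.normal_standard_normal_convert[OF s, of "\<lambda>x. x" 0] by simp
  then have "distr ?N lborel (\<lambda>x. x / s) = std_normal_distribution"
    by (rule distributed_distr_eq_density)
  then have "char std_normal_distribution (s * t) = (CLINT x|distr ?N lborel (\<lambda>x. x / s). iexp (s * t * x))"
    by (simp add: char_def)
  also have "\<dots> = (CLINT x|?N. iexp (s * t * (x / s)))"
    by (subst integral_distr) auto
  also have "\<dots> = char ?N t" using s by (simp add: char_def)
  finally show ?thesis by (simp add: char_std_normal_distribution)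
qed

lemma real_distribution_normal: "0 < s \<Longrightarrow> real_distribution (density lborel (normal_density 0 s))"
  unfolding real_distribution_def real_distribution_axioms_def
  using prob_space_normal_density by auto

lemma char_return: "char (return borel m) t = iexp (t * m)"
  unfolding char_def by (subst integral_return) auto

text \<open>Degenerate and nondegenerate centered Gaussian laws are treated uniformly through the second moment,
  which determines the characteristic function.\<close>

lemma (in prob_space) centered_gaussian:
  fixes Y :: "'a \<Rightarrow> real"
  assumes Y [measurable]: "Y \<in> borel_measurable M"
    and law: "gaussian_law (distr M borel Y)" and mean: "(\<integral>\<omega>. Y \<omega> \<partial>M) = 0"
  shows "integrable M (\<lambda>\<omega>. (Y \<omega>)\<^sup>2)"
    and "(CLINT \<omega>|M. iexp (t * Y \<omega>)) = complex_of_real (exp (- (t\<^sup>2 * (\<integral>\<omega>. (Y \<omega>)\<^sup>2 \<partial>M) / 2)))"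
proof -
  let ?D = "distr M borel Y"
  have mean': "(\<integral>x. x \<partial>?D) = 0" using mean by (simp add: integral_distr)
  have "integrable ?D (\<lambda>x. x\<^sup>2) \<and> char ?D t = complex_of_real (exp (- (t\<^sup>2 * (\<integral>x. x\<^sup>2 \<partial>?D) / 2)))"
    using law unfolding gaussian_law_def
  proof (elim disjE exE conjE)
    fix m assume D: "?D = return borel m"
    then have "m = 0" using mean' by (simp add: integral_return)
    have "integrable ?D (\<lambda>x. x\<^sup>2)"
      unfolding D by (subst integrable_iff_bounded) (simp add: nn_integral_return)
    then show ?thesis
      unfolding D \<open>m = 0\<close> by (simp add: char_return integral_return)
  next
    fix m s :: real assume s: "0 < s" and D: "?D = density lborel (normal_density m s)"
    have "m = 0"
      using mean' unfolding D by (simp add: integral_density integral_normal_moment_nz_1[OF s])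
    have "integrable lborel (\<lambda>x. normal_density 0 s x * x\<^sup>2)"
      using integrable_normal_moment[OF s, of 0 2] by simp
    moreover have "(\<integral>x. normal_density 0 s x * x\<^sup>2 \<partial>lborel) = s\<^sup>2"
      using integral_normal_moment_even[OF s, of 0 1] by simp
    ultimately show ?thesis
      unfolding D \<open>m = 0\<close>
      by (simp add: char_normal[OF s] integrable_density integral_density power_mult_distrib mult.commute)
  qed
  then show "integrable M (\<lambda>\<omega>. (Y \<omega>)\<^sup>2)"
    and "(CLINT \<omega>|M. iexp (t * Y \<omega>)) = complex_of_real (exp (- (t\<^sup>2 * (\<integral>\<omega>. (Y \<omega>)\<^sup>2 \<partial>M) / 2)))"
    by (simp_all add: char_def integrable_distr_eq integral_distr)
qed

lemma (in prob_space) gaussian_law_of_char: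
  fixes Y :: "'a \<Rightarrow> real"
  assumes Y [measurable]: "Y \<in> borel_measurable M" and "0 \<le> v"
    and char: "\<And>t. (CLINT \<omega>|M. iexp (t * Y \<omega>)) = complex_of_real (exp (- (t\<^sup>2 * v / 2)))"
  shows "gaussian_law (distr M borel Y)"
proof -
  let ?D = "distr M borel Y"
  have rd: "real_distribution ?D" by simp
  have ch: "char ?D t = complex_of_real (exp (- (t\<^sup>2 * v / 2)))" for t
    using char[of t] by (simp add: char_def integral_distr)
  show ?thesis
  proof (cases "v = 0")
    case True
    have "real_distribution (return borel (0::real))"
      unfolding real_distribution_def real_distribution_axioms_def by (simp add: prob_space_return)
    then have "?D = return borel 0"
      using rd ch True by (intro Levy_uniqueness ext) (auto simp: char_return)
    then show ?thesis by (auto simp: gaussian_law_def)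
  next
    case False
    then have v: "0 < sqrt v" using \<open>0 \<le> v\<close> by simp
    have "?D = density lborel (normal_density 0 (sqrt v))"
      using rd ch \<open>0 \<le> v\<close>
      by (intro Levy_uniqueness ext real_distribution_normal v)
        (simp_all add: char_normal[OF v] power_mult_distrib mult.commute)
    then show ?thesis using v unfolding gaussian_law_def by blast
  qed
qed

lemma (in prob_space) char_product_space:
  assumes [measurable]: "f \<in> borel_measurable M" "g \<in> borel_measurable M"
  shows "(CLINT z|M \<Otimes>\<^sub>M M. iexp (f (fst z) + g (snd z))) = (CLINT \<omega>|M. iexp (f \<omega>)) * (CLINT \<omega>|M. iexp (g \<omega>))"
proof -
  interpret P: pair_prob_space M M ..
  have "integrable (M \<Otimes>\<^sub>M M) (\<lambda>z. iexp (f (fst z) + g (snd z)))"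
    by (intro P.P.integrable_const_bound[where B=1]) auto
  from P.integral_fst'[OF this, symmetric]
  have "(CLINT z|M \<Otimes>\<^sub>M M. iexp (f (fst z) + g (snd z))) = (CLINT x|M. CLINT y|M. iexp (f x + g y))"
    by simp
  also have "\<dots> = (CLINT x|M. CLINT y|M. iexp (f x) * iexp (g y))"
    by (simp add: distrib_left exp_add)
  also have "\<dots> = (CLINT \<omega>|M. iexp (f \<omega>)) * (CLINT \<omega>|M. iexp (g \<omega>))"
    by simp
  finally show ?thesis .
qed

locale centered_gaussian_family = prob_space M
  for M :: "'w measure" +
  fixes Y :: "'j \<Rightarrow> 'w \<Rightarrow> real" and J :: "'j set"
  assumes finite_J: "finite J"
    and Y_borel [measurable]: "\<And>j. Y j \<in> borel_measurable M"
    and Y_mean: "\<And>j. j \<in> J \<Longrightarrow> (\<integral>\<omega>. Y j \<omega> \<partial>M) = 0"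
    and Y_gauss: "\<And>c. gaussian_law (distr M borel (\<lambda>\<omega>. \<Sum>j\<in>J. c j * Y j \<omega>))"
begin

abbreviation comb :: "('j \<Rightarrow> real) \<Rightarrow> 'w \<Rightarrow> real" where
  "comb c \<omega> \<equiv> (\<Sum>j\<in>J. c j * Y j \<omega>)"

lemma Y_square:
  assumes "j \<in> J"
  shows "integrable M (\<lambda>\<omega>. (Y j \<omega>)\<^sup>2)"
proof -
  have "(if i = j then 1 else 0) * Y i \<omega> = (if i = j then Y i \<omega> else 0)" for i \<omega> by simp
  then have "comb (\<lambda>i. if i = j then 1 else 0) \<omega> = Y j \<omega>" for \<omega>
    using assms finite_J by simp
  then have "gaussian_law (distr M borel (Y j))"
    using Y_gauss[of "\<lambda>i. if i = j then 1 else 0"] by simp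
  then show ?thesis by (rule centered_gaussian(1)[OF Y_borel _ Y_mean[OF assms]])
qed

lemma comb_borel: "comb c \<in> borel_measurable M"
  by measurable

lemma comb_mean: "(\<integral>\<omega>. comb c \<omega> \<partial>M) = 0"
proof -
  have "integrable M (Y j)" if "j \<in> J" for j
    by (rule square_integrable_imp_integrable[OF Y_borel Y_square[OF that]])
  then show ?thesis by (simp add: Bochner_Integration.integral_sum Y_mean)
qed

lemma comb_square: "integrable M (\<lambda>\<omega>. (comb c \<omega>)\<^sup>2)"
  by (rule centered_gaussian(1)[OF _ Y_gauss comb_mean]) simp

lemma comb_char: "(CLINT \<omega>|M. iexp (comb c \<omega>)) = complex_of_real (exp (- ((\<integral>\<omega>. (comb c \<omega>)\<^sup>2 \<partial>M) / 2)))"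
  using centered_gaussian(2)[where t=1, OF _ Y_gauss[of c] comb_mean[of c]] by simp

text \<open>
  Two independent copies are indexed by the two values of a Boolean. By the parallelogram
  identity, rotating the pair by 45 degrees leaves all variances, hence the joint law, unchanged.
\<close>

definition copies :: "'j \<times> bool \<Rightarrow> 'w \<times> 'w \<Rightarrow> real" where
  "copies p z = (if snd p then Y (fst p) (fst z) else Y (fst p) (snd z))"

definition rotated :: "'j \<times> bool \<Rightarrow> 'w \<times> 'w \<Rightarrow> real" where
  "rotated p z = (if snd p then Y (fst p) (fst z) + Y (fst p) (snd z)
                  else Y (fst p) (fst z) - Y (fst p) (snd z)) / sqrt 2"

lemma copies_borel [measurable]: "copies p \<in> borel_measurable (M \<Otimes>\<^sub>M M)"
  unfolding copies_def[abs_def] by (cases "snd p") simp_all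

lemma rotated_borel [measurable]: "rotated p \<in> borel_measurable (M \<Otimes>\<^sub>M M)"
  unfolding rotated_def[abs_def] by (cases "snd p") simp_all

lemma copies_rotated_distr:
  "distr (M \<Otimes>\<^sub>M M) (\<Pi>\<^sub>M p\<in>J \<times> UNIV. borel) (\<lambda>z. \<lambda>p\<in>J \<times> UNIV. copies p z)
   = distr (M \<Otimes>\<^sub>M M) (\<Pi>\<^sub>M p\<in>J \<times> UNIV. borel) (\<lambda>z. \<lambda>p\<in>J \<times> UNIV. rotated p z)"
proof (rule char_vector_unique)
  interpret P: pair_prob_space M M ..
  show "prob_space (M \<Otimes>\<^sub>M M)" "prob_space (M \<Otimes>\<^sub>M M)" by (rule P.P.prob_space_axioms)+
  fix t :: "'j \<times> bool \<Rightarrow> real"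
  define a where "a j = t (j, True)" for j
  define b where "b j = t (j, False)" for j
  have split: "(\<Sum>p\<in>J \<times> UNIV. t p * X p) = (\<Sum>j\<in>J. a j * X (j, True) + b j * X (j, False))" for X
    unfolding a_def b_def
    by (subst sum.cartesian_product[symmetric, where g="\<lambda>j b. t (j, b) * X (j, b)", simplified split_def, simplified])
      (simp add: UNIV_bool add.commute)
  have c: "(\<Sum>p\<in>J \<times> UNIV. t p * copies p z) = comb a (fst z) + comb b (snd z)" for z
    unfolding split by (simp add: copies_def sum.distrib)
  have r: "(\<Sum>p\<in>J \<times> UNIV. t p * rotated p z)
      = comb (\<lambda>j. (a j + b j) / sqrt 2) (fst z) + comb (\<lambda>j. (a j - b j) / sqrt 2) (snd z)" for z
    unfolding split sum.distrib[symmetric] by (intro sum.cong) (simp_all add: rotated_def field_simps)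
  have var: "(\<integral>\<omega>. (comb a \<omega>)\<^sup>2 \<partial>M) + (\<integral>\<omega>. (comb b \<omega>)\<^sup>2 \<partial>M)
      = (\<integral>\<omega>. (comb (\<lambda>j. (a j + b j) / sqrt 2) \<omega>)\<^sup>2 \<partial>M) + (\<integral>\<omega>. (comb (\<lambda>j. (a j - b j) / sqrt 2) \<omega>)\<^sup>2 \<partial>M)"
  proof -
    have half: "comb (\<lambda>j. (a j + b j) / sqrt 2) \<omega> = (comb a \<omega> + comb b \<omega>) / sqrt 2"
      "comb (\<lambda>j. (a j - b j) / sqrt 2) \<omega> = (comb a \<omega> - comb b \<omega>) / sqrt 2" for \<omega>
      by (simp_all add: sum_divide_distrib add_divide_distrib diff_divide_distrib sum.distrib sum_subtractf
          distrib_right left_diff_distrib)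
    have parallelogram: "x\<^sup>2 + y\<^sup>2 = ((x + y) / sqrt 2)\<^sup>2 + ((x - y) / sqrt 2)\<^sup>2" for x y :: real
      by (simp add: power_divide power2_eq_square field_simps)
    have "(comb a \<omega>)\<^sup>2 + (comb b \<omega>)\<^sup>2
        = (comb (\<lambda>j. (a j + b j) / sqrt 2) \<omega>)\<^sup>2 + (comb (\<lambda>j. (a j - b j) / sqrt 2) \<omega>)\<^sup>2" for \<omega>
      unfolding half by (rule parallelogram)
    then show ?thesis
      using Bochner_Integration.integral_add[OF comb_square[of a] comb_square[of b]]
        Bochner_Integration.integral_add[OF comb_square[of "\<lambda>j. (a j + b j) / sqrt 2"]
          comb_square[of "\<lambda>j. (a j - b j) / sqrt 2"]] by simp
  qed
  show "(CLINT z|M \<Otimes>\<^sub>M M. iexp (\<Sum>p\<in>J \<times> UNIV. t p * copies p z))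
      = (CLINT z|M \<Otimes>\<^sub>M M. iexp (\<Sum>p\<in>J \<times> UNIV. t p * rotated p z))"
    unfolding c r char_product_space[OF comb_borel comb_borel] comb_char of_real_mult[symmetric] exp_add[symmetric]
    using var by (simp only: of_real_eq_iff exp_inj_iff)
qed (use finite_J in auto)

definition vector_sum :: "('j \<Rightarrow> 'b::{real_normed_vector, second_countable_topology}) \<Rightarrow> 'w \<Rightarrow> 'b" where
  "vector_sum e \<omega> = (\<Sum>j\<in>J. Y j \<omega> *\<^sub>R e j)"

lemma vector_sum_borel [measurable]: "vector_sum e \<in> borel_measurable M"
  unfolding vector_sum_def[abs_def] by measurable

lemma ennreal_suminf_ge_term:
  fixes h :: "nat \<Rightarrow> ennreal"
  shows "h k \<le> (\<Sum>n. h n)"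
  using sum_le_suminf[of h "{k}"] by simp

text \<open>
  By rotation invariance, the product on the left is the probability that two independent copies
  \<open>X\<close>, \<open>X'\<close> satisfy \<open>norm (X - X') \<le> s * sqrt 2\<close> and \<open>t * sqrt 2 < norm (X + X')\<close>. Then both norms
  exceed \<open>(t - s) / sqrt 2\<close>.
\<close>

lemma fernique_inequality:
  fixes e :: "'j \<Rightarrow> 'b::{real_normed_vector, second_countable_topology}"
  shows "measure M {\<omega> \<in> space M. t < norm (vector_sum e \<omega>)} * measure M {\<omega> \<in> space M. norm (vector_sum e \<omega>) \<le> s}
   \<le> (measure M {\<omega> \<in> space M. (t - s) / sqrt 2 < norm (vector_sum e \<omega>)})\<^sup>2"
proof -
  interpret P: pair_prob_space M M ..
  let ?N = "M \<Otimes>\<^sub>M M" and ?K = "J \<times> (UNIV :: bool set)"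
  let ?X = "vector_sum e"
  define V where "V b v = (\<Sum>j\<in>J. v (j, b) *\<^sub>R e j)" for b :: bool and v :: "'j \<times> bool \<Rightarrow> real"
  have [measurable]: "V b \<in> borel_measurable (\<Pi>\<^sub>M p\<in>?K. borel)" for b
    unfolding V_def[abs_def]
    by (intro borel_measurable_sum borel_measurable_scaleR borel_measurable_const measurable_component_singleton) simp
  define S where "S = {v \<in> space (\<Pi>\<^sub>M p\<in>?K. borel). t < norm (V True v) \<and> norm (V False v) \<le> s}"
  have S [measurable]: "S \<in> sets (\<Pi>\<^sub>M p\<in>?K. borel)" unfolding S_def by measurable
  have prod: "measure ?N (A \<times> B) = measure M A * measure M B" if "A \<in> sets M" "B \<in> sets M" for A B
    using that by (simp add: measure_def emeasure_pair_measure_Times enn2real_mult)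
  have "measure ?N ((\<lambda>z. \<lambda>p\<in>?K. copies p z) -` S \<inter> space ?N)
      = measure (distr ?N (\<Pi>\<^sub>M p\<in>?K. borel) (\<lambda>z. \<lambda>p\<in>?K. copies p z)) S"
    by (subst measure_distr) auto
  also have "\<dots> = measure ?N ((\<lambda>z. \<lambda>p\<in>?K. rotated p z) -` S \<inter> space ?N)"
    unfolding copies_rotated_distr by (subst measure_distr) auto
  finally have eq: "measure ?N ((\<lambda>z. \<lambda>p\<in>?K. copies p z) -` S \<inter> space ?N)
      = measure ?N ((\<lambda>z. \<lambda>p\<in>?K. rotated p z) -` S \<inter> space ?N)" .
  have "V True (\<lambda>p\<in>?K. copies p z) = ?X (fst z)" "V False (\<lambda>p\<in>?K. copies p z) = ?X (snd z)" for z
    by (simp_all add: V_def vector_sum_def copies_def)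
  then have "(\<lambda>z. \<lambda>p\<in>?K. copies p z) -` S \<inter> space ?N
      = {\<omega> \<in> space M. t < norm (?X \<omega>)} \<times> {\<omega> \<in> space M. norm (?X \<omega>) \<le> s}"
    by (auto simp: S_def space_PiM space_pair_measure)
  then have lhs: "measure ?N ((\<lambda>z. \<lambda>p\<in>?K. copies p z) -` S \<inter> space ?N)
      = measure M {\<omega> \<in> space M. t < norm (?X \<omega>)} * measure M {\<omega> \<in> space M. norm (?X \<omega>) \<le> s}"
    by (simp add: prod)
  have rot: "V True (\<lambda>p\<in>?K. rotated p z) = (1 / sqrt 2) *\<^sub>R (?X (fst z) + ?X (snd z))"
    "V False (\<lambda>p\<in>?K. rotated p z) = (1 / sqrt 2) *\<^sub>R (?X (fst z) - ?X (snd z))" for z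
    by (simp_all add: V_def vector_sum_def rotated_def scaleR_sum_right scaleR_add_right
        scaleR_diff_right add_divide_distrib diff_divide_distrib scaleR_add_left scaleR_diff_left
        sum.distrib sum_subtractf)
  have far: "(t - s) / sqrt 2 < norm x \<and> (t - s) / sqrt 2 < norm y"
    if "t < norm ((1 / sqrt 2) *\<^sub>R (x + y))" "norm ((1 / sqrt 2) *\<^sub>R (x - y)) \<le> s" for x y :: 'b
  proof -
    have r: "(0::real) < sqrt 2" by simp
    have "t * sqrt 2 < norm (x + y)" "norm (x - y) \<le> s * sqrt 2"
      using that unfolding norm_scaleR by (simp_all add: field_simps)
    moreover have "2 * norm x = norm ((x + y) + (x - y))" "2 * norm y = norm ((x + y) - (x - y))"
      by (simp_all flip: scaleR_2)
    then have "norm (x + y) \<le> 2 * norm x + norm (x - y)" "norm (x + y) \<le> 2 * norm y + norm (x - y)"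
      using norm_triangle_ineq2[of "x + y" "- (x - y)"] norm_triangle_ineq2[of "x + y" "x - y"]
      by (auto simp: norm_minus_commute)
    ultimately have "(t - s) * sqrt 2 < 2 * norm x" "(t - s) * sqrt 2 < 2 * norm y"
      by (simp_all add: left_diff_distrib)
    moreover have half: "(t - s) / sqrt 2 = (t - s) * sqrt 2 / 2"
      by (simp add: field_simps)
    ultimately show ?thesis unfolding half by linarith
  qed
  let ?F = "{\<omega> \<in> space M. (t - s) / sqrt 2 < norm (?X \<omega>)}"
  have "(\<lambda>z. \<lambda>p\<in>?K. rotated p z) -` S \<inter> space ?N \<subseteq> ?F \<times> ?F"
  proof
    fix z assume "z \<in> (\<lambda>z. \<lambda>p\<in>?K. rotated p z) -` S \<inter> space ?N"
    then have "t < norm (V True (\<lambda>p\<in>?K. rotated p z))" "norm (V False (\<lambda>p\<in>?K. rotated p z)) \<le> s"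
      "z \<in> space ?N"
      by (auto simp: S_def)
    then show "z \<in> ?F \<times> ?F"
      unfolding rot using far[of "?X (fst z)" "?X (snd z)"] by (auto simp: space_pair_measure)
  qed
  then have "measure ?N ((\<lambda>z. \<lambda>p\<in>?K. rotated p z) -` S \<inter> space ?N) \<le> measure ?N (?F \<times> ?F)"
    by (intro P.P.finite_measure_mono) auto
  also have "\<dots> = (measure M ?F)\<^sup>2"
    by (simp add: prod power2_eq_square)
  finally show ?thesis using lhs eq by simp
qed

text \<open>
  If the norm is at most \<open>s\<close> with probability at least \<open>19/20\<close>, iterating the inequality along
  the thresholds \<open>3^n * s\<close> gives tails of at most \<open>(1/19) ^ (2 ^ n)\<close>, hence of at most
  \<open>(1/18) ^ Suc n\<close>. The constants are such that this still beats \<open>9 ^ Suc n * s^2\<close>, the square of the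
  next threshold: the products are \<open>s^2 / 2 ^ Suc n\<close>.
\<close>

lemma fernique_tail:
  fixes e :: "'j \<Rightarrow> 'b::{real_normed_vector, second_countable_topology}"
  assumes s: "0 < s" and p: "19 / 20 \<le> measure M {\<omega> \<in> space M. norm (vector_sum e \<omega>) \<le> s}"
  shows "measure M {\<omega> \<in> space M. 3 ^ n * s < norm (vector_sum e \<omega>)} \<le> (1 / 18) ^ Suc n"
proof -
  define \<alpha> where "\<alpha> = measure M {\<omega> \<in> space M. norm (vector_sum e \<omega>) \<le> s}"
  define G where "G u = measure M {\<omega> \<in> space M. u < norm (vector_sum e \<omega>)}" for u
  have a: "19 / 20 \<le> \<alpha>" "\<alpha> \<le> 1" using p by (auto simp: \<alpha>_def)
  have G_anti: "G v \<le> G u" if "u \<le> v" for u v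
    unfolding G_def using that by (intro finite_measure_mono) auto
  have step: "G (3 ^ Suc n * s) * \<alpha> \<le> (G (3 ^ n * s))\<^sup>2" for n
  proof -
    have "G (3 ^ Suc n * s) * \<alpha> \<le> (G ((3 ^ Suc n * s - s) / sqrt 2))\<^sup>2"
      unfolding G_def \<alpha>_def by (rule fernique_inequality)
    also have "(G ((3 ^ Suc n * s - s) / sqrt 2))\<^sup>2 \<le> (G (3 ^ n * s))\<^sup>2"
    proof -
      have "sqrt 2 \<le> (2::real)" by (simp add: real_le_lsqrt)
      then have "3 ^ n * s * sqrt 2 \<le> 2 * (3 ^ n * s)" using s mult_left_mono[of "sqrt 2" 2 "3 ^ n * s"] by simp
      moreover have "s \<le> 3 ^ n * s" using s by simp
      ultimately have "3 ^ n * s * sqrt 2 \<le> 3 ^ Suc n * s - s" unfolding power_Suc by linarith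
      then have "3 ^ n * s \<le> (3 ^ Suc n * s - s) / sqrt 2" by (subst pos_le_divide_eq) auto
      then show ?thesis by (intro power_mono G_anti) (auto simp: G_def)
    qed
    finally show ?thesis .
  qed
  have G0: "G s = 1 - \<alpha>"
  proof -
    have "{\<omega> \<in> space M. s < norm (vector_sum e \<omega>)} = space M - {\<omega> \<in> space M. norm (vector_sum e \<omega>) \<le> s}"
      by auto
    then show ?thesis unfolding G_def \<alpha>_def by (simp add: prob_compl)
  qed
  have "G (3 ^ n * s) / \<alpha> \<le> (1 / 19) ^ (2 ^ n)"
  proof (induction n)
    case 0
    then show ?case using a G0 by (simp add: field_simps)
  next
    case (Suc n)
    have "G (3 ^ Suc n * s) / \<alpha> \<le> (G (3 ^ n * s) / \<alpha>)\<^sup>2"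
      using step[of n] a by (simp add: power_divide divide_simps power2_eq_square)
    also have "\<dots> \<le> ((1 / 19) ^ (2 ^ n))\<^sup>2"
      using a by (intro power_mono Suc) (auto simp: G_def)
    also have "\<dots> = (1 / 19) ^ (2 ^ Suc n)" by (simp add: power_mult[symmetric] mult.commute)
    finally show ?case .
  qed
  moreover have "G (3 ^ n * s) \<le> G (3 ^ n * s) / \<alpha>"
    using a by (simp add: le_divide_eq G_def mult_left_le)
  moreover have "(1 / 19 :: real) ^ (2 ^ n) \<le> (1 / 19) ^ Suc n"
    using less_exp[of n] by (intro power_decreasing) (auto simp: Suc_le_eq)
  moreover have "(1 / 19 :: real) ^ Suc n \<le> (1 / 18) ^ Suc n" by (intro power_mono) auto
  ultimately show ?thesis unfolding G_def by linarith
qed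

text \<open>The constant depends on \<open>s\<close> only, neither on the number of summands nor on the vectors, so that the
  bound survives a passage to the limit.\<close>

theorem fernique_second_moment:
  fixes e :: "'j \<Rightarrow> 'b::{real_normed_vector, second_countable_topology}"
  assumes s: "0 < s" and p: "19 / 20 \<le> measure M {\<omega> \<in> space M. norm (vector_sum e \<omega>) \<le> s}"
  shows "(\<integral>\<^sup>+\<omega>. ennreal ((norm (vector_sum e \<omega>))\<^sup>2) \<partial>M) \<le> ennreal (2 * s\<^sup>2)"
proof -
  let ?X = "vector_sum e"
  let ?T = "\<lambda>n. {\<omega> \<in> space M. 3 ^ n * s < norm (?X \<omega>)}"
  have pw: "ennreal ((norm (?X \<omega>))\<^sup>2)
      \<le> ennreal (s\<^sup>2) + (\<Sum>n. ennreal ((3 ^ Suc n * s)\<^sup>2) * indicator (?T n) \<omega>)" if \<omega>: "\<omega> \<in> space M" for \<omega>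
  proof -
    obtain m where m: "norm (?X \<omega>) / s < 3 ^ m" using real_arch_pow[of 3] by auto
    have ex: "norm (?X \<omega>) \<le> 3 ^ m * s" using m s by (simp add: divide_less_eq)
    define n where "n = (LEAST m. norm (?X \<omega>) \<le> 3 ^ m * s)"
    have n: "norm (?X \<omega>) \<le> 3 ^ n * s" unfolding n_def using ex by (rule LeastI)
    show ?thesis
    proof (cases n)
      case 0
      then have "(norm (?X \<omega>))\<^sup>2 \<le> s\<^sup>2" using n by (intro power_mono) auto
      then have "ennreal ((norm (?X \<omega>))\<^sup>2) \<le> ennreal (s\<^sup>2)" by (rule ennreal_leI)
      then show ?thesis by (rule order_trans) simp
    next
      case (Suc k)
      then have "\<not> norm (?X \<omega>) \<le> 3 ^ k * s"
        using not_less_Least[of k "\<lambda>m. norm (?X \<omega>) \<le> 3 ^ m * s"] unfolding n_def by simp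
      then have k: "\<omega> \<in> ?T k" using \<omega> by simp
      have "(norm (?X \<omega>))\<^sup>2 \<le> (3 ^ Suc k * s)\<^sup>2" using n Suc by (intro power_mono) auto
      then have "ennreal ((norm (?X \<omega>))\<^sup>2) \<le> ennreal ((3 ^ Suc k * s)\<^sup>2) * indicator (?T k) \<omega>"
        using k by (simp add: ennreal_leI del: power_Suc)
      also have "\<dots> \<le> (\<Sum>n. ennreal ((3 ^ Suc n * s)\<^sup>2) * indicator (?T n) \<omega>)"
        by (rule ennreal_suminf_ge_term)
      finally show ?thesis by (rule order_trans) simp
    qed
  qed
  have "(\<integral>\<^sup>+\<omega>. ennreal ((norm (?X \<omega>))\<^sup>2) \<partial>M)
      \<le> (\<integral>\<^sup>+\<omega>. ennreal (s\<^sup>2) + (\<Sum>n. ennreal ((3 ^ Suc n * s)\<^sup>2) * indicator (?T n) \<omega>) \<partial>M)"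
    by (intro nn_integral_mono pw)
  also have "\<dots> = ennreal (s\<^sup>2) + (\<Sum>n. ennreal ((3 ^ Suc n * s)\<^sup>2) * emeasure M (?T n))"
    by (simp add: nn_integral_add nn_integral_suminf nn_integral_cmult emeasure_space_1 del: power_Suc)
  also have "\<dots> \<le> ennreal (s\<^sup>2) + (\<Sum>n. ennreal (s\<^sup>2 * (1 / 2) ^ Suc n))"
  proof (intro add_left_mono suminf_le allI)
    fix n
    have "(3 ^ Suc n * s)\<^sup>2 * measure M (?T n) \<le> (3 ^ Suc n * s)\<^sup>2 * (1 / 18) ^ Suc n"
      by (intro mult_left_mono fernique_tail s p) simp
    also have "(3 ^ Suc n * s)\<^sup>2 * (1 / 18) ^ Suc n = s\<^sup>2 * (9 * (1 / 18)) ^ Suc n"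
    proof -
      have "(3 ^ Suc n * s)\<^sup>2 = 9 ^ Suc n * s\<^sup>2"
        by (simp add: power2_eq_square flip: power_mult_distrib)
      then show ?thesis unfolding power_mult_distrib by (simp only: ac_simps)
    qed
    finally have "(3 ^ Suc n * s)\<^sup>2 * measure M (?T n) \<le> s\<^sup>2 * (1 / 2) ^ Suc n" by simp
    then show "ennreal ((3 ^ Suc n * s)\<^sup>2) * emeasure M (?T n) \<le> ennreal (s\<^sup>2 * (1 / 2) ^ Suc n)"
      by (simp add: emeasure_eq_measure ennreal_leI del: power_Suc flip: ennreal_mult)
  qed auto
  also have "(\<Sum>n. ennreal (s\<^sup>2 * (1 / 2) ^ Suc n)) = ennreal (s\<^sup>2)"
    using sums_mult[OF power_half_series, of "s\<^sup>2"] by (intro suminf_ennreal_eq) auto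
  also have "ennreal (s\<^sup>2) + ennreal (s\<^sup>2) = ennreal (2 * s\<^sup>2)" by (simp flip: ennreal_plus)
  finally show ?thesis .
qed

end

section \<open>Approximation by finitely many point evaluations\<close>

lemma apply_bcontfun_sum:
  "apply_bcontfun (\<Sum>i\<in>I. g i) x = (\<Sum>i\<in>I. apply_bcontfun (g i) x :: 'b::real_normed_vector)"
  by (induction I rule: infinite_finite_induct) (auto simp: plus_bcontfun.rep_eq)

text \<open>The function \<open>b (x, i)\<close> carries the \<open>i\<close>-th coordinate of the value at \<open>x\<close>.\<close>

definition interpolate :: "('x set) \<Rightarrow> ('x \<times> 'd \<Rightarrow> ('x::compact_metric_space \<Rightarrow>\<^sub>C (real ^ 'd))) \<Rightarrow>
    ('x \<Rightarrow> real ^ 'd) \<Rightarrow> ('x \<Rightarrow>\<^sub>C (real ^ 'd))" where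
  "interpolate F b f = (\<Sum>p\<in>F \<times> UNIV. (f (fst p) $ snd p) *\<^sub>R b p)"

text \<open>
  With a continuous partition of unity \<open>\<phi> p\<close> subordinate to the balls of radius \<open>\<delta>\<close> around
  finitely many centres \<open>p\<close>, the function \<open>\<Sum>p. \<phi> p * f p\<close> averages values of \<open>f\<close> at distance
  less than \<open>\<delta>\<close>.
\<close>

lemma interpolation_at_scale:
  assumes \<delta>: "0 < \<delta>"
  obtains F and b :: "'x \<times> 'd \<Rightarrow> ('x::compact_metric_space \<Rightarrow>\<^sub>C (real ^ 'd))"
  where "finite F"
    "\<And>f. norm (interpolate F b (apply_bcontfun f)) \<le> norm f"
    "\<And>f e. 0 \<le> e \<Longrightarrow> (\<And>x y. dist x y < \<delta> \<Longrightarrow> dist (apply_bcontfun f x) (apply_bcontfun f y) \<le> e) \<Longrightarrow>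
       dist (interpolate F b (apply_bcontfun f)) f \<le> e"
proof -
  obtain F :: "'x set" where F: "finite F" "UNIV \<subseteq> (\<Union>p\<in>F. ball p \<delta>)"
    using compact_UNIV[where 'a='x] \<delta> unfolding compact_eq_totally_bounded by blast
  define w where "w p x = max 0 (\<delta> - dist p x)" for p x :: 'x
  define W where "W x = (\<Sum>p\<in>F. w p x)" for x
  have w0: "0 \<le> w p x" for p x by (simp add: w_def)
  have W: "0 < W x" for x
  proof -
    obtain p where "p \<in> F" "dist p x < \<delta>" using F(2) by (force simp: mem_ball)
    then show ?thesis unfolding W_def
      by (intro sum_pos2[OF F(1), of p]) (auto simp: w_def)
  qed
  define \<phi> where "\<phi> p x = w p x / W x" for p x
  have \<phi>0: "0 \<le> \<phi> p x" for p x using w0 W[of x] by (simp add: \<phi>_def)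
  have \<phi>_sum: "(\<Sum>p\<in>F. \<phi> p x) = 1" for x
    using W[of x] by (simp add: \<phi>_def W_def flip: sum_divide_distrib)
  have \<phi>_cont: "continuous_on UNIV (\<phi> p)" for p
    unfolding \<phi>_def W_def w_def using W by (intro continuous_intros) (auto simp: W_def w_def less_imp_neq[symmetric])
  define b where "b q = coordinate_function (snd q) (\<phi> (fst q))" for q :: "'x \<times> 'd"
  have val: "apply_bcontfun (interpolate F b f) x = (\<Sum>p\<in>F. \<phi> p x *\<^sub>R f p)" for f :: "'x \<Rightarrow> real ^ 'd" and x
  proof -
    have "apply_bcontfun (interpolate F b f) x = (\<Sum>q\<in>F \<times> UNIV. (f (fst q) $ snd q) *\<^sub>R \<phi> (fst q) x *\<^sub>R axis (snd q) 1)"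
      unfolding interpolate_def b_def
      by (simp add: apply_bcontfun_sum scaleR_bcontfun.rep_eq apply_coordinate_function \<phi>_cont)
    also have "\<dots> = (\<Sum>p\<in>F. \<Sum>i\<in>UNIV. (f p $ i) *\<^sub>R \<phi> p x *\<^sub>R axis i 1)"
      by (simp add: sum.cartesian_product split_def)
    also have "\<dots> = (\<Sum>p\<in>F. \<phi> p x *\<^sub>R (\<Sum>i\<in>UNIV. (f p $ i) *\<^sub>R axis i 1))"
      by (simp add: scaleR_sum_right mult.commute)
    also have "\<dots> = (\<Sum>p\<in>F. \<phi> p x *\<^sub>R f p)"
      using basis_expansion[of "f p" for p] by (simp add: scalar_mult_eq_scaleR)
    finally show ?thesis .
  qed
  show thesis
  proof (rule that[OF F(1)])
    fix f :: "'x \<Rightarrow>\<^sub>C (real ^ 'd)"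
    show "norm (interpolate F b (apply_bcontfun f)) \<le> norm f"
    proof (rule norm_bound)
      fix x
      have "norm (apply_bcontfun (interpolate F b (apply_bcontfun f)) x)
          \<le> (\<Sum>p\<in>F. \<phi> p x * norm (apply_bcontfun f p))"
        unfolding val using \<phi>0 by (intro sum_norm_le) simp
      also have "\<dots> \<le> (\<Sum>p\<in>F. \<phi> p x * norm f)"
        by (intro sum_mono mult_left_mono norm_bounded \<phi>0)
      also have "\<dots> = norm f" using \<phi>_sum[of x] by (simp flip: sum_distrib_right)
      finally show "norm (apply_bcontfun (interpolate F b (apply_bcontfun f)) x) \<le> norm f" .
    qed
    fix e :: real
    assume e: "0 \<le> e" and osc: "\<And>x y. dist x y < \<delta> \<Longrightarrow> dist (apply_bcontfun f x) (apply_bcontfun f y) \<le> e"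
    show "dist (interpolate F b (apply_bcontfun f)) f \<le> e"
    proof (rule dist_bound)
      fix x
      have "apply_bcontfun f x = (\<Sum>p\<in>F. \<phi> p x *\<^sub>R apply_bcontfun f x)"
        using \<phi>_sum[of x] by (simp flip: scaleR_sum_left)
      then have "dist (apply_bcontfun (interpolate F b (apply_bcontfun f)) x) (apply_bcontfun f x)
          = norm (\<Sum>p\<in>F. \<phi> p x *\<^sub>R (apply_bcontfun f p - apply_bcontfun f x))"
        unfolding val dist_norm by (simp add: scaleR_diff_right sum_subtractf)
      also have "\<dots> \<le> (\<Sum>p\<in>F. \<phi> p x * e)"
      proof (rule sum_norm_le)
        fix p
        have "\<phi> p x * norm (apply_bcontfun f p - apply_bcontfun f x) \<le> \<phi> p x * e"
        proof (cases "dist p x < \<delta>")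
          case True
          then show ?thesis using osc[OF True] \<phi>0[of p x] by (intro mult_left_mono) (auto simp: dist_norm)
        next
          case False
          then have "\<phi> p x = 0" by (simp add: \<phi>_def w_def)
          then show ?thesis by simp
        qed
        then show "norm (\<phi> p x *\<^sub>R (apply_bcontfun f p - apply_bcontfun f x)) \<le> \<phi> p x * e"
          using \<phi>0 by simp
      qed
      also have "\<dots> = e" using \<phi>_sum[of x] by (simp flip: sum_distrib_right)
      finally show "dist (apply_bcontfun (interpolate F b (apply_bcontfun f)) x) (apply_bcontfun f x) \<le> e" .
    qed
  qed
qed

lemma finite_rank_approximation:
  obtains F and b :: "nat \<Rightarrow> 'x \<times> 'd \<Rightarrow> ('x::compact_metric_space \<Rightarrow>\<^sub>C (real ^ 'd))"
  where "\<And>n. finite (F n)"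
    "\<And>n f. norm (interpolate (F n) (b n) (apply_bcontfun f)) \<le> norm f"
    "\<And>f. (\<lambda>n. interpolate (F n) (b n) (apply_bcontfun f)) \<longlonglongrightarrow> f"
proof -
  have "\<exists>F (b :: 'x \<times> 'd \<Rightarrow> ('x \<Rightarrow>\<^sub>C (real ^ 'd))). finite F \<and>
      (\<forall>f. norm (interpolate F b (apply_bcontfun f)) \<le> norm f) \<and>
      (\<forall>f e. 0 \<le> e \<longrightarrow>
        (\<forall>x y. dist x y < inverse (real (Suc n)) \<longrightarrow> dist (apply_bcontfun f x) (apply_bcontfun f y) \<le> e) \<longrightarrow>
        dist (interpolate F b (apply_bcontfun f)) f \<le> e)" for n
  proof -
    have "0 < inverse (real (Suc n))" by simp
    from interpolation_at_scale[OF this] show ?thesis by metis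
  qed
  then obtain F and b :: "nat \<Rightarrow> 'x \<times> 'd \<Rightarrow> ('x \<Rightarrow>\<^sub>C (real ^ 'd))"
    where fin: "\<And>n. finite (F n)"
      and norm: "\<And>n f. norm (interpolate (F n) (b n) (apply_bcontfun f)) \<le> norm f"
      and close: "\<And>n f e. 0 \<le> e \<Longrightarrow>
        (\<forall>x y. dist x y < inverse (real (Suc n)) \<longrightarrow> dist (apply_bcontfun f x) (apply_bcontfun f y) \<le> e) \<Longrightarrow>
        dist (interpolate (F n) (b n) (apply_bcontfun f)) f \<le> e" by metis
  have "(\<lambda>n. interpolate (F n) (b n) (apply_bcontfun f)) \<longlonglongrightarrow> f" for f
  proof (rule metric_LIMSEQ_I)
    fix r :: real assume "0 < r"
    have "uniformly_continuous_on UNIV (apply_bcontfun f)"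
      by (rule compact_uniformly_continuous) (auto simp: compact_UNIV)
    then obtain d where d: "0 < d"
      "\<And>x y. dist x y < d \<Longrightarrow> dist (apply_bcontfun f x) (apply_bcontfun f y) < r / 2"
      unfolding uniformly_continuous_on_def using \<open>0 < r\<close>
      by (metis UNIV_I dist_commute half_gt_zero)
    obtain N where N: "inverse (real (Suc N)) < d" using reals_Archimedean[OF d(1)] by blast
    have "dist (interpolate (F n) (b n) (apply_bcontfun f)) f < r" if "N \<le> n" for n
    proof -
      have "inverse (real (Suc n)) \<le> inverse (real (Suc N))" using that by (intro le_imp_inverse_le) auto
      then have "dist (apply_bcontfun f x) (apply_bcontfun f y) \<le> r / 2" if "dist x y < inverse (real (Suc n))" for x y
        using d(2)[of x y] N that by linarith
      then have "dist (interpolate (F n) (b n) (apply_bcontfun f)) f \<le> r / 2"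
        using \<open>0 < r\<close> by (intro close) auto
      then show ?thesis using \<open>0 < r\<close> by linarith
    qed
    then show "\<exists>N. \<forall>n\<ge>N. dist (interpolate (F n) (b n) (apply_bcontfun f)) f < r" by blast
  qed
  with fin norm show thesis by (rule that)
qed

section \<open>From Gaussian processes to Gaussian random elements\<close>

lemma (in prob_space) gaussian_law_integrable:
  fixes Y :: "'a \<Rightarrow> real"
  assumes [measurable]: "Y \<in> borel_measurable M" and law: "gaussian_law (distr M borel Y)"
  shows "integrable M Y"
proof -
  let ?D = "distr M borel Y"
  have "integrable ?D (\<lambda>x. x)"
    using law unfolding gaussian_law_def
  proof (elim disjE exE conjE)
    fix m assume "?D = return borel m"
    then show ?thesis
      by (simp add: integrable_iff_bounded nn_integral_return)
  next
    fix m s :: real assume "0 < s" "?D = density lborel (normal_density m s)"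
    then show ?thesis
      by (simp add: integrable_density integrable_normal_moment_nz_1)
  qed
  then show ?thesis by (simp add: integrable_distr_eq)
qed

lemma integrable_vecI:
  fixes f :: "'a \<Rightarrow> real ^ 'd"
  assumes "\<And>i. integrable M (\<lambda>x. f x $ i)"
  shows "integrable M f"
proof -
  have "f = (\<lambda>x. \<Sum>i\<in>UNIV. (f x $ i) *\<^sub>R axis i 1)"
    using basis_expansion[of "f x" for x] by (simp add: fun_eq_iff scalar_mult_eq_scaleR)
  moreover have "integrable M (\<lambda>x. \<Sum>i\<in>UNIV. (f x $ i) *\<^sub>R axis i (1::real))"
    using assms by (intro Bochner_Integration.integrable_sum integrable_scaleR_left) auto
  ultimately show ?thesis by metis
qed

lemma borel_measurable_component:
  fixes f :: "'a \<Rightarrow> real ^ 'd"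
  shows "f \<in> borel_measurable M \<Longrightarrow> (\<lambda>x. f x $ i) \<in> borel_measurable M"
  by (rule borel_measurable_continuous_on[of "\<lambda>v. v $ i"]) (auto intro!: continuous_intros)

lemma inner_sum_product:
  fixes v :: "'x \<Rightarrow> real ^ 'd"
  shows "(\<Sum>x\<in>F. (\<chi> i. c (x, i)) \<bullet> v x) = (\<Sum>p\<in>F \<times> UNIV. c p * v (fst p) $ snd p)"
  by (simp add: inner_vec_def sum.cartesian_product split_def)

lemma gaussian_process_linear_combination:
  fixes \<xi> :: "'w \<Rightarrow> 'x::topological_space \<Rightarrow> real ^ 'd"
  assumes "continuous_gaussian_process M \<xi>" "finite F"
  shows "gaussian_law (distr M borel (\<lambda>\<omega>. \<Sum>p\<in>F \<times> UNIV. c p * \<xi> \<omega> (fst p) $ snd p))"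
proof -
  let ?a = "\<lambda>x. \<chi> i. c (x, i)"
  have [measurable]: "(\<lambda>\<omega>. \<xi> \<omega> x) \<in> borel_measurable M" for x
    using assms(1) by (simp add: continuous_gaussian_process_def)
  have "gaussian_law (distr (fdd M \<xi> F) borel (\<lambda>v. \<Sum>x\<in>F. ?a x \<bullet> v x))"
    using assms by (simp add: continuous_gaussian_process_def gaussian_law_on_def)
  also have "distr (fdd M \<xi> F) borel (\<lambda>v. \<Sum>x\<in>F. ?a x \<bullet> v x)
      = distr M borel ((\<lambda>v. \<Sum>x\<in>F. ?a x \<bullet> v x) \<circ> (\<lambda>\<omega>. \<lambda>x\<in>F. \<xi> \<omega> x))"
    unfolding fdd_def by (rule distr_distr) measurable
  also have "((\<lambda>v. \<Sum>x\<in>F. ?a x \<bullet> v x) \<circ> (\<lambda>\<omega>. \<lambda>x\<in>F. \<xi> \<omega> x)) = (\<lambda>\<omega>. \<Sum>x\<in>F. ?a x \<bullet> \<xi> \<omega> x)"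
    by (auto simp: fun_eq_iff intro!: sum.cong)
  finally show ?thesis by (simp only: inner_sum_product)
qed

locale centered_gaussian_process = prob_space M
  for M :: "'w measure" +
  fixes \<xi> :: "'w \<Rightarrow> 'x::compact_metric_space \<Rightarrow> real ^ 'd"
  assumes gp: "continuous_gaussian_process M \<xi>" and mean: "\<And>x. mean_function M \<xi> x = 0"
begin

definition random_function :: "'w \<Rightarrow> ('x \<Rightarrow>\<^sub>C (real ^ 'd))" where
  "random_function \<omega> = (if \<omega> \<in> space M then Bcontfun (\<xi> \<omega>) else 0)"

lemma apply_random_function: "\<omega> \<in> space M \<Longrightarrow> apply_bcontfun (random_function \<omega>) = \<xi> \<omega>"
  using gp by (simp add: random_function_def apply_Bcontfun_continuous continuous_gaussian_process_def)

lemma component_borel: "(\<lambda>\<omega>. \<xi> \<omega> x $ i) \<in> borel_measurable M"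
  using gp by (intro borel_measurable_component) (simp add: continuous_gaussian_process_def)

lemma component_integral: "(\<integral>\<omega>. \<xi> \<omega> x $ i \<partial>M) = 0"
proof -
  have "integrable M (\<lambda>\<omega>. \<xi> \<omega> x $ i)" for i
  proof (rule gaussian_law_integrable[OF component_borel])
    have "(\<Sum>p\<in>{x} \<times> UNIV. (if snd p = i then 1 else 0) * \<xi> \<omega> (fst p) $ snd p) = \<xi> \<omega> x $ i" for \<omega>
    proof -
      have delta: "(if j = i then 1 else 0) * r = (if j = i then r else 0)" for j :: 'd and r :: real by simp
      have "(\<Sum>p\<in>{x} \<times> UNIV. (if snd p = i then 1 else 0) * \<xi> \<omega> (fst p) $ snd p)
          = (\<Sum>y\<in>{x}. \<Sum>j\<in>UNIV. (if j = i then 1 else 0) * \<xi> \<omega> y $ j)"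
        unfolding sum.cartesian_product by (simp only: split_def)
      also have "\<dots> = \<xi> \<omega> x $ i" unfolding delta by simp
      finally show ?thesis .
    qed
    with gaussian_process_linear_combination[OF gp, of "{x}" "\<lambda>p. if snd p = i then 1 else 0"]
    show "gaussian_law (distr M borel (\<lambda>\<omega>. \<xi> \<omega> x $ i))" by simp
  qed
  then have "integrable M (\<lambda>\<omega>. \<xi> \<omega> x)" by (rule integrable_vecI)
  then have "(\<integral>\<omega>. \<xi> \<omega> x $ i \<partial>M) = (\<integral>\<omega>. \<xi> \<omega> x \<partial>M) $ i"
    by (rule integral_bounded_linear[OF bounded_linear_vec_nth])
  with mean[of x] show ?thesis by (simp add: mean_function_def)
qed

lemma finite_family:
  assumes "finite F"
  shows "centered_gaussian_family M (\<lambda>p \<omega>. \<xi> \<omega> (fst p) $ snd p) (F \<times> UNIV)"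
  by unfold_locales
    (use assms component_borel component_integral gaussian_process_linear_combination[OF gp] in auto)

lemma interpolate_family:
  assumes "finite F"
  shows "interpolate F b (\<xi> \<omega>)
    = centered_gaussian_family.vector_sum (\<lambda>p \<omega>. \<xi> \<omega> (fst p) $ snd p) (F \<times> UNIV) b \<omega>"
  unfolding interpolate_def
  by (rule centered_gaussian_family.vector_sum_def[OF finite_family[OF assms], symmetric])

text \<open>This reduces questions about the random function to interpolations, which are finite combinations of
  fixed functions with jointly Gaussian coefficients.\<close>

lemma approximation:
  obtains F and b :: "nat \<Rightarrow> 'x \<times> 'd \<Rightarrow> ('x \<Rightarrow>\<^sub>C (real ^ 'd))"
  where "\<And>n. finite (F n)"
    "\<And>n. (\<lambda>\<omega>. interpolate (F n) (b n) (\<xi> \<omega>)) \<in> borel_measurable M"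
    "\<And>n \<omega>. \<omega> \<in> space M \<Longrightarrow> norm (interpolate (F n) (b n) (\<xi> \<omega>)) \<le> norm (random_function \<omega>)"
    "\<And>\<omega>. \<omega> \<in> space M \<Longrightarrow> (\<lambda>n. interpolate (F n) (b n) (\<xi> \<omega>)) \<longlonglongrightarrow> random_function \<omega>"
proof -
  obtain F and b :: "nat \<Rightarrow> 'x \<times> 'd \<Rightarrow> ('x \<Rightarrow>\<^sub>C (real ^ 'd))"
    where F: "\<And>n. finite (F n)"
      and b: "\<And>n f. norm (interpolate (F n) (b n) (apply_bcontfun f)) \<le> norm f"
        "\<And>f. (\<lambda>n. interpolate (F n) (b n) (apply_bcontfun f)) \<longlonglongrightarrow> f"
    by (rule finite_rank_approximation) blast
  show thesis
  proof (rule that[of F b])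
    show "(\<lambda>\<omega>. interpolate (F n) (b n) (\<xi> \<omega>)) \<in> borel_measurable M" for n
      unfolding interpolate_def
      by (intro borel_measurable_sum borel_measurable_scaleR component_borel borel_measurable_const)
    show "norm (interpolate (F n) (b n) (\<xi> \<omega>)) \<le> norm (random_function \<omega>)" if "\<omega> \<in> space M" for n \<omega>
      using b(1)[of n "random_function \<omega>"] by (simp add: apply_random_function that)
    show "(\<lambda>n. interpolate (F n) (b n) (\<xi> \<omega>)) \<longlonglongrightarrow> random_function \<omega>" if "\<omega> \<in> space M" for \<omega>
      using b(2)[of "random_function \<omega>"] by (simp add: apply_random_function that)
  qed (rule F)
qed

lemma random_function_borel [measurable]: "random_function \<in> borel_measurable M"
proof -
  obtain F and b :: "nat \<Rightarrow> 'x \<times> 'd \<Rightarrow> ('x \<Rightarrow>\<^sub>C (real ^ 'd))"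
    where "\<And>n. (\<lambda>\<omega>. interpolate (F n) (b n) (\<xi> \<omega>)) \<in> borel_measurable M"
      "\<And>\<omega>. \<omega> \<in> space M \<Longrightarrow> (\<lambda>n. interpolate (F n) (b n) (\<xi> \<omega>)) \<longlonglongrightarrow> random_function \<omega>"
    by (rule approximation) blast
  then show ?thesis by (rule borel_measurable_LIMSEQ_metric)
qed

text \<open>
  The interpolations are dominated by the random function, so one threshold \<open>s\<close> serves in the
  moment bound for all of them, and the bound passes to the limit by Fatou's lemma.
\<close>

lemma random_function_square_integrable: "integrable M (\<lambda>\<omega>. (norm (random_function \<omega>))\<^sup>2)"
proof -
  let ?X = random_function
  obtain F and b :: "nat \<Rightarrow> 'x \<times> 'd \<Rightarrow> ('x \<Rightarrow>\<^sub>C (real ^ 'd))"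
    where F: "\<And>n. finite (F n)"
      and meas [measurable]: "\<And>n. (\<lambda>\<omega>. interpolate (F n) (b n) (\<xi> \<omega>)) \<in> borel_measurable M"
      and dom: "\<And>n \<omega>. \<omega> \<in> space M \<Longrightarrow> norm (interpolate (F n) (b n) (\<xi> \<omega>)) \<le> norm (?X \<omega>)"
      and lim: "\<And>\<omega>. \<omega> \<in> space M \<Longrightarrow> (\<lambda>n. interpolate (F n) (b n) (\<xi> \<omega>)) \<longlonglongrightarrow> ?X \<omega>"
    by (rule approximation) blast
  define A where "A n = {\<omega> \<in> space M. norm (?X \<omega>) \<le> real n}" for n
  have "(\<lambda>n. prob (A n)) \<longlonglongrightarrow> prob (\<Union>n. A n)"
    by (rule finite_Lim_measure_incseq) (auto simp: A_def incseq_def)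
  moreover have "(\<Union>n. A n) = space M" using real_arch_simple by (auto simp: A_def)
  ultimately have "(\<lambda>n. prob (A n)) \<longlonglongrightarrow> 1" by (simp add: prob_space)
  then have "eventually (\<lambda>n. 19 / 20 < prob (A n)) sequentially" by (rule order_tendstoD(1)) simp
  then have "eventually (\<lambda>n. 19 / 20 < prob (A n) \<and> 0 < n) sequentially"
    using eventually_gt_at_top[of 0] by (rule eventually_conj)
  then obtain m where m: "19 / 20 < prob (A m)" "0 < m"
    using eventually_happens'[OF sequentially_bot] by blast
  define s where "s = real m"
  have s: "0 < s" using m by (simp add: s_def)
  have bound: "(\<integral>\<^sup>+\<omega>. ennreal ((norm (interpolate (F n) (b n) (\<xi> \<omega>)))\<^sup>2) \<partial>M) \<le> ennreal (2 * s\<^sup>2)" for n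
  proof -
    interpret G: centered_gaussian_family M "\<lambda>p \<omega>. \<xi> \<omega> (fst p) $ snd p" "F n \<times> UNIV"
      by (rule finite_family[OF F])
    have "prob (A m) \<le> prob {\<omega> \<in> space M. norm (interpolate (F n) (b n) (\<xi> \<omega>)) \<le> s}"
      using dom[of _ n] by (intro finite_measure_mono) (auto simp: A_def s_def intro: order_trans)
    then show ?thesis
      using G.fernique_second_moment[OF s, of "b n"] m
      unfolding interpolate_family[OF F] by simp
  qed
  have "(\<integral>\<^sup>+\<omega>. ennreal ((norm (?X \<omega>))\<^sup>2) \<partial>M)
      = (\<integral>\<^sup>+\<omega>. liminf (\<lambda>n. ennreal ((norm (interpolate (F n) (b n) (\<xi> \<omega>)))\<^sup>2)) \<partial>M)"
  proof (rule nn_integral_cong)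
    fix \<omega> assume "\<omega> \<in> space M"
    then have "(\<lambda>n. ennreal ((norm (interpolate (F n) (b n) (\<xi> \<omega>)))\<^sup>2)) \<longlonglongrightarrow> ennreal ((norm (?X \<omega>))\<^sup>2)"
      by (intro tendsto_intros lim)
    then show "ennreal ((norm (?X \<omega>))\<^sup>2) = liminf (\<lambda>n. ennreal ((norm (interpolate (F n) (b n) (\<xi> \<omega>)))\<^sup>2))"
      by (intro lim_imp_Liminf[symmetric]) auto
  qed
  also have "\<dots> \<le> liminf (\<lambda>n. \<integral>\<^sup>+\<omega>. ennreal ((norm (interpolate (F n) (b n) (\<xi> \<omega>)))\<^sup>2) \<partial>M)"
    by (rule nn_integral_liminf) simp
  also have "\<dots> \<le> liminf (\<lambda>n. ennreal (2 * s\<^sup>2))"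
    by (intro Liminf_mono always_eventually allI bound)
  also have "\<dots> = ennreal (2 * s\<^sup>2)" by (simp add: Liminf_const)
  finally show ?thesis
    by (intro integrableI_bounded) (auto simp: less_top[symmetric] top_unique)
qed

lemma random_function_integrable: "integrable M random_function"
proof -
  have "integrable M (\<lambda>\<omega>. norm (random_function \<omega>))"
    by (rule square_integrable_imp_integrable[OF _ random_function_square_integrable]) measurable
  then show ?thesis by (simp add: integrable_norm_iff)
qed

lemma functional_times_integrable:
  "integrable M (\<lambda>\<omega>. blinfun_apply L (random_function \<omega>) *\<^sub>R random_function \<omega>)"
proof (rule Bochner_Integration.integrable_bound)
  show "integrable M (\<lambda>\<omega>. norm L * (norm (random_function \<omega>))\<^sup>2)"
    using random_function_square_integrable by simp
  have [measurable]: "(\<lambda>\<omega>. blinfun_apply L (random_function \<omega>)) \<in> borel_measurable M"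
    by (rule borel_measurable_continuous_on[OF _ random_function_borel]) (intro continuous_intros)
  show "(\<lambda>\<omega>. blinfun_apply L (random_function \<omega>) *\<^sub>R random_function \<omega>) \<in> borel_measurable M"
    by measurable
  have "norm (blinfun_apply L f *\<^sub>R f) \<le> norm (norm L * (norm f)\<^sup>2)" for f :: "'x \<Rightarrow>\<^sub>C (real ^ 'd)"
    using mult_right_mono[OF norm_blinfun[of L f] norm_ge_zero[of f]]
    by (simp add: power2_eq_square mult.assoc abs_mult)
  then show "AE \<omega> in M. norm (blinfun_apply L (random_function \<omega>) *\<^sub>R random_function \<omega>)
      \<le> norm (norm L * (norm (random_function \<omega>))\<^sup>2)" by auto
qed

text \<open>
  For an interpolation, \<open>L\<close> yields a linear combination of the process values, hence a centered
  Gaussian variable. Domination by \<open>norm L * norm X\<close> gives convergence of the variances, so the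
  characteristic functions converge to that of a Gaussian law.
\<close>

lemma functional_gaussian: "gaussian_law (distr M borel (\<lambda>\<omega>. blinfun_apply L (random_function \<omega>)))"
proof -
  let ?X = random_function
  obtain F and b :: "nat \<Rightarrow> 'x \<times> 'd \<Rightarrow> ('x \<Rightarrow>\<^sub>C (real ^ 'd))"
    where F: "\<And>n. finite (F n)"
      and meas [measurable]: "\<And>n. (\<lambda>\<omega>. interpolate (F n) (b n) (\<xi> \<omega>)) \<in> borel_measurable M"
      and dom: "\<And>n \<omega>. \<omega> \<in> space M \<Longrightarrow> norm (interpolate (F n) (b n) (\<xi> \<omega>)) \<le> norm (?X \<omega>)"
      and lim: "\<And>\<omega>. \<omega> \<in> space M \<Longrightarrow> (\<lambda>n. interpolate (F n) (b n) (\<xi> \<omega>)) \<longlonglongrightarrow> ?X \<omega>"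
    by (rule approximation) blast
  define Z where "Z n \<omega> = blinfun_apply L (interpolate (F n) (b n) (\<xi> \<omega>))" for n \<omega>
  define Z' where "Z' \<omega> = blinfun_apply L (?X \<omega>)" for \<omega>
  have [measurable]: "Z n \<in> borel_measurable M" for n
    unfolding Z_def[abs_def]
    by (rule borel_measurable_continuous_on[OF _ meas]) (intro continuous_intros)
  have [measurable]: "Z' \<in> borel_measurable M"
    unfolding Z'_def[abs_def]
    by (rule borel_measurable_continuous_on[OF _ random_function_borel]) (intro continuous_intros)
  have Z_lim: "(\<lambda>n. Z n \<omega>) \<longlonglongrightarrow> Z' \<omega>" if "\<omega> \<in> space M" for \<omega>
    unfolding Z_def Z'_def by (intro tendsto_intros lim that)
  have Z_dom: "(Z n \<omega>)\<^sup>2 \<le> (norm L)\<^sup>2 * (norm (?X \<omega>))\<^sup>2" if "\<omega> \<in> space M" for n \<omega>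
  proof -
    have "\<bar>Z n \<omega>\<bar> \<le> norm L * norm (interpolate (F n) (b n) (\<xi> \<omega>))"
      using norm_blinfun[of L] by (simp add: Z_def)
    also have "\<dots> \<le> norm L * norm (?X \<omega>)" by (intro mult_left_mono dom that) simp
    finally have "\<bar>Z n \<omega>\<bar>\<^sup>2 \<le> (norm L * norm (?X \<omega>))\<^sup>2" by (rule power_mono) simp
    then show ?thesis by (simp add: power_mult_distrib)
  qed
  have char_Z: "(CLINT \<omega>|M. iexp (t * Z n \<omega>)) = complex_of_real (exp (- (t\<^sup>2 * (\<integral>\<omega>. (Z n \<omega>)\<^sup>2 \<partial>M) / 2)))" for n t
  proof -
    interpret G: centered_gaussian_family M "\<lambda>p \<omega>. \<xi> \<omega> (fst p) $ snd p" "F n \<times> UNIV"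
      by (rule finite_family[OF F])
    have Z_comb: "Z n = G.comb (\<lambda>p. blinfun_apply L (b n p))"
      by (simp add: fun_eq_iff Z_def interpolate_def blinfun.sum_right blinfun.scaleR_right mult.commute)
    show ?thesis unfolding Z_comb by (rule centered_gaussian(2)[OF G.comb_borel G.Y_gauss G.comb_mean])
  qed
  define v where "v = (\<integral>\<omega>. (Z' \<omega>)\<^sup>2 \<partial>M)"
  have v_lim: "(\<lambda>n. \<integral>\<omega>. (Z n \<omega>)\<^sup>2 \<partial>M) \<longlonglongrightarrow> v"
    unfolding v_def
  proof (rule integral_dominated_convergence)
    show "integrable M (\<lambda>\<omega>. (norm L)\<^sup>2 * (norm (?X \<omega>))\<^sup>2)"
      using random_function_square_integrable by simp
    show "AE \<omega> in M. (\<lambda>n. (Z n \<omega>)\<^sup>2) \<longlonglongrightarrow> (Z' \<omega>)\<^sup>2"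
      by (intro AE_I2 tendsto_intros Z_lim)
    show "AE \<omega> in M. norm ((Z n \<omega>)\<^sup>2) \<le> (norm L)\<^sup>2 * (norm (?X \<omega>))\<^sup>2" for n
      using Z_dom by (intro AE_I2) simp
  qed measurable
  have "(CLINT \<omega>|M. iexp (t * Z' \<omega>)) = complex_of_real (exp (- (t\<^sup>2 * v / 2)))" for t
  proof (rule LIMSEQ_unique)
    show "(\<lambda>n. CLINT \<omega>|M. iexp (t * Z n \<omega>)) \<longlonglongrightarrow> (CLINT \<omega>|M. iexp (t * Z' \<omega>))"
    proof (rule integral_dominated_convergence[where w = "\<lambda>_. 1"])
      show "AE \<omega> in M. (\<lambda>n. iexp (t * Z n \<omega>)) \<longlonglongrightarrow> iexp (t * Z' \<omega>)"
        by (intro AE_I2 tendsto_intros Z_lim)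
    qed auto
    show "(\<lambda>n. CLINT \<omega>|M. iexp (t * Z n \<omega>)) \<longlonglongrightarrow> complex_of_real (exp (- (t\<^sup>2 * v / 2)))"
      unfolding char_Z by (intro tendsto_intros v_lim) simp
  qed
  then have "gaussian_law (distr M borel Z')"
    by (intro gaussian_law_of_char[of _ v]) (auto simp: v_def)
  then show ?thesis by (simp add: Z'_def[abs_def])
qed

lemma random_function_centered: "(\<integral>\<omega>. random_function \<omega> \<partial>M) = 0"
proof (rule bcontfun_eqI)
  fix x
  have "apply_bcontfun (\<integral>\<omega>. random_function \<omega> \<partial>M) x $ i = 0" for i
  proof -
    have "blinfun_apply (eval_functional x i) (\<integral>\<omega>. random_function \<omega> \<partial>M)
        = (\<integral>\<omega>. blinfun_apply (eval_functional x i) (random_function \<omega>) \<partial>M)"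
      by (rule integral_bounded_linear[OF blinfun.bounded_linear_right random_function_integrable, symmetric])
    also have "\<dots> = (\<integral>\<omega>. \<xi> \<omega> x $ i \<partial>M)"
      by (intro Bochner_Integration.integral_cong) (auto simp: eval_functional.rep_eq apply_random_function)
    finally show ?thesis by (simp add: component_integral eval_functional.rep_eq)
  qed
  then show "apply_bcontfun (\<integral>\<omega>. random_function \<omega> \<partial>M) x = apply_bcontfun 0 x"
    by (simp add: vec_eq_iff zero_bcontfun.rep_eq)
qed

text \<open>Square integrability of the norm makes all Bochner integrals in the definition converge.\<close>

theorem gaussian_process_is_element:
  "centered_gaussian_C_element M \<xi> (\<lambda>L. \<integral>\<omega>. blinfun_apply L (random_function \<omega>) *\<^sub>R random_function \<omega> \<partial>M)"
  unfolding centered_gaussian_C_element_def gaussian_element_def centered_def has_covariance_operator_def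
  using apply_random_function functional_gaussian random_function_integrable random_function_centered
    functional_times_integrable random_function_borel
  by (intro exI[of _ random_function]) (auto simp: has_bochner_integral_iff)

end

section \<open>From Gaussian random elements to Gaussian processes\<close>

lemma covariance_operator_integral:
  assumes "has_covariance_operator M X K"
  shows "integrable M (\<lambda>\<omega>. blinfun_apply L (X \<omega>) * blinfun_apply L' (X \<omega>))"
    and "blinfun_apply L' (K L) = (\<integral>\<omega>. blinfun_apply L (X \<omega>) * blinfun_apply L' (X \<omega>) \<partial>M)"
proof -
  have "has_bochner_integral M (\<lambda>\<omega>. blinfun_apply L' (blinfun_apply L (X \<omega>) *\<^sub>R X \<omega>)) (blinfun_apply L' (K L))"
    using assms unfolding has_covariance_operator_def
    by (intro has_bochner_integral_bounded_linear[OF blinfun.bounded_linear_right]) auto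
  then have "has_bochner_integral M (\<lambda>\<omega>. blinfun_apply L (X \<omega>) * blinfun_apply L' (X \<omega>)) (blinfun_apply L' (K L))"
    by (simp add: blinfun.scaleR_right)
  then show "integrable M (\<lambda>\<omega>. blinfun_apply L (X \<omega>) * blinfun_apply L' (X \<omega>))"
    "blinfun_apply L' (K L) = (\<integral>\<omega>. blinfun_apply L (X \<omega>) * blinfun_apply L' (X \<omega>) \<partial>M)"
    by (auto simp: has_bochner_integral_iff)
qed

lemma covariance_operator_symmetric:
  assumes "has_covariance_operator M X K"
  shows "blinfun_apply L' (K L) = blinfun_apply L (K L')"
  using covariance_operator_integral(2)[OF assms, of L' L] covariance_operator_integral(2)[OF assms, of L L']
  by (simp add: mult.commute)

definition kernel_of_operator ::
    "((('x::topological_space \<Rightarrow>\<^sub>C (real ^ 'd)) \<Rightarrow>\<^sub>L real) \<Rightarrow> ('x \<Rightarrow>\<^sub>C (real ^ 'd))) \<Rightarrow> 'x \<Rightarrow> 'x \<Rightarrow> real ^ 'd ^ 'd" where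
  "kernel_of_operator K x y = (\<chi> i l. blinfun_apply (eval_functional y l) (K (eval_functional x i)))"

lemma function_from_kernel_of_operator: "function_from_operator (kernel_of_operator K) K"
  by (simp add: function_from_operator_def kernel_of_operator_def)

text \<open>
  For fixed \<open>y\<close> and \<open>l\<close>, let \<open>\<delta> = eval_functional y l\<close>. By symmetry of the covariance operator the
  function \<open>x \<mapsto> k x y $ i $ l\<close> is the \<open>i\<close>-th component of the continuous function \<open>K \<delta>\<close>, so the sum of
  integrals is \<open>L (K \<delta>)\<close>, which by symmetry again is \<open>\<delta> (K L)\<close>.
\<close>

lemma operator_from_kernel_of_operator:
  fixes K :: "(('x::compact_metric_space \<Rightarrow>\<^sub>C (real ^ 'd)) \<Rightarrow>\<^sub>L real) \<Rightarrow> ('x \<Rightarrow>\<^sub>C (real ^ 'd))"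
  assumes K: "has_covariance_operator M X K"
  shows "operator_from_function (kernel_of_operator K) K"
  unfolding operator_from_function_def
proof (intro allI impI conjI)
  fix L and \<mu> :: "'d \<Rightarrow> 'x set \<Rightarrow> real" and y l i
  assume rep: "represents \<mu> L"
  have k: "(\<lambda>x. kernel_of_operator K x y $ i $ l) = (\<lambda>x. apply_bcontfun (K (eval_functional y l)) x $ i)" for i
    using covariance_operator_symmetric[OF K, of "eval_functional y l"]
    by (simp add: fun_eq_iff kernel_of_operator_def eval_functional.rep_eq)
  show "signed_integrable (\<mu> i) (\<lambda>x. kernel_of_operator K x y $ i $ l)"
    unfolding k using rep
    by (intro signed_integrable_continuous continuous_intros) (auto simp: represents_def)
  have "apply_bcontfun (K L) y $ l = blinfun_apply (eval_functional y l) (K L)"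
    by (simp add: eval_functional.rep_eq)
  also have "\<dots> = blinfun_apply L (K (eval_functional y l))"
    by (rule covariance_operator_symmetric[OF K])
  also have "\<dots> = (\<Sum>i\<in>UNIV. signed_integral (\<mu> i) (\<lambda>x. kernel_of_operator K x y $ i $ l))"
    unfolding k using rep by (simp add: represents_def)
  finally show "apply_bcontfun (K L) y $ l
      = (\<Sum>i\<in>UNIV. signed_integral (\<mu> i) (\<lambda>x. kernel_of_operator K x y $ i $ l))" .
qed

text \<open>Linear combinations of process values are continuous linear functionals of the random element.\<close>

theorem gaussian_element_is_process:
  fixes \<xi> :: "'w \<Rightarrow> 'x::compact_metric_space \<Rightarrow> real ^ 'd"
  assumes "prob_space M" and el: "centered_gaussian_C_element M \<xi> K"
  shows "centered_continuous_gp M \<xi> (kernel_of_operator K)"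
    and "operator_from_function (kernel_of_operator K) K"
proof -
  interpret prob_space M by fact
  obtain X :: "'w \<Rightarrow> ('x \<Rightarrow>\<^sub>C (real ^ 'd))"
    where X: "\<And>\<omega>. \<omega> \<in> space M \<Longrightarrow> apply_bcontfun (X \<omega>) = \<xi> \<omega>"
      and X_borel [measurable]: "X \<in> borel_measurable M"
      and gauss: "\<And>L :: ('x \<Rightarrow>\<^sub>C (real ^ 'd)) \<Rightarrow>\<^sub>L real. gaussian_law (distr M borel (\<lambda>\<omega>. blinfun_apply L (X \<omega>)))"
      and X_mean: "has_bochner_integral M X 0"
      and K: "has_covariance_operator M X K"
    using el by (auto simp: centered_gaussian_C_element_def gaussian_element_def centered_def)
  show "operator_from_function (kernel_of_operator K) K"
    by (rule operator_from_kernel_of_operator[OF K])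
  have eval: "blinfun_apply (eval_functional x i) (X \<omega>) = \<xi> \<omega> x $ i" if "\<omega> \<in> space M" for x i \<omega>
    by (simp add: eval_functional.rep_eq X that)
  have value_bounded_linear: "bounded_linear (\<lambda>f :: 'x \<Rightarrow>\<^sub>C (real ^ 'd). apply_bcontfun f x)" for x
    by (rule bounded_linear_intro[where K=1])
      (auto simp: plus_bcontfun.rep_eq scaleR_bcontfun.rep_eq norm_bounded)
  have value_integral: "has_bochner_integral M (\<lambda>\<omega>. \<xi> \<omega> x) 0" for x
  proof -
    have "has_bochner_integral M (\<lambda>\<omega>. apply_bcontfun (X \<omega>) x) (apply_bcontfun 0 x)"
      by (rule has_bochner_integral_bounded_linear[OF value_bounded_linear X_mean])
    then show ?thesis
      by (subst (asm) has_bochner_integral_cong[OF refl _ refl, of M _ "\<lambda>\<omega>. \<xi> \<omega> x"])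
        (auto simp: X zero_bcontfun.rep_eq)
  qed
  have borel [measurable]: "(\<lambda>\<omega>. \<xi> \<omega> x) \<in> borel_measurable M" for x
    using value_integral[of x] by (simp add: has_bochner_integral_iff borel_measurable_integrable)
  have mean: "mean_function M \<xi> x = 0" for x
    unfolding mean_function_def using value_integral by (rule has_bochner_integral_integral_eq)
  have "continuous_gaussian_process M \<xi>"
    unfolding continuous_gaussian_process_def
  proof (intro conjI allI impI ballI borel)
    show "continuous_on UNIV (\<xi> \<omega>)" if "\<omega> \<in> space M" for \<omega>
      by (simp flip: X[OF that])
    fix J :: "'x set" assume "finite J"
    show "gaussian_law_on J (fdd M \<xi> J)"
      unfolding gaussian_law_on_def
    proof
      fix a :: "'x \<Rightarrow> real ^ 'd"
      define L :: "('x \<Rightarrow>\<^sub>C (real ^ 'd)) \<Rightarrow>\<^sub>L real"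
        where "L = (\<Sum>x\<in>J. \<Sum>i\<in>UNIV. (a x $ i) *\<^sub>R eval_functional x i)"
      have "distr (fdd M \<xi> J) borel (\<lambda>v. \<Sum>x\<in>J. a x \<bullet> v x)
          = distr M borel ((\<lambda>v. \<Sum>x\<in>J. a x \<bullet> v x) \<circ> (\<lambda>\<omega>. \<lambda>x\<in>J. \<xi> \<omega> x))"
        unfolding fdd_def by (rule distr_distr) measurable
      also have "\<dots> = distr M borel (\<lambda>\<omega>. blinfun_apply L (X \<omega>))"
        by (intro distr_cong)
          (auto simp: L_def blinfun.sum_left blinfun.scaleR_left eval inner_vec_def)
      finally show "gaussian_law (distr (fdd M \<xi> J) borel (\<lambda>v. \<Sum>x\<in>J. a x \<bullet> v x))"
        using gauss by simp
    qed
  qed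
  moreover have "covariance_function M \<xi> x y = kernel_of_operator K x y" for x y
  proof -
    have "(\<integral>\<omega>. \<xi> \<omega> x $ i * \<xi> \<omega> y $ l \<partial>M)
        = blinfun_apply (eval_functional y l) (K (eval_functional x i))" for i l
      unfolding covariance_operator_integral(2)[OF K]
      by (intro Bochner_Integration.integral_cong) (auto simp: eval)
    then show ?thesis
      by (simp add: covariance_function_def mean kernel_of_operator_def vec_eq_iff)
  qed
  ultimately show "centered_continuous_gp M \<xi> (kernel_of_operator K)"
    by (simp add: centered_continuous_gp_def mean)
qed

text \<open>As every functional is represented by measures, the kernel determines the operator.\<close>

lemma operator_from_function_unique:
  fixes K K' :: "(('x::compact_metric_space \<Rightarrow>\<^sub>C (real ^ 'd)) \<Rightarrow>\<^sub>L real) \<Rightarrow> ('x \<Rightarrow>\<^sub>C (real ^ 'd))"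
  assumes "operator_from_function k K" "operator_from_function k K'"
  shows "K = K'"
proof
  fix L :: "('x \<Rightarrow>\<^sub>C (real ^ 'd)) \<Rightarrow>\<^sub>L real"
  obtain \<mu> where "represents \<mu> L" using riesz_representation by blast
  then show "K L = K' L"
    using assms by (intro bcontfun_eqI) (simp add: operator_from_function_def vec_eq_iff)
qed

lemma centered_continuous_gp_imp_element:
  fixes \<xi> :: "'w \<Rightarrow> 'x::compact_metric_space \<Rightarrow> real ^ 'd"
  assumes "prob_space M" and process: "centered_continuous_gp M \<xi> k"
  obtains K where "centered_gaussian_C_element M \<xi> K"
    "operator_from_function k K" "function_from_operator k K"
proof -
  interpret centered_gaussian_process M \<xi>
    using assms by (auto simp: centered_gaussian_process_def centered_gaussian_process_axioms_def
        centered_continuous_gp_def)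
  define K where "K L = (\<integral>\<omega>. blinfun_apply L (random_function \<omega>) *\<^sub>R random_function \<omega> \<partial>M)" for L
  have el: "centered_gaussian_C_element M \<xi> K"
    using gaussian_process_is_element by (simp add: K_def[abs_def])
  note * = gaussian_element_is_process[OF assms(1) el]
  have "k x y = kernel_of_operator K x y" for x y
    using process *(1) unfolding centered_continuous_gp_def by metis
  then have "k = kernel_of_operator K" by (simp add: fun_eq_iff)
  then show thesis
    using el *(2) function_from_kernel_of_operator by (intro that[of K]) simp_all
qed

theorem theorem2p2:
  fixes M :: "'w measure"
    and \<xi> :: "'w \<Rightarrow> 'x::compact_metric_space \<Rightarrow> real ^ 'd"
    and k :: "'x \<Rightarrow> 'x \<Rightarrow> real ^ 'd ^ 'd"
    and K :: "(('x \<Rightarrow>\<^sub>C (real ^ 'd)) \<Rightarrow>\<^sub>L real) \<Rightarrow> ('x \<Rightarrow>\<^sub>C (real ^ 'd))"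
  assumes "prob_space M"
  shows "(\<forall>L :: ('x \<Rightarrow>\<^sub>C (real ^ 'd)) \<Rightarrow>\<^sub>L real. \<exists>\<mu>. represents \<mu> L) \<and>
    (centered_continuous_gp M \<xi> k \<longleftrightarrow>
       (\<exists>K'. centered_gaussian_C_element M \<xi> K' \<and>
             operator_from_function k K' \<and> function_from_operator k K')) \<and>
    (centered_gaussian_C_element M \<xi> K \<longleftrightarrow>
       (\<exists>k'. centered_continuous_gp M \<xi> k' \<and>
             operator_from_function k' K \<and> function_from_operator k' K))"
proof (intro conjI allI iffI)
  show "\<exists>\<mu>. represents \<mu> L" for L :: "('x \<Rightarrow>\<^sub>C (real ^ 'd)) \<Rightarrow>\<^sub>L real"
    by (rule riesz_representation)
next
  assume "centered_continuous_gp M \<xi> k"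
  then show "\<exists>K'. centered_gaussian_C_element M \<xi> K' \<and> operator_from_function k K' \<and> function_from_operator k K'"
    using centered_continuous_gp_imp_element[OF assms] by metis
next
  assume "\<exists>K'. centered_gaussian_C_element M \<xi> K' \<and> operator_from_function k K' \<and> function_from_operator k K'"
  then obtain K' where K': "centered_gaussian_C_element M \<xi> K'" "function_from_operator k K'" by blast
  have "k = kernel_of_operator K'"
    using K'(2) by (simp add: fun_eq_iff function_from_operator_def kernel_of_operator_def)
  then show "centered_continuous_gp M \<xi> k"
    using gaussian_element_is_process(1)[OF assms K'(1)] by simp
next
  assume "centered_gaussian_C_element M \<xi> K"
  then show "\<exists>k'. centered_continuous_gp M \<xi> k' \<and> operator_from_function k' K \<and> function_from_operator k' K"
    using gaussian_element_is_process[OF assms] function_from_kernel_of_operator by blast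
next
  assume "\<exists>k'. centered_continuous_gp M \<xi> k' \<and> operator_from_function k' K \<and> function_from_operator k' K"
  then obtain k' where k': "centered_continuous_gp M \<xi> k'" "operator_from_function k' K" by blast
  obtain K' where "centered_gaussian_C_element M \<xi> K'" "operator_from_function k' K'"
    using centered_continuous_gp_imp_element[OF assms k'(1)] by metis
  moreover have "K' = K" using operator_from_function_unique calculation(2) k'(2) by blast
  ultimately show "centered_gaussian_C_element M \<xi> K" by simp
qed

end
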